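(* Let $M$ be a finite-dimensional complete Riemannian manifold of class $C^\infty$, $I=[0,1]$, $n\ge1$, $\mathbf p=(p_0,\dots,p_{n-1})\in M^n$, $t_0,\dots,t_{n-1}\in I$ pairwise distinct, and $\tau\ne0$ a real constant. Then $\mathcal J(x):=\tfrac12\int_0^1\big(\|\nabla_t\dot x\|^2+\tau^2\|\dot x\|^2\big)dt$ is weakly proper on $H^2(I,M)_{\mathbf p}$ with respect to $C^1(I,M)$; that is, every subset $U\subset H^2(I,M)_{\mathbf p}$ on which $\mathcal J$ is bounded is relatively compact in $C^1(I,M)$.
   Context: $H^2(I,M)$ is the Hilbert manifold of curves $x:I\to M$ of Sobolev class $H^2=W^{2,2}$, contained in the Banach manifold $C^1(I,M)$ of $C^1$ curves with the $C^1$ topology; $\nabla_t$ is covariant differentiation along $x$ (Levi-Civita connection). $H^2(I,M)_{\mathbf p}:=\{x\in H^2(I,M):x(t_i)=p_i,\ i=0,\dots,n-1\}$, a submanifold of $H^2(I,M)$. *)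

theory Defs
  imports "HOL-Analysis.Analysis"
begin

section \<open>The model space\<close>

text \<open>
  The model space is \<open>\<real>\<^sup>d\<close> with \<open>d \<ge> 0\<close>. The class \<^class>\<open>euclidean_space\<close> is not used because it
  forces \<open>d \<ge> 1\<close>. All superclasses other than \<^class>\<open>real_inner\<close> are automatic in finite
  dimension; they are listed only to make the library facts about them applicable.
\<close>

class finite_dim_space = real_inner + banach + heine_borel + second_countable_topology +
  assumes finite_dim: "\<exists>B. finite B \<and> (\<forall>x. \<exists>c. x = (\<Sum>b\<in>B. c b *\<^sub>R b))"

instance euclidean_space \<subseteq> finite_dim_space
proof
  show "\<exists>B::'a set. finite B \<and> (\<forall>x. \<exists>c. x = (\<Sum>b\<in>B. c b *\<^sub>R b))"
    by (metis finite_Basis euclidean_representation)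
qed


section \<open>Smooth manifolds\<close>

text \<open>In finite dimension, continuity of all iterated directional derivatives is the usual \<open>C\<^sup>k\<close>
  condition. The set \<open>S\<close> is always open below.\<close>

primrec Ck_on :: "nat \<Rightarrow> 'a::real_normed_vector set \<Rightarrow> ('a \<Rightarrow> 'b::real_normed_vector) \<Rightarrow> bool" where
  "Ck_on 0 S f \<longleftrightarrow> continuous_on S f"
| "Ck_on (Suc k) S f \<longleftrightarrow>
     (\<forall>x\<in>S. f differentiable (at x)) \<and> (\<forall>v. Ck_on k S (\<lambda>x. frechet_derivative f (at x) v))"

definition smooth_on :: "'a::real_normed_vector set \<Rightarrow> ('a \<Rightarrow> 'b::real_normed_vector) \<Rightarrow> bool" where
  "smooth_on S f \<longleftrightarrow> (\<forall>k. Ck_on k S f)"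

text \<open>A chart is a pair of its domain and its coordinate map; values of the map outside the domain
  are irrelevant.\<close>

type_synonym ('m, 'e) chart = "'m set \<times> ('m \<Rightarrow> 'e)"

definition transition :: "('m, 'e) chart \<Rightarrow> ('m, 'e) chart \<Rightarrow> 'e \<Rightarrow> 'e" where
  "transition c d = snd d \<circ> inv_into (fst c) (snd c)"

definition overlap :: "('m, 'e) chart \<Rightarrow> ('m, 'e) chart \<Rightarrow> 'e set" where
  "overlap c d = snd c ` (fst c \<inter> fst d)"

text \<open>The manifold is the whole type \<open>'m\<close>. No countability axiom is imposed beyond the Hausdorff
  property: every component carrying a Riemannian metric is metrizable anyway.\<close>

definition smooth_atlas :: "('m::t2_space, 'e::finite_dim_space) chart set \<Rightarrow> bool" where
  "smooth_atlas A \<longleftrightarrow>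
     \<Union> (fst ` A) = UNIV \<and>
     (\<forall>c\<in>A. open (fst c) \<and> open (snd c ` fst c) \<and>
        homeomorphism (fst c) (snd c ` fst c) (snd c) (inv_into (fst c) (snd c))) \<and>
     (\<forall>c\<in>A. \<forall>d\<in>A. smooth_on (overlap c d) (transition c d))"


section \<open>Riemannian metrics\<close>

text \<open>A metric is given by its coordinate representations: \<open>g c y u v\<close> is the inner product of the
  tangent vectors with components \<open>u\<close>, \<open>v\<close> in the chart \<open>c\<close> at the point with coordinates \<open>y\<close>.\<close>

type_synonym ('m, 'e) metric_rep = "('m, 'e) chart \<Rightarrow> 'e \<Rightarrow> 'e \<Rightarrow> 'e \<Rightarrow> real"

definition riemannian_manifold ::
    "('m::t2_space, 'e::finite_dim_space) chart set \<Rightarrow> ('m, 'e) metric_rep \<Rightarrow> bool" where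
  "riemannian_manifold A g \<longleftrightarrow>
     smooth_atlas A \<and>
     (\<forall>c\<in>A. \<forall>y\<in>snd c ` fst c.
        bilinear (g c y) \<and> (\<forall>u v. g c y u v = g c y v u) \<and> (\<forall>u. u \<noteq> 0 \<longrightarrow> g c y u u > 0)) \<and>
     (\<forall>c\<in>A. \<forall>u v. smooth_on (snd c ` fst c) (\<lambda>y. g c y u v)) \<and>
     (\<forall>c\<in>A. \<forall>d\<in>A. \<forall>y\<in>overlap c d. \<forall>u v.
        g c y u v = g d (transition c d y)
          (frechet_derivative (transition c d) (at y) u)
          (frechet_derivative (transition c d) (at y) v))"

text \<open>A tangent vector at \<open>q\<close> is represented by the family \<open>w\<close> of its components in all charts
  around \<open>q\<close>, so its length may be computed in an arbitrary one of them.\<close>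

definition chart_at :: "('m, 'e) chart set \<Rightarrow> 'm \<Rightarrow> ('m, 'e) chart" where
  "chart_at A q = (SOME c. c \<in> A \<and> q \<in> fst c)"

definition sq_norm ::
    "('m, 'e) chart set \<Rightarrow> ('m, 'e) metric_rep \<Rightarrow> 'm \<Rightarrow> (('m, 'e) chart \<Rightarrow> 'e) \<Rightarrow> real" where
  "sq_norm A g q w = (let c = chart_at A q in g c (snd c q) (w c) (w c))"

text \<open>The Christoffel symbols of the Levi-Civita connection, as a bilinear map:
  \<open>g\<^sub>k\<^sub>l \<Gamma>\<^sup>l\<^sub>i\<^sub>j = (\<partial>\<^sub>i g\<^sub>j\<^sub>k + \<partial>\<^sub>j g\<^sub>i\<^sub>k - \<partial>\<^sub>k g\<^sub>i\<^sub>j) / 2\<close>.\<close>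

definition christoffel ::
    "('m, 'e::real_normed_vector) metric_rep \<Rightarrow> ('m, 'e) chart \<Rightarrow> 'e \<Rightarrow> 'e \<Rightarrow> 'e \<Rightarrow> 'e" where
  "christoffel g c y u v = (THE w. \<forall>z. g c y w z =
     (frechet_derivative (\<lambda>y. g c y v z) (at y) u
      + frechet_derivative (\<lambda>y. g c y u z) (at y) v
      - frechet_derivative (\<lambda>y. g c y u v) (at y) z) / 2)"


section \<open>Curves\<close>

text \<open>\<open>velocity T x t c\<close> is the component in the chart \<open>c\<close> of the velocity at time \<open>t\<close> of a curve
  with parameter interval \<open>T\<close> (one-sided at end points); meaningful if \<open>x t \<in> fst c\<close>.\<close>

definition velocity ::
    "real set \<Rightarrow> (real \<Rightarrow> 'm) \<Rightarrow> real \<Rightarrow> ('m, 'e::real_normed_vector) chart \<Rightarrow> 'e" where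
  "velocity T x t c = vector_derivative (snd c \<circ> x) (at t within T)"

text \<open>Covariant derivative along \<open>x\<close> of a vector field \<open>V\<close> along \<open>x\<close>, in the chart \<open>c\<close>. For \<open>H\<^sup>2\<close>
  curves the derivative of the velocity exists only almost everywhere; values at the other times
  are irrelevant, since they only occur under an integral.\<close>

definition cov_deriv ::
    "('m, 'e::real_normed_vector) metric_rep \<Rightarrow> real set \<Rightarrow> (real \<Rightarrow> 'm) \<Rightarrow>
     (real \<Rightarrow> ('m, 'e) chart \<Rightarrow> 'e) \<Rightarrow> real \<Rightarrow> ('m, 'e) chart \<Rightarrow> 'e" where
  "cov_deriv g T x V t c =
     vector_derivative (\<lambda>s. V s c) (at t within T)
     + christoffel g c (snd c (x t)) (velocity T x t c) (V t c)"

definition C1_curve_on ::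
    "('m::topological_space, 'e::real_normed_vector) chart set \<Rightarrow> real set \<Rightarrow> (real \<Rightarrow> 'm) \<Rightarrow> bool" where
  "C1_curve_on A T x \<longleftrightarrow>
     continuous_on T x \<and>
     (\<forall>c\<in>A. (\<forall>t\<in>{t\<in>T. x t \<in> fst c}. (snd c \<circ> x) differentiable (at t within T)) \<and>
            continuous_on {t\<in>T. x t \<in> fst c} (\<lambda>t. velocity T x t c))"

definition piecewise_C1_curve ::
    "('m::topological_space, 'e::real_normed_vector) chart set \<Rightarrow> (real \<Rightarrow> 'm) \<Rightarrow> bool" where
  "piecewise_C1_curve A x \<longleftrightarrow>
     (\<exists>S. finite S \<and> {0, 1} \<subseteq> S \<and> S \<subseteq> {0..1} \<and>
        (\<forall>a\<in>S. \<forall>b\<in>S. a < b \<and> {a<..<b} \<inter> S = {} \<longrightarrow> C1_curve_on A {a..b} x))"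

definition curve_length ::
    "('m, 'e::real_normed_vector) chart set \<Rightarrow> ('m, 'e) metric_rep \<Rightarrow> (real \<Rightarrow> 'm) \<Rightarrow> real" where
  "curve_length A g x = (LINT t:{0..1}|lebesgue. sqrt (sq_norm A g (x t) (velocity {0..1} x t)))"

text \<open>Points in different components have infinite distance.\<close>

definition riem_dist ::
    "('m::topological_space, 'e::real_normed_vector) chart set \<Rightarrow> ('m, 'e) metric_rep \<Rightarrow>
     'm \<Rightarrow> 'm \<Rightarrow> ereal" where
  "riem_dist A g p q =
     (INF x\<in>{x. piecewise_C1_curve A x \<and> x 0 = p \<and> x 1 = q}. ereal (curve_length A g x))"

definition riem_complete ::
    "('m::topological_space, 'e::real_normed_vector) chart set \<Rightarrow> ('m, 'e) metric_rep \<Rightarrow> bool" where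
  "riem_complete A g \<longleftrightarrow>
     (\<forall>s::nat \<Rightarrow> 'm.
        (\<forall>e::real. e > 0 \<longrightarrow> (\<exists>N. \<forall>m\<ge>N. \<forall>n\<ge>N. riem_dist A g (s m) (s n) < ereal e)) \<longrightarrow>
        (\<exists>l. (\<lambda>n. riem_dist A g (s n) l) \<longlonglongrightarrow> 0))"


section \<open>The curve spaces\<close>

text \<open>Curves are normalised to be \<^const>\<open>undefined\<close> outside \<open>[0,1]\<close>, so that they are determined by
  their values on the interval.\<close>

definition C1_curves ::
    "('m::topological_space, 'e::real_normed_vector) chart set \<Rightarrow> (real \<Rightarrow> 'm) set" where
  "C1_curves A = {x \<in> extensional {0..1}. C1_curve_on A {0..1} x}"

text \<open>The topology of \<open>C\<^sup>1\<close> convergence in charts on compact sets of parameters, generated by the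
  usual subbasic neighbourhoods.\<close>

definition C1_nbhd ::
    "('m::topological_space, 'e::real_normed_vector) chart set \<Rightarrow> (real \<Rightarrow> 'm) \<Rightarrow> ('m, 'e) chart \<Rightarrow>
     real set \<Rightarrow> real \<Rightarrow> (real \<Rightarrow> 'm) set" where
  "C1_nbhd A x c K e =
     {y \<in> C1_curves A. y ` K \<subseteq> fst c \<and>
        (\<forall>t\<in>K. norm (snd c (y t) - snd c (x t)) < e \<and>
               norm (velocity {0..1} y t c - velocity {0..1} x t c) < e)}"

definition C1_topology ::
    "('m::topological_space, 'e::real_normed_vector) chart set \<Rightarrow> (real \<Rightarrow> 'm) topology" where
  "C1_topology A = topology_generated_by
     {C1_nbhd A x c K e | x c K e.
        x \<in> C1_curves A \<and> c \<in> A \<and> compact K \<and> K \<subseteq> {0..1} \<and> x ` K \<subseteq> fst c \<and> e > 0}"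

text \<open>\<open>f\<close> is of class \<open>H\<^sup>1\<close> on \<open>[a,b]\<close>: absolutely continuous with derivative \<open>v\<close> in \<open>L\<^sup>2\<close>.\<close>

definition H1_on :: "real \<Rightarrow> real \<Rightarrow> (real \<Rightarrow> 'e::real_normed_vector) \<Rightarrow> bool" where
  "H1_on a b f \<longleftrightarrow>
     (\<exists>v. v \<in> borel_measurable (lebesgue_on {a..b}) \<and>
          integrable (lebesgue_on {a..b}) (\<lambda>s. (norm (v s))\<^sup>2) \<and>
          (\<forall>t\<in>{a..b}. (v has_integral (f t - f a)) {a..t}))"

text \<open>A curve is of class \<open>H\<^sup>2\<close> if all its local representations are, i.e. are \<open>C\<^sup>1\<close> with derivative
  of class \<open>H\<^sup>1\<close>.\<close>

definition H2_curves ::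
    "('m::topological_space, 'e::real_normed_vector) chart set \<Rightarrow> (real \<Rightarrow> 'm) set" where
  "H2_curves A = {x \<in> C1_curves A.
     \<forall>c\<in>A. \<forall>a b. 0 \<le> a \<and> a \<le> b \<and> b \<le> 1 \<and> x ` {a..b} \<subseteq> fst c \<longrightarrow>
       H1_on a b (\<lambda>t. velocity {0..1} x t c)}"

definition H2_curves_through ::
    "('m::topological_space, 'e::real_normed_vector) chart set \<Rightarrow> nat \<Rightarrow> (nat \<Rightarrow> real) \<Rightarrow>
     (nat \<Rightarrow> 'm) \<Rightarrow> (real \<Rightarrow> 'm) set" where
  "H2_curves_through A n t p = {x \<in> H2_curves A. \<forall>i<n. x (t i) = p i}"


section \<open>The functional and weak properness\<close>

definition tension_energy ::
    "('m, 'e::real_normed_vector) chart set \<Rightarrow> ('m, 'e) metric_rep \<Rightarrow> real \<Rightarrow> (real \<Rightarrow> 'm) \<Rightarrow> real" where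
  "tension_energy A g \<tau> x =
     1/2 * (LINT t:{0..1}|lebesgue.
       sq_norm A g (x t) (cov_deriv g {0..1} x (velocity {0..1} x) t)
       + \<tau>\<^sup>2 * sq_norm A g (x t) (velocity {0..1} x t))"

definition weakly_proper :: "('a \<Rightarrow> real) \<Rightarrow> 'a set \<Rightarrow> 'a topology \<Rightarrow> bool" where
  "weakly_proper f S X \<longleftrightarrow>
     (\<forall>U\<subseteq>S. bounded (f ` U) \<longrightarrow> compactin X (X closure_of U))"

end

theory Submission
  imports Defs "HOL-Complex_Analysis.Great_Picard"
begin

text \<open>
  Since \<open>\<tau> \<noteq> 0\<close>, a bound on the functional bounds the \<open>L\<^sup>2\<close> norms of the velocity and of the covariant
  acceleration. As all curves pass through the same point at the same time, they stay in a metric ball of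
  fixed radius, which is compact by the Hopf-Rinow theorem, and they are uniformly equicontinuous. Hence, for
  a sufficiently fine subdivision of \<open>[0,1]\<close>, every curve maps every subinterval into one of finitely many
  coordinate balls, and only finitely many itineraries are possible. For a fixed itinerary the Christoffel
  symbols are bounded along the curves, so the \<open>L\<^sup>2\<close> bounds make the velocities in coordinates uniformly bounded
  and equicontinuous, and the theorem of Arzela and Ascoli applies to the pairs of coordinates and velocity.
  The functional controls the weak derivative of the velocity because an indefinite integral is
  differentiable almost everywhere, with the integrand as its derivative.
\<close>

section \<open>Finite-dimensional inner product spaces\<close>

text \<open>The functional integrates pointwise expressions in a chart that is chosen arbitrarily at
  every time. To evaluate it in a convenient chart, the covariant acceleration must transform as a
  vector; this rests on the transformation law of the Christoffel symbols and so on the symmetry of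
  second derivatives. Integrability has to be established too, since the integral of a
  non-integrable function is 0 by convention and a bound on it would say nothing. The distance is an
  infimum over piecewise curves and infinite between components; it is replaced by the lengths of
  chains of arcs, inside the component of one prescribed point. The topology on curves is given by a
  subbasis only. Compactness is therefore obtained in an auxiliary metric space for each itinerary,
  whose inclusion into the curve space is continuous, and the Hausdorff property turns the compact
  sets so obtained into closed ones. The limits are curves of class \<open>C1\<close>, which is what
  a closure in the \<open>C1\<close> topology asks for.\<close>

definition orthonormal_basis :: "('e::real_vector \<Rightarrow> 'e \<Rightarrow> real) \<Rightarrow> 'e set \<Rightarrow> bool" where
  "orthonormal_basis h C \<longleftrightarrow> finite C \<and> (\<forall>c\<in>C. \<forall>d\<in>C. h c d = (if c = d then 1 else 0)) \<and>
     (\<forall>x. x = (\<Sum>c\<in>C. h x c *\<^sub>R c))"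

text \<open>Vectors are adjoined one at a time: the residual \<open>r\<close> of \<open>b\<close> is
  orthogonal to \<open>C\<close>, so either \<open>b\<close> is already spanned or the normalised
  residual extends \<open>C\<close>. Spanning is expressed by the Fourier expansion of each vector
  of \<open>B\<close>, so that dependent vectors in \<open>B\<close> cause no trouble.\<close>

lemma gram_schmidt:
  fixes h :: "'e::real_vector \<Rightarrow> 'e \<Rightarrow> real"
  assumes "bilinear h" and sym: "\<And>u v. h u v = h v u" and pos: "\<And>u. u \<noteq> 0 \<Longrightarrow> h u u > 0"
    and "finite B"
  shows "\<exists>C. finite C \<and> (\<forall>c\<in>C. \<forall>d\<in>C. h c d = (if c = d then 1 else 0)) \<and>
     (\<forall>b\<in>B. b = (\<Sum>c\<in>C. h b c *\<^sub>R c))"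
  using \<open>finite B\<close>
proof (induction B)
  case empty
  show ?case by (rule exI[of _ "{}"]) auto
next
  case (insert b B)
  then obtain C where C: "finite C" and on: "\<And>c d. c \<in> C \<Longrightarrow> d \<in> C \<Longrightarrow> h c d = (if c = d then 1 else 0)"
    and ex: "\<And>b. b \<in> B \<Longrightarrow> b = (\<Sum>c\<in>C. h b c *\<^sub>R c)" by blast
  have l1: "linear (\<lambda>x. h x y)" and l2: "linear (h y)" for y
    using assms(1) by (auto simp: bilinear_def)
  define r where "r = b - (\<Sum>c\<in>C. h b c *\<^sub>R c)"
  have sumh: "h (\<Sum>c\<in>C. k c *\<^sub>R c) d = k d" if "d \<in> C" for d k
  proof -
    have "h (\<Sum>c\<in>C. k c *\<^sub>R c) d = (\<Sum>c\<in>C. k c * h c d)"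
      using linear_sum[OF l1[of d], of "\<lambda>c. k c *\<^sub>R c" C] linear_cmul[OF l1[of d]] by simp
    also have "\<dots> = (\<Sum>c\<in>C. if c = d then k c else 0)"
      by (rule sum.cong) (auto simp: on that)
    also have "\<dots> = k d" using C that by simp
    finally show ?thesis .
  qed
  have rd: "h r d = 0" if "d \<in> C" for d
    using linear_diff[OF l1[of d]] sumh[OF that] by (simp add: r_def)
  show ?case
  proof (cases "r = 0")
    case True
    then have "b = (\<Sum>c\<in>C. h b c *\<^sub>R c)" by (simp add: r_def)
    then show ?thesis using C on ex by (intro exI[of _ C]) auto
  next
    case False
    define s where "s = sqrt (h r r)"
    have s: "s > 0" "s * s = h r r" using pos[OF False] by (auto simp: s_def)
    define e where "e = (1/s) *\<^sub>R r"
    have ec: "h e d = 0" if "d \<in> C" for d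
      using rd[OF that] linear_cmul[OF l1[of d]] by (simp add: e_def)
    have ce: "h d e = 0" if "d \<in> C" for d using ec[OF that] sym by metis
    have hrr: "h r r \<noteq> 0" using pos[OF False] by simp
    have ee: "h e e = 1"
      using linear_cmul[OF l1[of e]] linear_cmul[OF l2[of r]] s hrr by (simp add: e_def field_simps)
    have eC: "e \<notin> C" using ec ee by force
    have sume: "h (\<Sum>c\<in>C. k c *\<^sub>R c) e = 0" for k
      using linear_sum[OF l1[of e], of "\<lambda>c. k c *\<^sub>R c" C] linear_cmul[OF l1[of e]] ce by simp
    have re: "h r e = s" using linear_cmul[OF l2[of r]] s by (simp add: e_def field_simps)
    have be: "h b e = s"
    proof -
      have "h b e = h r e + h (\<Sum>c\<in>C. h b c *\<^sub>R c) e"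
        using linear_add[OF l1[of e], of r "\<Sum>c\<in>C. h b c *\<^sub>R c"] by (simp add: r_def)
      then show ?thesis using re sume by simp
    qed
    have "b = (\<Sum>c\<in>insert e C. h b c *\<^sub>R c)"
      using eC C be s by (simp add: e_def r_def)
    moreover have "b' = (\<Sum>c\<in>insert e C. h b' c *\<^sub>R c)" if "b' \<in> B" for b'
    proof -
      have "h b' e = 0" using sume[of "h b'"] ex[OF that] by simp
      then show ?thesis using eC C ex[OF that] by simp
    qed
    ultimately show ?thesis using on C ec ce ee eC
      by (intro exI[of _ "insert e C"]) auto
  qed
qed

lemma orthonormal_basis_exists:
  fixes h :: "'e::finite_dim_space \<Rightarrow> 'e \<Rightarrow> real"
  assumes "bilinear h" and "\<And>u v. h u v = h v u" and "\<And>u. u \<noteq> 0 \<Longrightarrow> h u u > 0"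
  shows "\<exists>C. orthonormal_basis h C"
proof -
  obtain B :: "'e set" where B: "finite B" "\<And>x. \<exists>c. x = (\<Sum>b\<in>B. c b *\<^sub>R b)"
    using finite_dim by metis
  obtain C where C: "finite C" and on: "\<And>c d. c \<in> C \<Longrightarrow> d \<in> C \<Longrightarrow> h c d = (if c = d then 1 else 0)"
    and ex: "\<And>b. b \<in> B \<Longrightarrow> b = (\<Sum>c\<in>C. h b c *\<^sub>R c)"
    using gram_schmidt[OF assms B(1)] by blast
  have l1: "linear (\<lambda>x. h x y)" for y
    using assms(1) by (auto simp: bilinear_def)
  have "x = (\<Sum>c\<in>C. h x c *\<^sub>R c)" for x
  proof -
    obtain k where k: "x = (\<Sum>b\<in>B. k b *\<^sub>R b)" using B(2) by metis
    have "h x c = (\<Sum>b\<in>B. k b * h b c)" for c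
      unfolding k using linear_sum[OF l1[of c], of "\<lambda>b. k b *\<^sub>R b" B] linear_cmul[OF l1[of c]] by simp
    then have "(\<Sum>c\<in>C. h x c *\<^sub>R c) = (\<Sum>b\<in>B. k b *\<^sub>R (\<Sum>c\<in>C. h b c *\<^sub>R c))"
      by (simp add: scaleR_sum_left scaleR_sum_right sum.swap[of _ B C])
    also have "\<dots> = x" unfolding k using ex by (intro sum.cong) auto
    finally show ?thesis by simp
  qed
  then show ?thesis using C on unfolding orthonormal_basis_def by blast
qed

text \<open>A fixed orthonormal basis takes the place of \<open>Basis\<close>: the class
  \<open>finite_dim_space\<close> admits dimension 0, where \<open>onb\<close> is empty.\<close>

definition onb :: "'e::finite_dim_space set" where
  "onb = (SOME C. orthonormal_basis inner C)"

lemma orthonormal_basis_onb: "orthonormal_basis inner (onb :: 'e::finite_dim_space set)"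
proof -
  have "bilinear (inner :: 'e \<Rightarrow> 'e \<Rightarrow> real)"
    using bilinear_conv_bounded_bilinear bounded_bilinear_inner
    by (auto simp: bilinear_def linear_iff inner_add_left inner_add_right)
  from orthonormal_basis_exists[OF this] have "\<exists>C :: 'e set. orthonormal_basis inner C"
    using inner_commute by auto
  then show ?thesis unfolding onb_def by (rule someI_ex)
qed

lemma finite_onb [simp]: "finite onb"
  and onb_expand: "x = (\<Sum>b\<in>onb. (x \<bullet> b) *\<^sub>R b)"
  and norm_onb: "b \<in> onb \<Longrightarrow> norm b = 1"
  for x b :: "'e::finite_dim_space"
  using orthonormal_basis_onb unfolding orthonormal_basis_def by (auto simp: norm_eq_sqrt_inner)

lemma linear_onb_expand:
  fixes f :: "'e::finite_dim_space \<Rightarrow> 'b::real_vector"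
  assumes "linear f"
  shows "f x = (\<Sum>b\<in>onb. (x \<bullet> b) *\<^sub>R f b)"
proof -
  have "f x = f (\<Sum>b\<in>onb. (x \<bullet> b) *\<^sub>R b)" using onb_expand[of x] by simp
  also have "\<dots> = (\<Sum>b\<in>onb. (x \<bullet> b) *\<^sub>R f b)"
    by (simp add: linear_sum[OF assms] linear_cmul[OF assms])
  finally show ?thesis .
qed

lemma bilinear_onb_expand:
  fixes h :: "'e::finite_dim_space \<Rightarrow> 'e \<Rightarrow> real"
  assumes "bilinear h"
  shows "h x y = (\<Sum>b\<in>onb. \<Sum>c\<in>onb. (x \<bullet> b) * (y \<bullet> c) * h b c)"
proof -
  have l1: "linear (\<lambda>x. h x y)" and l2: "linear (h y)" for y
    using assms(1) by (auto simp: bilinear_def)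
  have "h x y = (\<Sum>b\<in>onb. (x \<bullet> b) * h b y)" using linear_onb_expand[OF l1[of y], of x] by simp
  also have "\<dots> = (\<Sum>b\<in>onb. (x \<bullet> b) * (\<Sum>c\<in>onb. (y \<bullet> c) * h b c))"
    using linear_onb_expand[OF l2, where x=y] by (intro sum.cong) auto
  finally show ?thesis by (simp add: sum_distrib_left mult.assoc)
qed

text \<open>An orthonormal basis for \<open>h\<close> gives the vector explicitly, with the values
  of \<open>f\<close> as coefficients; positivity gives uniqueness. This makes the definite
  description in \<open>christoffel\<close> meaningful.\<close>

lemma riesz_representation:
  fixes h :: "'e::finite_dim_space \<Rightarrow> 'e \<Rightarrow> real"
  assumes h: "bilinear h" and sym: "\<And>u v. h u v = h v u" and pos: "\<And>u. u \<noteq> 0 \<Longrightarrow> h u u > 0"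
    and f: "linear f"
  shows "\<exists>!w. \<forall>z. h w z = f z"
proof -
  obtain C where C: "orthonormal_basis h C" using orthonormal_basis_exists[OF h sym pos] by blast
  have l1: "linear (\<lambda>x. h x y)" and l2: "linear (h y)" for y
    using h by (auto simp: bilinear_def)
  define w where "w = (\<Sum>c\<in>C. f c *\<^sub>R c)"
  have "h w z = f z" for z
  proof -
    have "h w z = (\<Sum>c\<in>C. f c * h c z)"
      using linear_sum[OF l1[of z], of "\<lambda>c. f c *\<^sub>R c" C] linear_cmul[OF l1[of z]] by (simp add: w_def)
    also have "\<dots> = f (\<Sum>c\<in>C. h z c *\<^sub>R c)"
      using linear_sum[OF f, of "\<lambda>c. h z c *\<^sub>R c" C] linear_cmul[OF f] sym by (simp add: mult.commute)
    also have "\<dots> = f z" using C unfolding orthonormal_basis_def by metis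
    finally show ?thesis .
  qed
  moreover have "w1 = w2" if "\<forall>z. h w1 z = f z" "\<forall>z. h w2 z = f z" for w1 w2
  proof (rule ccontr)
    assume "w1 \<noteq> w2"
    then have "h (w1 - w2) (w1 - w2) > 0" using pos by simp
    then show False using linear_diff[OF l1] that by simp
  qed
  ultimately show ?thesis by blast
qed

section \<open>Smooth maps\<close>

lemma Ck_on_continuous: "Ck_on k S f \<Longrightarrow> continuous_on S f"
  by (cases k) (auto intro!: continuous_at_imp_continuous_on differentiable_imp_continuous_within)

lemma smooth_on_continuous: "smooth_on S f \<Longrightarrow> continuous_on S f"
  unfolding smooth_on_def using Ck_on_continuous by blast

lemma smooth_on_has_derivative:
  "smooth_on S f \<Longrightarrow> x \<in> S \<Longrightarrow> (f has_derivative frechet_derivative f (at x)) (at x)"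
  unfolding smooth_on_def by (metis Ck_on.simps(2) frechet_derivative_works)

lemma smooth_on_frechet_derivative:
  "smooth_on S f \<Longrightarrow> smooth_on S (\<lambda>x. frechet_derivative f (at x) v)"
  unfolding smooth_on_def by (metis Ck_on.simps(2))

text \<open>A linear map is determined by its values on the finite set \<open>onb\<close>, so
  continuity at every fixed vector gives continuity along a varying vector \<open>w\<close>.\<close>

lemma continuous_on_linear_family:
  fixes L :: "'c::topological_space \<Rightarrow> 'e::finite_dim_space \<Rightarrow> 'b::real_normed_vector"
  assumes "\<And>s. s \<in> S \<Longrightarrow> linear (L s)" and "\<And>v. continuous_on S (\<lambda>s. L s v)"
    and "continuous_on S w"
  shows "continuous_on S (\<lambda>s. L s (w s))"
proof -
  have "continuous_on S (\<lambda>s. \<Sum>b\<in>onb. (w s \<bullet> b) *\<^sub>R L s b)"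
    by (intro continuous_intros assms)
  then show ?thesis
    by (rule continuous_on_cong[THEN iffD1, rotated -1]) (auto simp: linear_onb_expand[OF assms(1), symmetric])
qed

lemma continuous_on_bilinear_family:
  fixes L :: "'c::topological_space \<Rightarrow> 'e::finite_dim_space \<Rightarrow> 'e \<Rightarrow> real"
  assumes "\<And>s. s \<in> S \<Longrightarrow> bilinear (L s)" and "\<And>u v. continuous_on S (\<lambda>s. L s u v)"
    and "continuous_on S w" and "continuous_on S z"
  shows "continuous_on S (\<lambda>s. L s (w s) (z s))"
proof -
  have lin: "linear (\<lambda>u. L s u v)" "linear (L s u)" if "s \<in> S" for s u v
    using assms(1)[OF that] by (auto simp: bilinear_def)
  have "continuous_on S (\<lambda>s. L s (w s) v)" for v
    by (rule continuous_on_linear_family[where L="\<lambda>s u. L s u v", OF _ assms(2,3)]) (rule lin)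
  from continuous_on_linear_family[where L="\<lambda>s v. L s (w s) v", OF _ this assms(4)]
  show ?thesis using lin(2) by blast
qed

lemma smooth_on_continuous_frechet_derivative:
  fixes f :: "'e::finite_dim_space \<Rightarrow> 'b::real_normed_vector"
  assumes "smooth_on S f" and "continuous_on T p" and "p ` T \<subseteq> S" and "continuous_on T w"
  shows "continuous_on T (\<lambda>t. frechet_derivative f (at (p t)) (w t))"
proof (rule continuous_on_linear_family[where L="\<lambda>t. frechet_derivative f (at (p t))"])
  show "linear (frechet_derivative f (at (p t)))" if "t \<in> T" for t
    using smooth_on_has_derivative[OF assms(1)] that assms(3) has_derivative_linear by blast
  show "continuous_on T (\<lambda>t. frechet_derivative f (at (p t)) v)" for v
    using continuous_on_compose2[OF smooth_on_continuous[OF smooth_on_frechet_derivative[OF assms(1)]] assms(2,3)] .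
qed fact

section \<open>Symmetry of second derivatives\<close>

lemma mixed_derivative_mean_value:
  fixes f :: "'e::real_normed_vector \<Rightarrow> real"
  assumes s: "s > 0"
    and dom: "\<And>a b. 0 \<le> a \<Longrightarrow> a \<le> s \<Longrightarrow> 0 \<le> b \<Longrightarrow> b \<le> s \<Longrightarrow> x + a *\<^sub>R u + b *\<^sub>R v \<in> S"
    and f: "\<And>y. y \<in> S \<Longrightarrow> (f has_derivative G y) (at y)"
    and G: "\<And>y. y \<in> S \<Longrightarrow> ((\<lambda>y. G y u) has_derivative H y) (at y)"
  shows "\<exists>a b. 0 \<le> a \<and> a \<le> s \<and> 0 \<le> b \<and> b \<le> s \<and>
     f (x + s *\<^sub>R u + s *\<^sub>R v) - f (x + s *\<^sub>R u) - f (x + s *\<^sub>R v) + f x = s * (s * H (x + a *\<^sub>R u + b *\<^sub>R v) v)"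
proof -
  have line: "((\<lambda>a. \<phi> (y + a *\<^sub>R w)) has_real_derivative D w) (at a)"
    if "(\<phi> has_derivative D) (at (y + a *\<^sub>R w))" for \<phi> :: "'e \<Rightarrow> real" and D y w a
  proof -
    have "((\<lambda>a. y + a *\<^sub>R w) has_derivative (\<lambda>h. h *\<^sub>R w)) (at a)"
      by (auto intro!: derivative_eq_intros)
    from has_derivative_compose[OF this that]
    show ?thesis unfolding has_field_derivative_def
      using linear_cmul[OF has_derivative_linear[OF that]] by (simp add: o_def mult_commute_abs)
  qed
  \<comment> \<open>The second difference over the parallelogram is \<open>k s - k 0\<close>. The
    mean value theorem is applied to \<open>k\<close> along \<open>u\<close>, and then along
    \<open>v\<close> to the difference of first derivatives that it produces.\<close>
  define k where "k a = f (x + a *\<^sub>R u + s *\<^sub>R v) - f (x + a *\<^sub>R u)" for a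
  have "\<exists>z>0. z < s \<and> k s - k 0 = (s - 0) * (G (x + z *\<^sub>R u + s *\<^sub>R v) u - G (x + z *\<^sub>R u) u)"
  proof (rule MVT2[OF s])
    fix a assume a: "0 \<le> a" "a \<le> s"
    have 1: "(f has_derivative G (x + s *\<^sub>R v + a *\<^sub>R u)) (at (x + s *\<^sub>R v + a *\<^sub>R u))"
      using f[OF dom[of a s]] a s by (simp add: ac_simps)
    have 2: "(f has_derivative G (x + a *\<^sub>R u)) (at (x + a *\<^sub>R u))"
      using f[OF dom[of a 0]] a s by simp
    show "(k has_real_derivative G (x + a *\<^sub>R u + s *\<^sub>R v) u - G (x + a *\<^sub>R u) u) (at a)"
      using DERIV_diff[OF line[OF 1] line[OF 2]] unfolding k_def by (simp add: ac_simps)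
  qed
  then obtain a where a: "0 < a" "a < s" "k s - k 0 = s * (G (x + a *\<^sub>R u + s *\<^sub>R v) u - G (x + a *\<^sub>R u) u)"
    by auto
  have "\<exists>z>0. z < s \<and> G (x + a *\<^sub>R u + s *\<^sub>R v) u - G (x + a *\<^sub>R u + 0 *\<^sub>R v) u = (s - 0) * H (x + a *\<^sub>R u + z *\<^sub>R v) v"
  proof (rule MVT2[OF s])
    fix b assume b: "0 \<le> b" "b \<le> s"
    show "((\<lambda>b. G (x + a *\<^sub>R u + b *\<^sub>R v) u) has_real_derivative H (x + a *\<^sub>R u + b *\<^sub>R v) v) (at b)"
      using line[OF G[OF dom[of a b]]] a b by simp
  qed
  then obtain b where b: "0 < b" "b < s"
    "G (x + a *\<^sub>R u + s *\<^sub>R v) u - G (x + a *\<^sub>R u) u = s * H (x + a *\<^sub>R u + b *\<^sub>R v) v"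
    by auto
  show ?thesis using a b by (intro exI[of _ a] exI[of _ b]) (auto simp: k_def)
qed

text \<open>The second difference over a parallelogram does not change when \<open>u\<close> and
  \<open>v\<close> are exchanged, and each mixed derivative at some point of the parallelogram
  equals its normalised value. Shrinking the parallelogram brings both points to \<open>x\<close>,
  where the mixed derivatives are continuous.\<close>

lemma symmetric_second_derivative:
  fixes f :: "'e::real_normed_vector \<Rightarrow> real"
  assumes S: "open S" "x \<in> S"
    and f: "\<And>y. y \<in> S \<Longrightarrow> (f has_derivative G y) (at y)"
    and G: "\<And>y w. y \<in> S \<Longrightarrow> ((\<lambda>y. G y w) has_derivative H w y) (at y)"
    and H: "\<And>w z. continuous_on S (\<lambda>y. H w y z)"
  shows "H u x v = H v x u"
proof -
  have "dist (H u x v) (H v x u) \<le> e" if e: "e > 0" for e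
  proof -
    have "\<exists>d>0. \<forall>y. dist y x < d \<longrightarrow> y \<in> S \<and> dist (H w y z) (H w x z) < e/2" for w z
    proof -
      have "isCont (\<lambda>y. H w y z) x" using H S by (simp add: continuous_on_eq_continuous_at)
      then obtain d1 where "d1 > 0" "\<forall>y. dist y x < d1 \<longrightarrow> dist (H w y z) (H w x z) < e/2"
        using e unfolding continuous_at_eps_delta by (meson half_gt_zero)
      moreover obtain d2 where "d2 > 0" "\<forall>y. dist y x < d2 \<longrightarrow> y \<in> S" using S open_dist by blast
      ultimately show ?thesis by (intro exI[of _ "min d1 d2"]) auto
    qed
    then obtain d1 d2 where d1: "d1 > 0" "\<And>y. dist y x < d1 \<Longrightarrow> y \<in> S \<and> dist (H u y v) (H u x v) < e/2"
      and d2: "d2 > 0" "\<And>y. dist y x < d2 \<Longrightarrow> y \<in> S \<and> dist (H v y u) (H v x u) < e/2" by metis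
    \<comment> \<open>The parallelogram with these sides lies within half the radius
      \<open>min d1 d2\<close>; the summand 1 keeps the denominator positive when \<open>u\<close>
      and \<open>v\<close> vanish.\<close>
    define s where "s = min d1 d2 / (2 * (norm u + norm v + 1))"
    have nuv: "norm u + norm v + 1 > 0" using norm_ge_zero[of u] norm_ge_zero[of v] by linarith
    have half: "min d1 d2 / (2 * q) * q = min d1 d2 / 2" if "q > 0" for q :: real
      using that by simp
    have s: "s > 0" unfolding s_def using d1 d2 nuv by (intro divide_pos_pos) auto
    have dd: "dist (x + a *\<^sub>R u + b *\<^sub>R v) x < min d1 d2"
      if "0 \<le> a" "a \<le> s" "0 \<le> b" "b \<le> s" for a b
    proof -
      have "dist (x + a *\<^sub>R u + b *\<^sub>R v) x = norm (a *\<^sub>R u + b *\<^sub>R v)" by (simp add: dist_norm)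
      also have "\<dots> \<le> a * norm u + b * norm v" using that by (intro norm_triangle_le) simp
      also have "\<dots> \<le> s * norm u + s * norm v" using that by (intro add_mono mult_right_mono) auto
      also have "\<dots> \<le> s * (norm u + norm v + 1)" using s by (simp add: algebra_simps)
      also have "\<dots> = min d1 d2 / 2" unfolding s_def using half[OF nuv] .
      also have "\<dots> < min d1 d2" using d1(1) d2(1) by (simp add: min_def)
      finally show ?thesis .
    qed
    have dd': "dist (x + a *\<^sub>R v + b *\<^sub>R u) x < min d1 d2"
      if "0 \<le> a" "a \<le> s" "0 \<le> b" "b \<le> s" for a b
      using dd[of b a] that by (simp add: ac_simps)
    have inS: "x + a *\<^sub>R u + b *\<^sub>R v \<in> S" if "0 \<le> a" "a \<le> s" "0 \<le> b" "b \<le> s" for a b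
      using d1(2) dd[OF that] by simp
    have inS': "x + a *\<^sub>R v + b *\<^sub>R u \<in> S" if "0 \<le> a" "a \<le> s" "0 \<le> b" "b \<le> s" for a b
      using d1(2) dd'[OF that] by simp
    obtain a b where ab: "0 \<le> a" "a \<le> s" "0 \<le> b" "b \<le> s"
     "f (x + s *\<^sub>R u + s *\<^sub>R v) - f (x + s *\<^sub>R u) - f (x + s *\<^sub>R v) + f x = s * (s * H u (x + a *\<^sub>R u + b *\<^sub>R v) v)"
      using mixed_derivative_mean_value[where S=S and G=G and H="H u" and f=f, OF s inS f G] by blast
    obtain a' b' where ab': "0 \<le> a'" "a' \<le> s" "0 \<le> b'" "b' \<le> s"
     "f (x + s *\<^sub>R v + s *\<^sub>R u) - f (x + s *\<^sub>R v) - f (x + s *\<^sub>R u) + f x = s * (s * H v (x + a' *\<^sub>R v + b' *\<^sub>R u) u)"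
      using mixed_derivative_mean_value[where S=S and G=G and H="H v" and f=f, OF s inS' f G] by blast
    have "s * (s * H u (x + a *\<^sub>R u + b *\<^sub>R v) v) = s * (s * H v (x + a' *\<^sub>R v + b' *\<^sub>R u) u)"
    proof -
      have com: "x + s *\<^sub>R v + s *\<^sub>R u = x + s *\<^sub>R u + s *\<^sub>R v" by simp
      show ?thesis using ab(5) ab'(5)[unfolded com] by linarith
    qed
    then have eq: "H u (x + a *\<^sub>R u + b *\<^sub>R v) v = H v (x + a' *\<^sub>R v + b' *\<^sub>R u) u" using s by simp
    have "\<bar>H u (x + a *\<^sub>R u + b *\<^sub>R v) v - H u x v\<bar> < e/2"
      using d1(2) dd[OF ab(1-4)] by (simp add: dist_real_def)
    moreover have "\<bar>H v (x + a' *\<^sub>R v + b' *\<^sub>R u) u - H v x u\<bar> < e/2"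
      using d2(2) dd'[OF ab'(1-4)] by (simp add: dist_real_def)
    ultimately show ?thesis using eq unfolding dist_real_def by linarith
  qed
  then have "dist (H u x v) (H v x u) \<le> 0" by (metis add_0 field_le_epsilon)
  then show ?thesis by simp
qed

text \<open>Inner products with fixed vectors reduce it to real values. The behaviour of Christoffel
  symbols under a change of chart depends on it, with a transition map for \<open>f\<close>.\<close>

lemma smooth_on_symmetric_second_derivative:
  fixes f :: "'e::real_normed_vector \<Rightarrow> 'b::real_inner"
  assumes "smooth_on S f" and "open S" and "x \<in> S"
  shows "frechet_derivative (\<lambda>y. frechet_derivative f (at y) u) (at x) v =
         frechet_derivative (\<lambda>y. frechet_derivative f (at y) v) (at x) u" (is "?l = ?r")
proof -
  have "?l \<bullet> b = ?r \<bullet> b" for b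
  proof (rule symmetric_second_derivative[where f="\<lambda>y. f y \<bullet> b" and G="\<lambda>y v. frechet_derivative f (at y) v \<bullet> b"
        and H="\<lambda>w y z. frechet_derivative (\<lambda>y. frechet_derivative f (at y) w) (at y) z \<bullet> b" and S=S])
    show "((\<lambda>y. f y \<bullet> b) has_derivative (\<lambda>v. frechet_derivative f (at y) v \<bullet> b)) (at y)" if "y \<in> S" for y
      using smooth_on_has_derivative[OF assms(1) that] by (intro has_derivative_inner_left)
    show "((\<lambda>y. frechet_derivative f (at y) w \<bullet> b) has_derivative
        (\<lambda>z. frechet_derivative (\<lambda>y. frechet_derivative f (at y) w) (at y) z \<bullet> b)) (at y)" if "y \<in> S" for y w
      using smooth_on_has_derivative[OF smooth_on_frechet_derivative[OF assms(1)] that] by (intro has_derivative_inner_left)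
    show "continuous_on S (\<lambda>y. frechet_derivative (\<lambda>y. frechet_derivative f (at y) w) (at y) z \<bullet> b)" for w z
      by (intro continuous_intros smooth_on_continuous smooth_on_frechet_derivative assms(1))
  qed (use assms in auto)
  then have "(?l - ?r) \<bullet> (?l - ?r) = 0" by (simp add: inner_diff_left)
  then show ?thesis by simp
qed

section \<open>Almost everywhere differentiability of indefinite integrals\<close>

text \<open>The exceptional set is split according to the size of the defect of the difference quotient.
  By Vitali's theorem each part is covered, up to a null set, by disjoint intervals with a large
  defect, and by Henstock's lemma their total length is arbitrarily small.\<close>

lemma negligible_derivative_defect:
  fixes f :: "real \<Rightarrow> real"
  assumes f: "f integrable_on {a..b}" and e: "e > 0"
    and F: "\<And>s t. a < s \<Longrightarrow> s \<le> t \<Longrightarrow> t < b \<Longrightarrow> F t - F s = integral {s..t} f"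
  shows "negligible {t \<in> {a<..<b}. \<forall>d>0. \<exists>h. \<bar>h\<bar> < d \<and> \<bar>F (t + h) - F t - f t * h\<bar> > e * \<bar>h\<bar>}"
    (is "negligible ?E")
  unfolding negligible_outer_le
proof (intro allI impI)
  fix r :: real assume r: "r > 0"
  have "f integrable_on cbox a b" using f by simp
  \<comment> \<open>With this tolerance in Henstock's lemma, disjoint intervals whose defect exceeds
    \<open>e\<close> times their length have total length at most \<open>r / 2\<close>.\<close>
  moreover have "e * r / 2 > 0" using e r by simp
  ultimately obtain \<gamma> where \<gamma>: "gauge \<gamma>" and hen: "\<And>p. p tagged_partial_division_of (cbox a b) \<Longrightarrow> \<gamma> fine p \<Longrightarrow>
       sum (\<lambda>(x,k). norm (measure lborel k *\<^sub>R f x - integral k f)) p < e * r / 2"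
    by (rule Henstock_lemma) blast
  \<comment> \<open>A pair \<open>(t, h)\<close> stands for the interval between \<open>t\<close>
    and \<open>t + h\<close>, written as a ball for Vitali's theorem. Its tag \<open>t\<close> is an
    end point, the right one if \<open>h\<close> is negative.\<close>
  define cen where "cen = (\<lambda>(t::real, h::real). t + h/2)"
  define rad where "rad = (\<lambda>(t::real, h::real). \<bar>h\<bar>/2)"
  define K where "K = {(t,h). t \<in> ?E \<and> h \<noteq> 0 \<and> cball (t+h/2) (\<bar>h\<bar>/2) \<subseteq> \<gamma> t \<inter> {a<..<b} \<and>
      \<bar>F (t + h) - F t - f t * h\<bar> > e * \<bar>h\<bar>}"
  have r0: "0 < rad i" if "i \<in> K" for i using that by (auto simp: K_def rad_def)
  have fine: "\<exists>i. i \<in> K \<and> t \<in> cball (cen i) (rad i) \<and> rad i < d" if t: "t \<in> ?E" and d: "0 < d" for t d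
  proof -
    have "open (\<gamma> t \<inter> {a<..<b})" "t \<in> \<gamma> t \<inter> {a<..<b}" using \<gamma> t by (auto simp: gauge_def)
    then obtain \<delta> where \<delta>: "\<delta> > 0" "ball t \<delta> \<subseteq> \<gamma> t \<inter> {a<..<b}" using openE by blast
    have "min \<delta> d > 0" using \<delta> d by simp
    then obtain h where h: "\<bar>h\<bar> < min \<delta> d" "\<bar>F (t + h) - F t - f t * h\<bar> > e * \<bar>h\<bar>" using t by blast
    have h0: "h \<noteq> 0" using h(2) by (auto)
    have "cball (t+h/2) (\<bar>h\<bar>/2) \<subseteq> ball t \<delta>"
    proof
      fix y assume "y \<in> cball (t+h/2) (\<bar>h\<bar>/2)"
      then show "y \<in> ball t \<delta>" using h(1) by (auto simp: dist_real_def abs_if field_simps split: if_splits)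
    qed
    then have "(t,h) \<in> K" using t h h0 \<delta> by (auto simp: K_def)
    moreover have "t \<in> cball (cen (t,h)) (rad (t,h))" by (simp add: cen_def rad_def dist_real_def)
    moreover have "rad (t,h) < d" using h d by (simp add: rad_def)
    ultimately show ?thesis by blast
  qed
  obtain C where C: "countable C" "C \<subseteq> K" and dis: "pairwise (\<lambda>i j. disjnt (cball (cen i) (rad i)) (cball (cen j) (rad j))) C"
     and neg: "negligible (?E - (\<Union>i\<in>C. cball (cen i) (rad i)))"
    by (rule Vitali_covering_theorem_cballs[of K rad ?E cen, OF r0 fine])
  let ?B = "\<lambda>i. cball (cen i) (rad i)"
  have len: "(\<Sum>i\<in>D. measure lebesgue (?B i)) \<le> r / 2" if D: "finite D" "D \<subseteq> C" for D
  proof -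
    define p where "p = (\<lambda>i. (fst i, ?B i)) ` D"
    have DK: "i \<in> K" if "i \<in> D" for i using that D C by blast
    have BI: "?B i = {cen i - rad i .. cen i + rad i}" for i by (simp add: cball_eq_atLeastAtMost)
    have sub: "?B (t,h) \<subseteq> {a<..<b}" "t \<in> ?B (t,h)" "?B (t,h) \<subseteq> \<gamma> t" "h \<noteq> 0" if "(t,h) \<in> D" for t h
      using DK[OF that] by (auto simp: K_def cen_def rad_def dist_real_def)
    \<comment> \<open>Disjoint intervals that contain their tags cannot coincide, so the sum over
      the tagged division is a sum over \<open>D\<close>.\<close>
    have inj: "inj_on (\<lambda>i. (fst i, ?B i)) D"
    proof (rule inj_onI)
      fix i j assume ij: "i \<in> D" "j \<in> D" "(fst i, ?B i) = (fst j, ?B j)"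
      show "i = j"
      proof (rule ccontr)
        assume "i \<noteq> j"
        then have "disjnt (?B i) (?B j)" using dis ij D unfolding pairwise_def by blast
        moreover have "fst i \<in> ?B i" using sub(2)[of "fst i" "snd i"] ij(1) by simp
        moreover have "?B i = ?B j" using ij(3) by blast
        ultimately show False by (auto simp: disjnt_iff)
      qed
    qed
    have pD: "\<exists>h. (x,h) \<in> D \<and> k = ?B (x,h)" if "(x,k) \<in> p" for x k
      using that by (auto simp: p_def)
    have "p tagged_partial_division_of (cbox a b)"
      unfolding tagged_partial_division_of_def
    proof (intro conjI allI impI)
      show "finite p" using D by (simp add: p_def)
      fix x k assume "(x,k) \<in> p"
      then obtain h where h: "(x,h) \<in> D" "k = ?B (x,h)" by (auto simp: p_def)
      show "x \<in> k" using sub(2)[OF h(1)] unfolding h(2) .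
      show "k \<subseteq> cbox a b"
        using sub(1)[OF h(1)] greaterThanLessThan_subseteq_atLeastAtMost_iff[of a b a b] unfolding h(2) interval_cbox[symmetric]
        by fastforce
      show "\<exists>a b. k = cbox a b" unfolding h(2) BI interval_cbox by blast
    next
      fix x k x2 k2 assume ne: "(x,k) \<in> p \<and> (x2,k2) \<in> p \<and> (x,k) \<noteq> (x2,k2)"
      then have 1: "(x,k) \<in> p" and 2: "(x2,k2) \<in> p" and 3: "(x,k) \<noteq> (x2,k2)" by blast+
      obtain h where h: "(x,h) \<in> D" "k = ?B (x,h)" using pD[OF 1] by blast
      obtain h2 where h2: "(x2,h2) \<in> D" "k2 = ?B (x2,h2)" using pD[OF 2] by blast
      have "(x,h) \<noteq> (x2,h2)" using 3 h(2) h2(2) by blast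
      moreover have "(x,h) \<in> C" "(x2,h2) \<in> C" using h(1) h2(1) D(2) by blast+
      ultimately have "disjnt k k2" using pairwiseD[OF dis] unfolding h(2) h2(2) by blast
      then have "k \<inter> k2 = {}" by (simp add: disjnt_def)
      then show "interior k \<inter> interior k2 = {}" using interior_subset by blast
    qed
    moreover have "\<gamma> fine p" unfolding fine_def using pD sub(3) by blast
    ultimately have "sum (\<lambda>(x,k). norm (measure lborel k *\<^sub>R f x - integral k f)) p < e * r / 2" by (rule hen)
    then have 1: "(\<Sum>i\<in>D. norm (measure lborel (?B i) *\<^sub>R f (fst i) - integral (?B i) f)) < e * r / 2"
      unfolding p_def by (subst (asm) sum.reindex[OF inj]) (simp add: o_def)
    \<comment> \<open>The defect at \<open>t\<close> is the error of one tagged interval in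
      Henstock's lemma; the cases are the two possible positions of the tag.\<close>
    have 2: "e * measure lebesgue (?B i) \<le> norm (measure lborel (?B i) *\<^sub>R f (fst i) - integral (?B i) f)" if i: "i \<in> D" for i
    proof -
      obtain t h where ih: "i = (t,h)" by fastforce
      have th: "t \<in> {a<..<b}" "?B (t,h) \<subseteq> {a<..<b}" "\<bar>F (t + h) - F t - f t * h\<bar> > e * \<bar>h\<bar>"
        using DK[OF i] ih by (auto simp: K_def cen_def rad_def)
      have thI: "t + h \<in> ?B (t,h)" by (simp add: cen_def rad_def dist_real_def)
      have m: "measure lborel (?B (t,h)) = \<bar>h\<bar>" unfolding BI by (simp add: rad_def)
      have ml: "measure lebesgue (?B (t,h)) = \<bar>h\<bar>" unfolding BI by (simp add: rad_def)
      show ?thesis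
      proof (cases "h \<ge> 0")
        case True
        then have "?B (t,h) = {t..t+h}" unfolding BI by (simp add: cen_def rad_def)
        moreover have "F (t+h) - F t = integral {t..t+h} f" using F[of t "t+h"] True th thI by auto
        ultimately show ?thesis using m ml th(3) True unfolding ih by (simp add: abs_minus_commute mult.commute)
      next
        case False
        then have "?B (t,h) = {t+h..t}" unfolding BI by (simp add: cen_def rad_def)
        moreover have "F t - F (t+h) = integral {t+h..t} f" using F[of "t+h" t] False th thI by auto
        ultimately show ?thesis using m ml th(3) False unfolding ih by (simp add: mult.commute)
      qed
    qed
    have "e * (\<Sum>i\<in>D. measure lebesgue (?B i)) \<le> e * r / 2"
    proof -
      have "e * (\<Sum>i\<in>D. measure lebesgue (?B i)) = (\<Sum>i\<in>D. e * measure lebesgue (?B i))"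
        by (simp add: sum_distrib_left)
      also have "\<dots> \<le> (\<Sum>i\<in>D. norm (measure lborel (?B i) *\<^sub>R f (fst i) - integral (?B i) f))"
        by (rule sum_mono) (rule 2)
      finally show ?thesis using 1 by linarith
    qed
    then show ?thesis using e by (simp add: field_simps)
  qed
  define V where "V = (\<Union>i\<in>C. ?B i)"
  have V: "V \<in> lmeasurable" "measure lebesgue V \<le> r/2"
  proof -
    have "measure lebesgue (\<Union>i\<in>D. ?B i) \<le> r/2" if "finite D" "D \<subseteq> C" for D
    proof -
      have "measure lebesgue (\<Union>i\<in>D. ?B i) \<le> (\<Sum>i\<in>D. measure lebesgue (?B i))"
        by (rule measure_UNION_le) (auto simp: that)
      then show ?thesis using len[OF that] by linarith
    qed
    then show "V \<in> lmeasurable" "measure lebesgue V \<le> r/2" unfolding V_def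
      using fmeasurable_UN_bound[of C ?B lebesgue "r/2"] measure_UN_bound[of C ?B lebesgue "r/2"] C(1)
      by auto
  qed
  define Z where "Z = ?E - V"
  have Z: "negligible Z" unfolding Z_def V_def by (rule neg)
  have "measure lebesgue (Z \<union> V) \<le> measure lebesgue Z + measure lebesgue V"
    using V(1) negligible_imp_measurable[OF Z] by (intro measure_Un_le) auto
  then have "measure lebesgue (Z \<union> V) \<le> r"
    using V(2) negligible_imp_measure0[OF Z] r by linarith
  moreover have "Z \<union> V \<in> lmeasurable" using V(1) negligible_imp_measurable[OF Z] by (rule fmeasurable.Un[rotated])
  moreover have "?E \<subseteq> Z \<union> V" unfolding Z_def by blast
  ultimately show "\<exists>T. ?E \<subseteq> T \<and> T \<in> lmeasurable \<and> measure lebesgue T \<le> r" by blast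
qed

text \<open>The difference quotient fails to converge to \<open>f t\<close> only if a defect above
  some \<open>1 / real (Suc n)\<close> persists at all scales, and countably many negligible sets
  have a negligible union.\<close>

lemma real_indefinite_integral_has_derivative_ae:
  fixes f :: "real \<Rightarrow> real"
  assumes F: "\<And>t. t \<in> {a..b} \<Longrightarrow> (f has_integral (F t - F a)) {a..t}"
  shows "\<exists>N. negligible N \<and> (\<forall>t\<in>{a<..<b}-N. (F has_real_derivative f t) (at t))"
proof -
  define E where "E e = {t \<in> {a<..<b}. \<forall>d>0. \<exists>h. \<bar>h\<bar> < d \<and> \<bar>F (t + h) - F t - f t * h\<bar> > e * \<bar>h\<bar>}" for e
  have f: "f integrable_on {a..b}" if "a < b" using F[of b] that by auto
  have FF: "F t - F s = integral {s..t} f" if "a < s" "s \<le> t" "t < b" for s t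
  proof -
    have "f integrable_on {a..t}" using F[of t] that by auto
    then have "integral {a..s} f + integral {s..t} f = integral {a..t} f"
      using Henstock_Kurzweil_Integration.integral_combine[of a s t f] that by simp
    then show ?thesis using F[of s] F[of t] that by (auto dest!: integral_unique)
  qed
  have "negligible (E e)" if "e > 0" for e
  proof (cases "a < b")
    case True
    then show ?thesis unfolding E_def by (intro negligible_derivative_defect f that FF) auto
  qed (auto simp: E_def)
  then have "negligible (\<Union>n. E (1 / real (Suc n)))" by (intro negligible_countable_Union) auto
  moreover have "(F has_real_derivative f t) (at t)" if t: "t \<in> {a<..<b} - (\<Union>n. E (1 / real (Suc n)))" for t
    unfolding DERIV_def LIM_def
  proof (intro allI impI)
    fix r :: real assume "r > 0"
    then obtain n where n: "1 / real (Suc n) < r" using nat_approx_posE by blast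
    obtain d where d: "d > 0" "\<And>h. \<bar>h\<bar> < d \<Longrightarrow> \<bar>F (t + h) - F t - f t * h\<bar> \<le> (1 / real (Suc n)) * \<bar>h\<bar>"
    proof -
      have "\<not> (\<forall>d>0. \<exists>h. \<bar>h\<bar> < d \<and> \<bar>F (t + h) - F t - f t * h\<bar> > (1 / real (Suc n)) * \<bar>h\<bar>)"
        using t unfolding E_def by blast
      then show ?thesis using that by (meson not_less)
    qed
    have "dist ((F (t + h) - F t) / h) (f t) < r" if h: "h \<noteq> 0" "\<bar>h\<bar> < d" for h
    proof -
      have "dist ((F (t + h) - F t) / h) (f t) = \<bar>F (t + h) - F t - f t * h\<bar> / \<bar>h\<bar>"
        using h by (simp add: dist_real_def divide_simps flip: abs_divide)
      also have "\<dots> \<le> 1 / real (Suc n)" using d(2)[OF h(2)] h by (simp add: divide_simps mult.commute)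
      finally show ?thesis using n by simp
    qed
    then show "\<exists>s>0. \<forall>x. x \<noteq> 0 \<and> dist x 0 < s \<longrightarrow> dist ((F (t + x) - F t) / x) (f t) < r"
      using d(1) by auto
  qed
  ultimately show ?thesis by blast
qed

text \<open>Coordinates in \<open>onb\<close> reduce it to real values, at the price of a finite
  union of exceptional sets.\<close>

lemma indefinite_integral_has_vector_derivative_ae:
  fixes f :: "real \<Rightarrow> 'e::finite_dim_space"
  assumes F: "\<And>t. t \<in> {a..b} \<Longrightarrow> (f has_integral (F t - F a)) {a..t}"
  shows "\<exists>N. negligible N \<and> (\<forall>t\<in>{a<..<b}-N. (F has_vector_derivative f t) (at t))"
proof -
  have "\<exists>N. negligible N \<and> (\<forall>t\<in>{a<..<b}-N. ((\<lambda>t. F t \<bullet> c) has_real_derivative f t \<bullet> c) (at t))" for c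
  proof (rule real_indefinite_integral_has_derivative_ae)
    fix t assume "t \<in> {a..b}"
    from has_integral_linear[OF F[OF this] bounded_linear_inner_left[of c]]
    show "((\<lambda>t. f t \<bullet> c) has_integral F t \<bullet> c - F a \<bullet> c) {a..t}" by (simp add: o_def inner_diff_left)
  qed
  then obtain N where N: "\<And>c. negligible (N c)"
    "\<And>c t. t \<in> {a<..<b} - N c \<Longrightarrow> ((\<lambda>t. F t \<bullet> c) has_real_derivative f t \<bullet> c) (at t)" by metis
  have "(F has_vector_derivative f t) (at t)" if t: "t \<in> {a<..<b} - (\<Union>c\<in>onb. N c)" for t
  proof -
    have "((\<lambda>t. \<Sum>c\<in>onb. (F t \<bullet> c) *\<^sub>R c) has_vector_derivative (\<Sum>c\<in>onb. (f t \<bullet> c) *\<^sub>R c)) (at t)"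
      using N(2) t by (intro has_vector_derivative_sum) (auto intro!: derivative_eq_intros)
    then show ?thesis by (simp only: onb_expand[symmetric])
  qed
  moreover have "negligible (\<Union>c\<in>onb. N c)" using N by (intro negligible_Union) auto
  ultimately show ?thesis by blast
qed

section \<open>Charts and the Levi-Civita connection\<close>

text \<open>Identities such as the transformation law of the metric hold on an open set only, while
  \<open>frechet_derivative\<close> is applied to functions on the whole space.\<close>

lemma frechet_derivative_eqI_on_open:
  assumes "open S" "y \<in> S" "\<And>x. x \<in> S \<Longrightarrow> f x = h x" "(h has_derivative h') (at y)"
  shows "frechet_derivative f (at y) = h'" and "(f has_derivative h') (at y)"
proof -
  show "(f has_derivative h') (at y)"
    using has_derivative_transform_within_open[OF assms(4,1,2)] assms(3) by auto
  then show "frechet_derivative f (at y) = h'" using frechet_derivative_at by metis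
qed

lemma has_vector_derivative_transform_eventually:
  assumes "(f has_vector_derivative f') (at t within T)" "eventually (\<lambda>s. f s = h s) (at t within T)"
    "f t = h t" "t \<in> T"
  shows "(h has_vector_derivative f') (at t within T)"
  using assms has_derivative_transform_eventually unfolding has_vector_derivative_def by metis

text \<open>A product rule in which the base point moves as well. Differentiability is known for
  fixed vectors only, so everything is expanded in \<open>onb\<close> into products of real
  functions; \<open>dGex\<close> shows that the derivative in the base point has the same expansion,
  which reassembles the sums.\<close>

lemma has_derivative_bilinear_family:
  fixes G :: "'e::finite_dim_space \<Rightarrow> 'e \<Rightarrow> 'e \<Rightarrow> real"
  assumes S: "open S" "\<And>x. x \<in> S \<Longrightarrow> bilinear (G x)"
    and G: "\<And>u v x. x \<in> S \<Longrightarrow> (\<lambda>x. G x u v) differentiable (at x)"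
    and T: "open T" "y \<in> T" "f ` T \<subseteq> S"
    and f: "(f has_derivative f') (at y)"
    and P: "(P has_derivative P') (at y)" and Q: "(Q has_derivative Q') (at y)"
  shows "((\<lambda>x. G (f x) (P x) (Q x)) has_derivative
     (\<lambda>u. frechet_derivative (\<lambda>x. G x (P y) (Q y)) (at (f y)) (f' u) + G (f y) (P' u) (Q y) + G (f y) (P y) (Q' u))) (at y)"
proof -
  have fS: "f y \<in> S" using T by blast
  define dG where "dG b c = frechet_derivative (\<lambda>x. G x b c) (at (f y))" for b c
  have dG: "((\<lambda>x. G x b c) has_derivative dG b c) (at (f y))" for b c
    using G[OF fS] unfolding dG_def frechet_derivative_works .
  have dGf: "((\<lambda>x. G (f x) b c) has_derivative (\<lambda>u. dG b c (f' u))) (at y)" for b c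
    using has_derivative_compose[OF f dG] .
  have ex: "G x p q = (\<Sum>b\<in>onb. \<Sum>c\<in>onb. (p \<bullet> b) * (q \<bullet> c) * G x b c)" if "x \<in> S" for x p q
    using bilinear_onb_expand[OF S(2)[OF that]] .
  have "((\<lambda>x. \<Sum>b\<in>onb. \<Sum>c\<in>onb. (p \<bullet> b) * (q \<bullet> c) * G x b c) has_derivative
      (\<lambda>u. \<Sum>b\<in>onb. \<Sum>c\<in>onb. (p \<bullet> b) * (q \<bullet> c) * dG b c u)) (at (f y))" for p q
    by (intro has_derivative_sum has_derivative_mult_right dG)
  from frechet_derivative_eqI_on_open(1)[OF S(1) fS ex this]
  have dGex: "dG p q = (\<lambda>u. \<Sum>b\<in>onb. \<Sum>c\<in>onb. (p \<bullet> b) * (q \<bullet> c) * dG b c u)" for p q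
    unfolding dG_def by blast
  have *: "((\<lambda>x. (P x \<bullet> b) * (Q x \<bullet> c) * G (f x) b c) has_derivative
      (\<lambda>u. (P y \<bullet> b) * (Q y \<bullet> c) * dG b c (f' u) + ((P' u \<bullet> b) * (Q y \<bullet> c) * G (f y) b c + (P y \<bullet> b) * (Q' u \<bullet> c) * G (f y) b c))) (at y)"
    for b c
    by (rule derivative_eq_intros dGf P Q refl)+ (simp add: algebra_simps)
  have "((\<lambda>x. \<Sum>b\<in>onb. \<Sum>c\<in>onb. (P x \<bullet> b) * (Q x \<bullet> c) * G (f x) b c) has_derivative
      (\<lambda>u. \<Sum>b\<in>onb. \<Sum>c\<in>onb. (P y \<bullet> b) * (Q y \<bullet> c) * dG b c (f' u) + ((P' u \<bullet> b) * (Q y \<bullet> c) * G (f y) b c + (P y \<bullet> b) * (Q' u \<bullet> c) * G (f y) b c))) (at y)"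
    by (intro has_derivative_sum *)
  also have "(\<lambda>u. \<Sum>b\<in>onb. \<Sum>c\<in>onb. (P y \<bullet> b) * (Q y \<bullet> c) * dG b c (f' u) + ((P' u \<bullet> b) * (Q y \<bullet> c) * G (f y) b c + (P y \<bullet> b) * (Q' u \<bullet> c) * G (f y) b c))
    = (\<lambda>u. dG (P y) (Q y) (f' u) + G (f y) (P' u) (Q y) + G (f y) (P y) (Q' u))"
    by (simp add: dGex[of "P y" "Q y"] ex[OF fS, of "P' _" "Q y"] ex[OF fS, of "P y" "Q' _"] sum.distrib add.assoc)
  finally have 1: "((\<lambda>x. \<Sum>b\<in>onb. \<Sum>c\<in>onb. (P x \<bullet> b) * (Q x \<bullet> c) * G (f x) b c) has_derivative
     (\<lambda>u. dG (P y) (Q y) (f' u) + G (f y) (P' u) (Q y) + G (f y) (P y) (Q' u))) (at y)" .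
  have "G (f x) (P x) (Q x) = (\<Sum>b\<in>onb. \<Sum>c\<in>onb. (P x \<bullet> b) * (Q x \<bullet> c) * G (f x) b c)" if "x \<in> T" for x
    using T(3) that by (intro ex) blast
  from frechet_derivative_eqI_on_open(2)[OF T(1,2) this 1]
  show ?thesis unfolding dG_def .
qed

text \<open>The same device along a curve, for the derivative of a smooth map applied to a moving
  vector. With a transition map for \<open>f\<close> it differentiates the velocity in a second
  chart.\<close>

lemma has_vector_derivative_linear_family:
  fixes f :: "'e::finite_dim_space \<Rightarrow> 'b::real_normed_vector"
  assumes S: "open S" "smooth_on S f" "y t \<in> S"
    and y: "(y has_vector_derivative y') (at t within T)"
    and w: "(w has_vector_derivative w') (at t within T)"
    and near: "eventually (\<lambda>s. y s \<in> S) (at t within T)" and t: "t \<in> T"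
  shows "((\<lambda>s. frechet_derivative f (at (y s)) (w s)) has_vector_derivative
     frechet_derivative (\<lambda>x. frechet_derivative f (at x) (w t)) (at (y t)) y' + frechet_derivative f (at (y t)) w') (at t within T)"
proof -
  let ?D = "\<lambda>x. frechet_derivative f (at x)"
  have lin: "linear (?D x)" if "x \<in> S" for x
    using smooth_on_has_derivative[OF S(2) that] has_derivative_linear by blast
  have ex: "?D x u = (\<Sum>b\<in>onb. (u \<bullet> b) *\<^sub>R ?D x b)" if "x \<in> S" for x u
    using linear_onb_expand[OF lin[OF that]] .
  define D2 where "D2 b = frechet_derivative (\<lambda>x. ?D x b) (at (y t))" for b
  have D2: "((\<lambda>x. ?D x b) has_derivative D2 b) (at (y t))" for b
    unfolding D2_def by (rule smooth_on_has_derivative[OF smooth_on_frechet_derivative[OF S(2)] S(3)])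
  have "((\<lambda>x. \<Sum>b\<in>onb. (u \<bullet> b) *\<^sub>R ?D x b) has_derivative (\<lambda>z. \<Sum>b\<in>onb. (u \<bullet> b) *\<^sub>R D2 b z)) (at (y t))" for u
    by (intro has_derivative_sum has_derivative_scaleR_right D2)
  from frechet_derivative_eqI_on_open(1)[OF S(1,3) ex this]
  have D2ex: "D2 u z = (\<Sum>b\<in>onb. (u \<bullet> b) *\<^sub>R D2 b z)" for u z
    unfolding D2_def by metis
  have Dy: "((\<lambda>s. ?D (y s) b) has_vector_derivative D2 b y') (at t within T)" for b
    using vector_derivative_diff_chain_within[OF y has_derivative_at_withinI[OF D2]] by (simp add: o_def)
  have wb: "((\<lambda>s. w s \<bullet> b) has_real_derivative w' \<bullet> b) (at t within T)" for b
    using bounded_linear.has_vector_derivative[OF bounded_linear_inner_left w, of b]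
    by (simp add: has_real_derivative_iff_has_vector_derivative)
  have "((\<lambda>s. \<Sum>b\<in>onb. (w s \<bullet> b) *\<^sub>R ?D (y s) b) has_vector_derivative
     (\<Sum>b\<in>onb. (w t \<bullet> b) *\<^sub>R D2 b y' + (w' \<bullet> b) *\<^sub>R ?D (y t) b)) (at t within T)"
    by (intro has_vector_derivative_sum has_vector_derivative_scaleR wb Dy)
  also have "(\<Sum>b\<in>onb. (w t \<bullet> b) *\<^sub>R D2 b y' + (w' \<bullet> b) *\<^sub>R ?D (y t) b) = D2 (w t) y' + ?D (y t) w'"
    using D2ex[of "w t" y'] ex[OF S(3), of w'] by (simp add: sum.distrib)
  finally have *: "((\<lambda>s. \<Sum>b\<in>onb. (w s \<bullet> b) *\<^sub>R ?D (y s) b) has_vector_derivative D2 (w t) y' + ?D (y t) w') (at t within T)" .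
  have "eventually (\<lambda>s. (\<Sum>b\<in>onb. (w s \<bullet> b) *\<^sub>R ?D (y s) b) = ?D (y s) (w s)) (at t within T)"
    using near by (rule eventually_mono) (simp add: ex[symmetric])
  from has_vector_derivative_transform_eventually[OF * this _ t]
  show ?thesis unfolding D2_def using ex[OF S(3), of "w t"] by simp
qed

locale riemannian =
  fixes A :: "('m::t2_space, 'e::finite_dim_space) chart set" and g :: "('m, 'e) metric_rep"
  assumes riemannian: "riemannian_manifold A g"
begin

section \<open>Charts and transition maps\<close>

lemma atlas: "smooth_atlas A"
  using riemannian by (simp add: riemannian_manifold_def)

lemma chart_at: "chart_at A q \<in> A" "q \<in> fst (chart_at A q)"
proof -
  have "\<exists>c. c \<in> A \<and> q \<in> fst c" using atlas unfolding smooth_atlas_def by blast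
  then have "chart_at A q \<in> A \<and> q \<in> fst (chart_at A q)" unfolding chart_at_def by (rule someI_ex)
  then show "chart_at A q \<in> A" "q \<in> fst (chart_at A q)" by auto
qed

abbreviation cinv :: "('m, 'e) chart \<Rightarrow> 'e \<Rightarrow> 'm" where
  "cinv c \<equiv> inv_into (fst c) (snd c)"

abbreviation img :: "('m, 'e) chart \<Rightarrow> 'e set" where
  "img c \<equiv> snd c ` fst c"

lemma open_chart: "c \<in> A \<Longrightarrow> open (fst c)" and open_img: "c \<in> A \<Longrightarrow> open (img c)"
  using atlas by (auto simp: smooth_atlas_def)

lemma chart_homeomorphism: "c \<in> A \<Longrightarrow> homeomorphism (fst c) (img c) (snd c) (cinv c)"
  using atlas by (auto simp: smooth_atlas_def)

lemma cinv_snd: "c \<in> A \<Longrightarrow> q \<in> fst c \<Longrightarrow> cinv c (snd c q) = q"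
  using chart_homeomorphism by (auto simp: homeomorphism_def)

lemma snd_cinv: "y \<in> img c \<Longrightarrow> snd c (cinv c y) = y" and cinv_in: "y \<in> img c \<Longrightarrow> cinv c y \<in> fst c"
  by (auto simp: f_inv_into_f inv_into_into)

lemma continuous_on_chart: "c \<in> A \<Longrightarrow> continuous_on (fst c) (snd c)"
  and continuous_on_cinv: "c \<in> A \<Longrightarrow> continuous_on (img c) (cinv c)"
  using chart_homeomorphism by (auto simp: homeomorphism_def)

lemma overlap_iff: "c \<in> A \<Longrightarrow> y \<in> overlap c d \<longleftrightarrow> y \<in> img c \<and> cinv c y \<in> fst d"
  unfolding overlap_def using cinv_snd snd_cinv cinv_in by fastforce

lemma snd_in_overlap: "q \<in> fst c \<Longrightarrow> q \<in> fst d \<Longrightarrow> snd c q \<in> overlap c d"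
  by (auto simp: overlap_def)

lemma open_overlap: "c \<in> A \<Longrightarrow> d \<in> A \<Longrightarrow> open (overlap c d)"
proof -
  assume c: "c \<in> A" "d \<in> A"
  have "overlap c d = img c \<inter> cinv c -` fst d" using overlap_iff[OF c(1)] by blast
  then show ?thesis
    using continuous_on_open_vimage[OF open_img[OF c(1)]] continuous_on_cinv[OF c(1)] open_chart[OF c(2)]
    by (metis inf_commute)
qed

lemma transition_snd: "c \<in> A \<Longrightarrow> q \<in> fst c \<Longrightarrow> transition c d (snd c q) = snd d q"
  by (simp add: transition_def cinv_snd)

lemma transition_in_overlap: "c \<in> A \<Longrightarrow> y \<in> overlap c d \<Longrightarrow> transition c d y \<in> overlap d c"
  by (auto simp: overlap_def transition_snd)

lemma overlap_subset: "overlap c d \<subseteq> img c" "c \<in> A \<Longrightarrow> transition c d ` overlap c d \<subseteq> img d"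
  by (auto simp: overlap_def transition_snd)

lemma transition_inverse: "c \<in> A \<Longrightarrow> d \<in> A \<Longrightarrow> y \<in> overlap c d \<Longrightarrow> transition d c (transition c d y) = y"
  by (auto simp: overlap_def transition_snd)

lemma smooth_transition: "c \<in> A \<Longrightarrow> d \<in> A \<Longrightarrow> smooth_on (overlap c d) (transition c d)"
  using atlas by (auto simp: smooth_atlas_def)

abbreviation Dtr :: "('m, 'e) chart \<Rightarrow> ('m, 'e) chart \<Rightarrow> 'e \<Rightarrow> 'e \<Rightarrow> 'e" where
  "Dtr c d y \<equiv> frechet_derivative (transition c d) (at y)"

lemma transition_has_derivative:
  "c \<in> A \<Longrightarrow> d \<in> A \<Longrightarrow> y \<in> overlap c d \<Longrightarrow> (transition c d has_derivative Dtr c d y) (at y)"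
  using smooth_on_has_derivative[OF smooth_transition] .

lemma linear_Dtr: "c \<in> A \<Longrightarrow> d \<in> A \<Longrightarrow> y \<in> overlap c d \<Longrightarrow> linear (Dtr c d y)"
  using has_derivative_linear[OF transition_has_derivative] .

lemma Dtr_inverse:
  assumes "c \<in> A" "d \<in> A" "y \<in> overlap c d"
  shows "Dtr d c (transition c d y) (Dtr c d y u) = u"
proof -
  have "((\<lambda>x. transition d c (transition c d x)) has_derivative (\<lambda>u. Dtr d c (transition c d y) (Dtr c d y u))) (at y)"
    using has_derivative_compose[OF transition_has_derivative[OF assms]
        transition_has_derivative[OF assms(2,1) transition_in_overlap[OF assms(1,3)]]] .
  moreover have "((\<lambda>x. transition d c (transition c d x)) has_derivative (\<lambda>u. u)) (at y)"
    by (rule frechet_derivative_eqI_on_open(2)[OF open_overlap[OF assms(1,2)] assms(3) _ has_derivative_ident])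
      (simp add: transition_inverse assms)
  ultimately have "(\<lambda>u. Dtr d c (transition c d y) (Dtr c d y u)) = (\<lambda>u. u)" by (rule has_derivative_unique)
  then show ?thesis by metis
qed

lemma Dtr_surj:
  assumes "c \<in> A" "d \<in> A" "y \<in> overlap c d"
  shows "\<exists>z. Dtr c d y z = w"
  using Dtr_inverse[OF assms(2,1) transition_in_overlap[OF assms(1,3)]] transition_inverse[OF assms] by metis

section \<open>The metric and its Christoffel symbols in coordinates\<close>

lemma bilinear_g: "c \<in> A \<Longrightarrow> y \<in> img c \<Longrightarrow> bilinear (g c y)"
  and g_sym: "c \<in> A \<Longrightarrow> y \<in> img c \<Longrightarrow> g c y u v = g c y v u"
  and g_pos: "c \<in> A \<Longrightarrow> y \<in> img c \<Longrightarrow> u \<noteq> 0 \<Longrightarrow> g c y u u > 0"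
  and smooth_g: "c \<in> A \<Longrightarrow> smooth_on (img c) (\<lambda>y. g c y u v)"
  and g_transition: "c \<in> A \<Longrightarrow> d \<in> A \<Longrightarrow> y \<in> overlap c d \<Longrightarrow>
        g c y u v = g d (transition c d y) (Dtr c d y u) (Dtr c d y v)"
  using riemannian unfolding riemannian_manifold_def by blast+

lemma g_zero: "c \<in> A \<Longrightarrow> y \<in> img c \<Longrightarrow> g c y 0 u = 0 \<and> g c y u 0 = 0"
  using bilinear_g bilinear_lzero bilinear_rzero by blast

lemma g_nonneg: "c \<in> A \<Longrightarrow> y \<in> img c \<Longrightarrow> g c y u u \<ge> 0"
  using g_pos[of c y u] g_zero[of c y 0] by (cases "u = 0") auto

text \<open>The vectors \<open>u\<close> and \<open>v\<close> are held fixed; the last argument is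
  the direction of differentiation.\<close>

abbreviation dg :: "('m, 'e) chart \<Rightarrow> 'e \<Rightarrow> 'e \<Rightarrow> 'e \<Rightarrow> 'e \<Rightarrow> real" where
  "dg c y u v z \<equiv> frechet_derivative (\<lambda>y. g c y u v) (at y) z"

lemma g_has_derivative:
  "c \<in> A \<Longrightarrow> y \<in> img c \<Longrightarrow> ((\<lambda>y. g c y u v) has_derivative dg c y u v) (at y)"
  using smooth_on_has_derivative[OF smooth_g] .

lemma linear_dg:
  assumes "c \<in> A" "y \<in> img c"
  shows "linear (\<lambda>z. dg c y u z v)" "linear (\<lambda>z. dg c y z u v)" "linear (dg c y u v)"
proof -
  have bil: "bilinear (g c x)" if "x \<in> img c" for x using bilinear_g[OF assms(1) that] .
  note eq = frechet_derivative_eqI_on_open(1)[OF open_img[OF assms(1)] assms(2)]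
  \<comment> \<open>Linearity in the fixed vectors comes from identities between functions of the
    base point, which hold on the open image of the chart.\<close>
  have l: "dg c y u (z + z') = (\<lambda>v. dg c y u z v + dg c y u z' v)"
    "dg c y (z + z') u = (\<lambda>v. dg c y z u v + dg c y z' u v)"
    "dg c y u (r *\<^sub>R z) = (\<lambda>v. r * dg c y u z v)"
    "dg c y (r *\<^sub>R z) u = (\<lambda>v. r * dg c y z u v)" for z z' r u
    using bil by (rule_tac [!] eq)
      (auto intro!: g_has_derivative assms has_derivative_add has_derivative_mult_right
        simp: bilinear_radd bilinear_ladd bilinear_rmul bilinear_lmul)
  show "linear (\<lambda>z. dg c y u z v)" "linear (\<lambda>z. dg c y z u v)"
    by (auto simp: linear_iff l)
  show "linear (dg c y u v)" using has_derivative_linear[OF g_has_derivative[OF assms]] .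
qed

abbreviation first_kind :: "('m, 'e) chart \<Rightarrow> 'e \<Rightarrow> 'e \<Rightarrow> 'e \<Rightarrow> 'e \<Rightarrow> real" where
  "first_kind c y u v z \<equiv> (dg c y v z u + dg c y u z v - dg c y u v z) / 2"

text \<open>The first-kind expression is linear in \<open>z\<close>, so by Riesz representation the
  definite description denotes the vector it describes.\<close>

lemma christoffel:
  assumes "c \<in> A" "y \<in> img c"
  shows "g c y (christoffel g c y u v) z = first_kind c y u v z"
proof -
  have "linear (\<lambda>z. first_kind c y u v z)"
    using linear_add[OF linear_dg(1)[OF assms]] linear_add[OF linear_dg(3)[OF assms]]
      linear_cmul[OF linear_dg(1)[OF assms]] linear_cmul[OF linear_dg(3)[OF assms]]
    by (auto simp: linear_iff field_simps)
  from riesz_representation[OF bilinear_g[OF assms] g_sym[OF assms] g_pos[OF assms] this]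
  have "\<forall>z. g c y (christoffel g c y u v) z = first_kind c y u v z"
    unfolding christoffel_def by (rule theI')
  then show ?thesis by blast
qed

lemma g_eqI:
  assumes "c \<in> A" "y \<in> img c" "\<And>z. g c y u z = g c y v z"
  shows "u = v"
proof (rule ccontr)
  assume "u \<noteq> v"
  then have "g c y (u - v) (u - v) > 0" using g_pos[OF assms(1,2)] by simp
  then show False using bilinear_lsub[OF bilinear_g[OF assms(1,2)]] assms(3) by simp
qed

text \<open>The transformation law of the metric is differentiated in the direction
  \<open>u\<close>. The last two terms contain second derivatives of the transition map; they are
  what prevents the Christoffel symbols from being a tensor.\<close>

lemma dg_transition:
  assumes c: "c \<in> A" and d: "d \<in> A" and y: "y \<in> overlap c d"
  shows "dg c y v z u = dg d (transition c d y) (Dtr c d y v) (Dtr c d y z) (Dtr c d y u)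
    + g d (transition c d y) (frechet_derivative (\<lambda>x. Dtr c d x v) (at y) u) (Dtr c d y z)
    + g d (transition c d y) (Dtr c d y v) (frechet_derivative (\<lambda>x. Dtr c d x z) (at y) u)"
proof -
  have D: "((\<lambda>x. Dtr c d x v) has_derivative frechet_derivative (\<lambda>x. Dtr c d x v) (at y)) (at y)" for v
    by (rule smooth_on_has_derivative[OF smooth_on_frechet_derivative[OF smooth_transition[OF c d]] y])
  have "((\<lambda>x. g d (transition c d x) (Dtr c d x v) (Dtr c d x z)) has_derivative
     (\<lambda>u. dg d (transition c d y) (Dtr c d y v) (Dtr c d y z) (Dtr c d y u)
    + g d (transition c d y) (frechet_derivative (\<lambda>x. Dtr c d x v) (at y) u) (Dtr c d y z)
    + g d (transition c d y) (Dtr c d y v) (frechet_derivative (\<lambda>x. Dtr c d x z) (at y) u))) (at y)"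
  proof (rule has_derivative_bilinear_family[OF open_img[OF d] _ _ open_overlap[OF c d] y overlap_subset(2)[OF c] _ D D])
    show "bilinear (g d x)" if "x \<in> img d" for x using bilinear_g[OF d that] .
    show "(\<lambda>x. g d x u v) differentiable (at x)" if "x \<in> img d" for x u v
      using g_has_derivative[OF d that] by (auto simp: differentiable_def)
  qed (rule transition_has_derivative[OF c d y])
  from frechet_derivative_eqI_on_open(1)[OF open_overlap[OF c d] y g_transition[OF c d] this]
  show ?thesis by (rule fun_cong)
qed

text \<open>Both sides are tested against vectors \<open>Dtr c d y z\<close>, which are all vectors.
  In the first-kind combination the terms with second derivatives of the transition map cancel in
  pairs by symmetry, except for two equal ones that form the inhomogeneous term.\<close>

lemma christoffel_transition:
  assumes c: "c \<in> A" and d: "d \<in> A" and y: "y \<in> overlap c d"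
  shows "Dtr c d y (christoffel g c y u v) =
     christoffel g d (transition c d y) (Dtr c d y u) (Dtr c d y v) + frechet_derivative (\<lambda>x. Dtr c d x v) (at y) u"
    (is "?l = ?r")
proof -
  let ?y = "transition c d y"
  have yc: "y \<in> img c" and yd: "?y \<in> img d" using overlap_subset c y by blast+
  note bil = bilinear_g[OF d yd]
  have "g d ?y ?l w = g d ?y ?r w" for w
  proof -
    obtain z where z: "w = Dtr c d y z" using Dtr_surj[OF c d y] by metis
    define H where "H v u = frechet_derivative (\<lambda>x. Dtr c d x v) (at y) u" for v u
    have H: "H v u = H u v" for u v unfolding H_def
      by (rule smooth_on_symmetric_second_derivative[OF smooth_transition[OF c d] open_overlap[OF c d] y])
    have "g d ?y ?l w = first_kind c y u v z"
      unfolding z g_transition[OF c d y, symmetric] by (rule christoffel[OF c yc])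
    also have "\<dots> = first_kind d ?y (Dtr c d y u) (Dtr c d y v) w + g d ?y (H v u) w"
      unfolding dg_transition[OF c d y] z H_def[symmetric]
      using H[of v u] H[of z u] H[of z v] g_sym[OF d yd, of "H u z" "Dtr c d y v"]
      by (simp add: field_simps)
    also have "\<dots> = g d ?y ?r w"
      unfolding christoffel[OF d yd, symmetric] by (simp add: bilinear_ladd[OF bil] H_def)
    finally show ?thesis .
  qed
  then show ?thesis using g_eqI[OF d yd] by blast
qed

text \<open>\<open>sq_norm\<close> measures in the arbitrary chart \<open>chart_at A q\<close>; for
  components that transform by \<open>Dtr\<close>, the invariance of the metric allows any other
  chart.\<close>

lemma sq_norm_eq:
  assumes c: "c \<in> A" and q: "q \<in> fst c"
    and w: "\<And>d. d \<in> A \<Longrightarrow> q \<in> fst d \<Longrightarrow> w d = Dtr c d (snd c q) (w c)"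
  shows "sq_norm A g q w = g c (snd c q) (w c) (w c)"
proof -
  let ?d = "chart_at A q"
  show ?thesis unfolding sq_norm_def Let_def w[OF chart_at]
    using g_transition[OF c chart_at(1) snd_in_overlap[OF q chart_at(2)]] transition_snd[OF c q] by metis
qed

section \<open>Velocity and covariant acceleration under a change of chart\<close>

lemma eventually_in_chart:
  assumes "continuous (at t within T) x" "x t \<in> fst c" "c \<in> A"
  shows "eventually (\<lambda>s. x s \<in> fst c) (at t within T)"
  using topological_tendstoD[OF _ open_chart[OF assms(3)]] assms(1,2) unfolding continuous_within by blast

lemma curve_transition:
  assumes c: "c \<in> A" and d: "d \<in> A" and x: "continuous (at t within T) x" "x t \<in> fst c" "x t \<in> fst d" and t: "t \<in> T"
    and v: "((snd c \<circ> x) has_vector_derivative v) (at t within T)"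
  shows "((snd d \<circ> x) has_vector_derivative Dtr c d (snd c (x t)) v) (at t within T)"
proof -
  have "((transition c d \<circ> (snd c \<circ> x)) has_vector_derivative Dtr c d (snd c (x t)) v) (at t within T)"
    using transition_has_derivative[OF c d snd_in_overlap[OF x(2,3)]]
    by (intro vector_derivative_diff_chain_within[OF v, where g'="Dtr c d (snd c (x t))"])
       (simp add: has_derivative_at_withinI)
  moreover have "eventually (\<lambda>s. (transition c d \<circ> (snd c \<circ> x)) s = (snd d \<circ> x) s) (at t within T)"
    using eventually_in_chart[OF x(1,2) c] by (rule eventually_mono) (simp add: transition_snd[OF c])
  ultimately show ?thesis
    by (rule has_vector_derivative_transform_eventually) (use transition_snd[OF c x(2)] t in auto)
qed

lemma C1_curve_on_continuous: "C1_curve_on A T x \<Longrightarrow> t \<in> T \<Longrightarrow> continuous (at t within T) x"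
  unfolding C1_curve_on_def continuous_on_eq_continuous_within by blast

lemma C1_curve_on_velocity:
  "C1_curve_on A T x \<Longrightarrow> t \<in> T \<Longrightarrow> c \<in> A \<Longrightarrow> x t \<in> fst c \<Longrightarrow>
    ((snd c \<circ> x) has_vector_derivative velocity T x t c) (at t within T)"
  unfolding C1_curve_on_def velocity_def vector_derivative_works[symmetric] by blast

lemma velocity_transition:
  assumes x: "C1_curve_on A {a..b} x" and t: "t \<in> {a..b}" "a < b" and c: "c \<in> A" "x t \<in> fst c" and d: "d \<in> A" "x t \<in> fst d"
  shows "velocity {a..b} x t d = Dtr c d (snd c (x t)) (velocity {a..b} x t c)"
  using vector_derivative_within_cbox[of a b t "snd d \<circ> x"]
    curve_transition[OF c(1) d(1) C1_curve_on_continuous[OF x t(1)] c(2) d(2) t(1) C1_curve_on_velocity[OF x t(1) c]] t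
  unfolding velocity_def by auto

lemma sq_norm_velocity:
  assumes "C1_curve_on A {a..b} x" "t \<in> {a..b}" "a < b" "c \<in> A" "x t \<in> fst c"
  shows "sq_norm A g (x t) (velocity {a..b} x t) = g c (snd c (x t)) (velocity {a..b} x t c) (velocity {a..b} x t c)"
  using sq_norm_eq[OF assms(4,5)] velocity_transition[OF assms] by blast

text \<open>By the product rule the derivative of the velocity picks up a second derivative of the
  transition map. It is the inhomogeneous term of \<open>christoffel_transition\<close>, hence
  absorbed by the Christoffel symbols of \<open>c\<close>.\<close>

lemma cov_deriv_transition:
  assumes x: "C1_curve_on A {a..b} x" and t: "t \<in> {a..b}" "a < b" and c: "c \<in> A" "x t \<in> fst c" and d: "d \<in> A" "x t \<in> fst d"
    and w: "((\<lambda>s. velocity {a..b} x s c) has_vector_derivative w) (at t within {a..b})"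
  shows "cov_deriv g {a..b} x (velocity {a..b} x) t d =
    Dtr c d (snd c (x t)) (cov_deriv g {a..b} x (velocity {a..b} x) t c)"
proof -
  let ?T = "{a..b}" and ?y = "snd c (x t)"
  let ?v = "velocity ?T x t c"
  have ov: "?y \<in> overlap c d" by (rule snd_in_overlap[OF c(2) d(2)])
  have xc: "continuous (at t within ?T) x" by (rule C1_curve_on_continuous[OF x t(1)])
  have ev: "eventually (\<lambda>s. s \<in> ?T \<and> x s \<in> fst c \<and> x s \<in> fst d) (at t within ?T)"
    using eventually_in_chart[OF xc c(2,1)] eventually_in_chart[OF xc d(2,1)]
    by (auto simp: eventually_conj_iff eventually_at_filter)
  have "((\<lambda>s. Dtr c d ((snd c \<circ> x) s) (velocity ?T x s c)) has_vector_derivative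
      frechet_derivative (\<lambda>y. Dtr c d y ?v) (at ((snd c \<circ> x) t)) ?v + Dtr c d ((snd c \<circ> x) t) w) (at t within ?T)"
    by (rule has_vector_derivative_linear_family[OF open_overlap[OF c(1) d(1)] smooth_transition[OF c(1) d(1)] _
        C1_curve_on_velocity[OF x t(1) c] w])
      (use ov ev t in \<open>auto elim!: eventually_mono intro: snd_in_overlap\<close>)
  moreover have "eventually (\<lambda>s. Dtr c d ((snd c \<circ> x) s) (velocity ?T x s c) = velocity ?T x s d) (at t within ?T)"
    using ev by (rule eventually_mono) (use velocity_transition[OF x _ t(2) c(1) _ d(1)] in auto)
  ultimately have "((\<lambda>s. velocity ?T x s d) has_vector_derivative
      frechet_derivative (\<lambda>y. Dtr c d y ?v) (at ?y) ?v + Dtr c d ?y w) (at t within ?T)"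
    using has_vector_derivative_transform_eventually t(1) velocity_transition[OF x t c d] by fastforce
  then have 1: "vector_derivative (\<lambda>s. velocity ?T x s d) (at t within ?T) =
      frechet_derivative (\<lambda>y. Dtr c d y ?v) (at ?y) ?v + Dtr c d ?y w"
    using vector_derivative_within_cbox[of a b t] t by auto
  have 2: "vector_derivative (\<lambda>s. velocity ?T x s c) (at t within ?T) = w"
    using vector_derivative_within_cbox[of a b t] t w by auto
  show ?thesis unfolding cov_deriv_def 1 2 velocity_transition[OF x t c d]
    using christoffel_transition[OF c(1) d(1) ov, of ?v ?v] linear_add[OF linear_Dtr[OF c(1) d(1) ov]]
      transition_snd[OF c] by simp
qed

text \<open>Intended for the times at which the velocity is differentiable in one chart, which for
  an \<open>H2\<close> curve are almost all; there the density of the functional becomes an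
  expression in that chart.\<close>

lemma sq_norm_cov_deriv:
  assumes x: "C1_curve_on A {a..b} x" and t: "t \<in> {a..b}" "a < b" and c: "c \<in> A" "x t \<in> fst c"
    and w: "((\<lambda>s. velocity {a..b} x s c) has_vector_derivative w) (at t within {a..b})"
  defines "z \<equiv> w + christoffel g c (snd c (x t)) (velocity {a..b} x t c) (velocity {a..b} x t c)"
  shows "sq_norm A g (x t) (cov_deriv g {a..b} x (velocity {a..b} x) t) = g c (snd c (x t)) z z"
proof -
  have "vector_derivative (\<lambda>s. velocity {a..b} x s c) (at t within {a..b}) = w"
    using vector_derivative_within_cbox[of a b t] t w by auto
  then have "z = cov_deriv g {a..b} x (velocity {a..b} x) t c" by (simp add: z_def cov_deriv_def)
  then show ?thesis using sq_norm_eq[OF c] cov_deriv_transition[OF x t c _ _ w] by metis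
qed

end

section \<open>Lengths of curves\<close>

lemma has_vector_derivative_at_within_Icc:
  fixes f :: "real \<Rightarrow> 'b::real_normed_vector"
  assumes "(f has_vector_derivative f') (at t within {a..b})" "a < t" "t < b"
  shows "(f has_vector_derivative f') (at t)"
  using assms at_within_Icc_at[of a t b] by simp

context riemannian
begin

text \<open>Continuity in a chart is continuity on the set of times spent there; this set is
  relatively open in \<open>T\<close>, so continuity within \<open>T\<close> follows.\<close>

lemma continuous_within_open_restrict:
  assumes "continuous_on {s \<in> T. x s \<in> W} f" "continuous_on T x" "open W" "t \<in> T" "x t \<in> W"
  shows "continuous (at t within T) f"
proof -
  have "openin (top_of_set T) (T \<inter> x -` W)" using assms(2,3) by (rule continuous_openin_preimage_gen)
  then obtain V where V: "open V" "T \<inter> x -` W = T \<inter> V" by (auto simp: openin_open)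
  have "{s \<in> T. x s \<in> W} = T \<inter> V" using V(2) by auto
  then have "continuous (at t within (T \<inter> V)) f"
    using assms(1,4,5) by (metis (no_types, lifting) continuous_on_eq_continuous_within mem_Collect_eq)
  moreover have "at t within (T \<inter> V) = at t within T"
    by (rule at_within_nhd[of _ V]) (use V assms(4,5) in auto)
  ultimately show ?thesis by simp
qed

lemma C1_curve_on_continuous_on: "C1_curve_on A T x \<Longrightarrow> continuous_on T x"
  by (simp add: C1_curve_on_def)

lemma continuous_on_sq_norm_velocity_chart:
  assumes x: "C1_curve_on A T x" and c: "c \<in> A"
  shows "continuous_on {t \<in> T. x t \<in> fst c}
     (\<lambda>t. g c (snd c (x t)) (velocity T x t c) (velocity T x t c))"
proof -
  let ?N = "{t \<in> T. x t \<in> fst c}"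
  have xN: "continuous_on ?N x" by (rule continuous_on_subset[OF C1_curve_on_continuous_on[OF x]]) auto
  have y: "continuous_on ?N (\<lambda>t. snd c (x t))"
    by (rule continuous_on_compose2[OF continuous_on_chart[OF c] xN]) auto
  have guv: "continuous_on ?N (\<lambda>t. g c (snd c (x t)) u v)" for u v
    by (rule continuous_on_compose2[OF smooth_on_continuous[OF smooth_g[OF c]] y]) auto
  have bil: "bilinear (g c (snd c (x t)))" if "t \<in> ?N" for t
    using that by (intro bilinear_g c) auto
  have v: "continuous_on ?N (\<lambda>t. velocity T x t c)" using x c by (simp add: C1_curve_on_def)
  show ?thesis
    by (rule continuous_on_bilinear_family[where L="\<lambda>t. g c (snd c (x t))", OF bil guv v v])
qed

lemma continuous_on_sq_norm_velocity:
  assumes x: "C1_curve_on A {a..b} x" and ab: "a < b"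
  shows "continuous_on {a..b} (\<lambda>t. sq_norm A g (x t) (velocity {a..b} x t))"
  unfolding continuous_on_eq_continuous_within
proof
  fix t assume t: "t \<in> {a..b}"
  let ?c = "chart_at A (x t)"
  have "continuous_on {s \<in> {a..b}. x s \<in> fst ?c} (\<lambda>t. sq_norm A g (x t) (velocity {a..b} x t))"
    using continuous_on_sq_norm_velocity_chart[OF x chart_at(1)]
    by (rule continuous_on_eq) (auto simp: sq_norm_velocity[OF x _ ab chart_at(1)])
  then show "continuous (at t within {a..b}) (\<lambda>t. sq_norm A g (x t) (velocity {a..b} x t))"
    using continuous_within_open_restrict[OF _ C1_curve_on_continuous_on[OF x] open_chart[OF chart_at(1)] t chart_at(2)]
    by blast
qed

lemma sq_norm_nonneg: "sq_norm A g q w \<ge> 0"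
  unfolding sq_norm_def Let_def using chart_at by (intro g_nonneg) auto

text \<open>The transition maps carry differentiability and continuity of the velocity from one
  chart to all others, so a curve inside a single chart is examined there alone. Constants,
  coordinate segments and the pieces of limit curves are obtained from it.\<close>

lemma C1_curve_in_chart:
  assumes c: "c \<in> A" "x ` {a..b} \<subseteq> fst c" and ab: "a < b"
    and v: "\<And>t. t \<in> {a..b} \<Longrightarrow> ((snd c \<circ> x) has_vector_derivative v t) (at t within {a..b})"
    and vc: "continuous_on {a..b} v"
  shows "C1_curve_on A {a..b} x" "\<And>t. t \<in> {a..b} \<Longrightarrow> velocity {a..b} x t c = v t"
proof -
  have xin: "x t \<in> fst c" if "t \<in> {a..b}" for t using c(2) that by blast
  have yc: "continuous_on {a..b} (\<lambda>t. snd c (x t))"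
    unfolding continuous_on_eq_continuous_within
    using has_vector_derivative_continuous[OF v] by (auto simp: o_def)
  have "continuous_on {a..b} (\<lambda>t. cinv c (snd c (x t)))"
    by (rule continuous_on_compose2[OF continuous_on_cinv[OF c(1)] yc]) (use c in auto)
  then have xc: "continuous_on {a..b} x"
    by (rule continuous_on_eq) (use cinv_snd[OF c(1) xin] in auto)
  have tr: "((snd d \<circ> x) has_vector_derivative Dtr c d (snd c (x t)) (v t)) (at t within {a..b})"
    if "d \<in> A" "t \<in> {a..b}" "x t \<in> fst d" for d t
    using curve_transition[OF c(1) that(1) _ _ that(3) that(2) v[OF that(2)]] xc xin[OF that(2)] that
    by (auto simp: continuous_on_eq_continuous_within)
  have vel: "velocity {a..b} x t d = Dtr c d (snd c (x t)) (v t)"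
    if "d \<in> A" "t \<in> {a..b}" "x t \<in> fst d" for d t
    unfolding velocity_def using vector_derivative_within_cbox[of a b t] tr[OF that] ab that(2) by auto
  show "velocity {a..b} x t c = v t" if "t \<in> {a..b}" for t
    unfolding velocity_def using vector_derivative_within_cbox[of a b t] v[OF that] ab that by auto
  show "C1_curve_on A {a..b} x" unfolding C1_curve_on_def
  proof (intro conjI ballI)
    fix d assume d: "d \<in> A"
    show "(snd d \<circ> x) differentiable (at t within {a..b})" if "t \<in> {t \<in> {a..b}. x t \<in> fst d}" for t
      using tr[OF d] that by (auto intro: differentiableI_vector)
    let ?N = "{t \<in> {a..b}. x t \<in> fst d}"
    have "continuous_on ?N (\<lambda>t. Dtr c d (snd c (x t)) (v t))"
      by (rule smooth_on_continuous_frechet_derivative[OF smooth_transition[OF c(1) d]])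
        (use c in \<open>auto intro!: continuous_on_subset[OF yc] continuous_on_subset[OF vc] snd_in_overlap\<close>)
    then show "continuous_on ?N (\<lambda>t. velocity {a..b} x t d)"
      by (rule continuous_on_eq) (auto simp: vel[OF d])
  qed (rule xc)
qed

lemma C1_curve_on_subinterval:
  assumes x: "C1_curve_on A {a..b} x" and ab: "a \<le> a'" "a' < b'" "b' \<le> b"
  shows "C1_curve_on A {a'..b'} x"
    "\<And>t c. t \<in> {a'..b'} \<Longrightarrow> c \<in> A \<Longrightarrow> x t \<in> fst c \<Longrightarrow> velocity {a'..b'} x t c = velocity {a..b} x t c"
proof -
  have sub: "{a'..b'} \<subseteq> {a..b}" using ab by auto
  have d: "((snd c \<circ> x) has_vector_derivative velocity {a..b} x t c) (at t within {a'..b'})"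
    if "t \<in> {a'..b'}" "c \<in> A" "x t \<in> fst c" for t c
    using C1_curve_on_velocity[OF x _ that(2,3)] sub that(1) has_vector_derivative_within_subset by blast
  show v: "velocity {a'..b'} x t c = velocity {a..b} x t c"
    if "t \<in> {a'..b'}" "c \<in> A" "x t \<in> fst c" for t c
    using vector_derivative_within_cbox[of a' b' t] d[OF that] ab(2) that(1) unfolding velocity_def by auto
  show "C1_curve_on A {a'..b'} x" unfolding C1_curve_on_def
  proof (intro conjI ballI)
    show "continuous_on {a'..b'} x" using C1_curve_on_continuous_on[OF x] sub continuous_on_subset by blast
    fix c assume c: "c \<in> A"
    show "(snd c \<circ> x) differentiable (at t within {a'..b'})" if "t \<in> {t \<in> {a'..b'}. x t \<in> fst c}" for t
      using d[OF _ c] that by (auto intro: differentiableI_vector)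
    have "continuous_on {t \<in> {a..b}. x t \<in> fst c} (\<lambda>t. velocity {a..b} x t c)"
      using x c by (simp add: C1_curve_on_def)
    then have "continuous_on {t \<in> {a'..b'}. x t \<in> fst c} (\<lambda>t. velocity {a..b} x t c)"
      by (rule continuous_on_subset) (use sub in auto)
    then show "continuous_on {t \<in> {a'..b'}. x t \<in> fst c} (\<lambda>t. velocity {a'..b'} x t c)"
      by (rule continuous_on_eq) (auto simp: v c)
  qed
qed

text \<open>Two-sided derivatives make the speed local; it is junk only at the corners and the end points.\<close>

definition spd :: "(real \<Rightarrow> 'm) \<Rightarrow> real \<Rightarrow> real" where
  "spd x t = sqrt (sq_norm A g (x t) (\<lambda>c. vector_derivative (snd c \<circ> x) (at t)))"

lemma spd_nonneg: "spd x t \<ge> 0"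
  by (simp add: spd_def sq_norm_nonneg)

lemma velocity_interior: "a < t \<Longrightarrow> t < b \<Longrightarrow> velocity {a..b} x t = (\<lambda>c. vector_derivative (snd c \<circ> x) (at t))"
  unfolding velocity_def using at_within_Icc_at[of a t b] by simp

lemma spd_velocity: "a < t \<Longrightarrow> t < b \<Longrightarrow> spd x t = sqrt (sq_norm A g (x t) (velocity {a..b} x t))"
  by (simp add: spd_def velocity_interior)

lemma spd_cong_open:
  assumes "open W" "t \<in> W" "\<And>s. s \<in> W \<Longrightarrow> x s = z s"
  shows "spd x t = spd z t"
proof -
  have "((snd c \<circ> x) has_vector_derivative v) (at t) \<longleftrightarrow> ((snd c \<circ> z) has_vector_derivative v) (at t)" for c :: "('m, 'e) chart" and v
    using has_vector_derivative_transform_within_open[of "snd c \<circ> x" v t W "snd c \<circ> z"]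
      has_vector_derivative_transform_within_open[of "snd c \<circ> z" v t W "snd c \<circ> x"] assms by auto
  then have "vector_derivative (snd c \<circ> x) (at t) = vector_derivative (snd c \<circ> z) (at t)" for c :: "('m, 'e) chart"
    unfolding vector_derivative_def by presburger
  then show ?thesis using assms by (simp add: spd_def)
qed

lemma spd_has_integral_velocity:
  assumes x: "C1_curve_on A {a..b} x" and ab: "a < b"
  shows "(spd x has_integral integral {a..b} (\<lambda>t. sqrt (sq_norm A g (x t) (velocity {a..b} x t)))) {a..b}"
proof (rule has_integral_spike_finite[where S="{a,b}"])
  show "((\<lambda>t. sqrt (sq_norm A g (x t) (velocity {a..b} x t))) has_integral
     integral {a..b} (\<lambda>t. sqrt (sq_norm A g (x t) (velocity {a..b} x t)))) {a..b}"
    by (intro integrable_integral integrable_continuous_real continuous_on_real_sqrt continuous_on_sq_norm_velocity x ab)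
  show "spd x t = sqrt (sq_norm A g (x t) (velocity {a..b} x t))" if "t \<in> {a..b} - {a,b}" for t
    using that by (intro spd_velocity) auto
qed auto

lemma spd_integrable: "C1_curve_on A {a..b} x \<Longrightarrow> a < b \<Longrightarrow> spd x integrable_on {a..b}"
  using spd_has_integral_velocity by blast

text \<open>The points are connected by a chain of \<open>C1\<close> arcs of total length
  \<open>l\<close>. With concatenation as a constructor, partitions and gluing are confined to the
  comparison with \<open>riem_dist\<close>, and arguments about lengths become inductions.\<close>

inductive joined :: "'m \<Rightarrow> 'm \<Rightarrow> real \<Rightarrow> bool" where
  arc: "a < b \<Longrightarrow> C1_curve_on A {a..b} x \<Longrightarrow> joined (x a) (x b) (integral {a..b} (spd x))"
| trans: "joined p q l \<Longrightarrow> joined q r l' \<Longrightarrow> joined p r (l + l')"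

lemma joined_nonneg: "joined p q l \<Longrightarrow> l \<ge> 0"
proof (induction rule: joined.induct)
  case (arc a b x)
  then show ?case
    using Henstock_Kurzweil_Integration.integral_nonneg[OF spd_integrable spd_nonneg] by blast
qed simp

lemma joined_refl: "joined p p 0"
proof -
  let ?c = "chart_at A p" and ?x = "\<lambda>t::real. p"
  have x: "C1_curve_on A {0..1} ?x" and v: "\<And>t. t \<in> {0..1} \<Longrightarrow> velocity {0..1} ?x t ?c = 0"
    using C1_curve_in_chart[OF chart_at(1), of ?x 0 1 p "\<lambda>t. 0"] chart_at(2)[of p]
    by (auto simp: o_def)
  have "spd ?x t = 0" if "0 < t" "t < 1" for t
    using v[of t] that chart_at g_zero by (simp add: spd_velocity[of 0 t 1] sq_norm_def Let_def)
  then have "(spd ?x has_integral 0) {0..1}"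
    by (intro has_integral_spike_finite[where S="{0,1}" and f="\<lambda>_. 0", OF _ _ has_integral_0]) auto
  then show ?thesis using arc[OF _ x] by (simp add: integral_unique)
qed

lemma C1_curve_on_affine:
  assumes x: "C1_curve_on A {a..b} x" and ab: "a < b" and m: "m \<noteq> 0"
    and p: "p = (\<lambda>t. m * t + k)" and im: "p ` {a'..b'} = {a..b}" and ab': "a' < b'"
  shows "C1_curve_on A {a'..b'} (x \<circ> p)"
    and "\<And>t. a' < t \<Longrightarrow> t < b' \<Longrightarrow> spd (x \<circ> p) t = \<bar>m\<bar> * spd x (p t)"
proof -
  have pT: "p t \<in> {a..b}" if "t \<in> {a'..b'}" for t using im that by blast
  have dp: "(p has_vector_derivative m) (at t within S)" for t S
    unfolding p has_real_derivative_iff_has_vector_derivative[symmetric] by (auto intro!: derivative_eq_intros)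
  have pc: "continuous_on S p" for S unfolding p by (intro continuous_intros)
  have d: "((snd c \<circ> (x \<circ> p)) has_vector_derivative m *\<^sub>R velocity {a..b} x (p t) c) (at t within {a'..b'})"
    if "t \<in> {a'..b'}" "c \<in> A" "x (p t) \<in> fst c" for t c
    using vector_diff_chain_within[OF dp, of "snd c \<circ> x" "velocity {a..b} x (p t) c" t "{a'..b'}"]
      C1_curve_on_velocity[OF x pT[OF that(1)] that(2,3)] unfolding im by (simp add: o_assoc)
  have v: "velocity {a'..b'} (x \<circ> p) t c = m *\<^sub>R velocity {a..b} x (p t) c"
    if "t \<in> {a'..b'}" "c \<in> A" "x (p t) \<in> fst c" for t c
    using vector_derivative_within_cbox[of a' b' t] d[OF that] ab' that(1) unfolding velocity_def by auto
  show "C1_curve_on A {a'..b'} (x \<circ> p)" unfolding C1_curve_on_def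
  proof (intro conjI ballI)
    show "continuous_on {a'..b'} (x \<circ> p)"
      using C1_curve_on_continuous_on[OF x] im pc by (intro continuous_on_compose) auto
    fix c assume c: "c \<in> A"
    show "(snd c \<circ> (x \<circ> p)) differentiable (at t within {a'..b'})" if "t \<in> {t \<in> {a'..b'}. (x \<circ> p) t \<in> fst c}" for t
      using d[OF _ c] that by (auto intro: differentiableI_vector)
    have "continuous_on {t \<in> {a..b}. x t \<in> fst c} (\<lambda>t. velocity {a..b} x t c)"
      using x c by (simp add: C1_curve_on_def)
    then have "continuous_on {t \<in> {a'..b'}. x (p t) \<in> fst c} (\<lambda>t. velocity {a..b} x (p t) c)"
      by (rule continuous_on_compose2[OF _ pc]) (use pT in auto)
    then have "continuous_on {t \<in> {a'..b'}. x (p t) \<in> fst c} (\<lambda>t. m *\<^sub>R velocity {a..b} x (p t) c)"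
      by (intro continuous_intros)
    then have "continuous_on {t \<in> {a'..b'}. x (p t) \<in> fst c} (\<lambda>t. velocity {a'..b'} (x \<circ> p) t c)"
      by (rule continuous_on_eq) (use v[OF _ c] in simp)
    moreover have "{t \<in> {a'..b'}. (x \<circ> p) t \<in> fst c} = {t \<in> {a'..b'}. x (p t) \<in> fst c}" by simp
    ultimately show "continuous_on {t \<in> {a'..b'}. (x \<circ> p) t \<in> fst c} (\<lambda>t. velocity {a'..b'} (x \<circ> p) t c)"
      by (simp only:)
  qed
  show "spd (x \<circ> p) t = \<bar>m\<bar> * spd x (p t)" if t: "a' < t" "t < b'" for t
  proof -
    let ?c = "chart_at A (x (p t))"
    have "p t \<noteq> p a'" "p t \<noteq> p b'" using t m by (auto simp: p)
    have im': "p a' \<in> {a..b}" "p b' \<in> {a..b}" using im ab' by auto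
    have "a < p t \<and> p t < b"
    proof (cases "m > 0")
      case True
      then have "p a' < p t" "p t < p b'" using t by (auto simp: p)
      then show ?thesis using im' by auto
    next
      case False
      then have "p a' > p t" "p t > p b'" using t m by (auto simp: p mult_less_cancel_left)
      then show ?thesis using im' by auto
    qed
    then have "spd x (p t) = sqrt (sq_norm A g (x (p t)) (velocity {a..b} x (p t)))"
      by (intro spd_velocity) auto
    moreover have "spd (x \<circ> p) t = sqrt (sq_norm A g (x (p t)) (velocity {a'..b'} (x \<circ> p) t))"
      using spd_velocity[OF t] by simp
    moreover have "sq_norm A g (x (p t)) (velocity {a'..b'} (x \<circ> p) t) = m\<^sup>2 * sq_norm A g (x (p t)) (velocity {a..b} x (p t))"
      using v[of t ?c] t chart_at[of "x (p t)"] bilinear_g[OF chart_at(1), of "snd ?c (x (p t))" "x (p t)"]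
      by (simp add: sq_norm_def Let_def bilinear_lmul bilinear_rmul power2_eq_square)
    ultimately show ?thesis by (simp add: real_sqrt_mult)
  qed
qed

lemma joined_sym: "joined p q l \<Longrightarrow> joined q p l"
proof (induction rule: joined.induct)
  case (arc a b x)
  have p: "uminus = (\<lambda>t. (-1) * t + (0::real))" by auto
  have im: "uminus ` {-b..-a} = {a..b}" by simp
  have x': "C1_curve_on A {-b..-a} (x \<circ> uminus)" using C1_curve_on_affine(1)[OF arc(2,1) _ p im] arc by simp
  have s: "spd (x \<circ> uminus) t = spd x (- t)" if "-b < t" "t < -a" for t
    using C1_curve_on_affine(2)[OF arc(2,1) _ p im _ that] arc by simp
  have "((\<lambda>t. spd x (- t)) has_integral integral {a..b} (spd x)) {-b..-a}"
    using spd_integrable[OF arc(2,1)] by (simp add: has_integral_reflect_real has_integral_integral)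
  then have "(spd (x \<circ> uminus) has_integral integral {a..b} (spd x)) {-b..-a}"
    by (rule has_integral_spike_finite[where S="{-b,-a}", rotated -1]) (auto simp: s)
  then show ?case using joined.arc[OF _ x'] arc by (simp add: integral_unique)
next
  case (trans p q l r l')
  then show ?case using joined.trans by (metis add.commute)
qed

lemma arc_sub:
  assumes x: "C1_curve_on A {a..b} x" and "a \<le> s" "s < t" "t \<le> b"
  shows "joined (x s) (x t) (integral {s..t} (spd x))"
  using joined.arc[OF assms(3) C1_curve_on_subinterval(1)[OF assms]] .

text \<open>Length along an arc is continuous, so the intermediate value theorem cuts an arc at any
  prescribed length; in a concatenation the cut falls into one of the two parts or on their joint.
  This is the length space property behind the Hopf-Rinow argument.\<close>

lemma joined_split:
  "joined p q l \<Longrightarrow> 0 < u \<Longrightarrow> u < l \<Longrightarrow> \<exists>m. joined p m u \<and> joined m q (l - u)"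
proof (induction arbitrary: u rule: joined.induct)
  case (arc a b x)
  have int: "spd x integrable_on {a..b}" by (rule spd_integrable[OF arc(2,1)])
  have "continuous_on {a..b} (\<lambda>s. integral {a..s} (spd x))"
    by (rule indefinite_integral_continuous_1[OF int])
  then obtain s where s: "s \<ge> a" "s \<le> b" "integral {a..s} (spd x) = u"
    using IVT'[of "\<lambda>s. integral {a..s} (spd x)" a u b] arc by auto
  then have "s \<noteq> a" "s \<noteq> b" using arc by auto
  then have ab: "a < s" "s < b" using s by auto
  have "integral {s..b} (spd x) = integral {a..b} (spd x) - u"
    using Henstock_Kurzweil_Integration.integral_combine[OF s(1,2) int] s(3) by simp
  then show ?case using arc_sub[OF arc(2), of a s] arc_sub[OF arc(2), of s b] ab s(3) by fastforce
next
  case (trans p q l r l')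
  consider "u < l" | "u = l" | "u > l" by linarith
  then show ?case
  proof cases
    case 1
    then obtain m where "joined p m u" "joined m q (l - u)" using trans by blast
    then show ?thesis using joined.trans[of m q "l - u" r l'] trans(2) by (auto simp: algebra_simps)
  next
    case 2
    then show ?thesis using trans by auto
  next
    case 3
    then obtain m where "joined q m (u - l)" "joined m r (l' - (u - l))"
      using trans.IH(2)[of "u - l"] trans.prems by auto
    then show ?thesis using joined.trans[of p q l m "u - l"] trans(1) by (auto simp: algebra_simps)
  qed
qed

end

section \<open>Comparison with coordinates\<close>

context riemannian
begin

definition coord_ball :: "('m, 'e) chart \<Rightarrow> 'e \<Rightarrow> real \<Rightarrow> bool" where
  "coord_ball c y r \<longleftrightarrow> c \<in> A \<and> r > 0 \<and> cball y r \<subseteq> img c"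

lemma coord_ball_exists:
  assumes "c \<in> A" "q \<in> fst c"
  shows "\<exists>r. coord_ball c (snd c q) r"
  using open_contains_cball[of "img c"] open_img[OF assms(1)] assms unfolding coord_ball_def by blast

text \<open>Minimum and maximum of the norm over the compact product of the ball with the unit
  sphere, extended by homogeneity. In dimension 0 the sphere is empty and any positive constants
  serve.\<close>

lemma coord_ball_comparison:
  assumes "coord_ball c y0 r"
  shows "\<exists>l>0. \<exists>L>0. \<forall>y\<in>cball y0 r. \<forall>u. l * norm u \<le> sqrt (g c y u u) \<and> sqrt (g c y u u) \<le> L * norm u"
proof (cases "\<exists>u::'e. norm u = 1")
  case True
  have c: "c \<in> A" and r: "r > 0" and sub: "cball y0 r \<subseteq> img c" using assms by (auto simp: coord_ball_def)
  let ?K = "cball y0 r \<times> sphere (0::'e) 1"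
  let ?f = "\<lambda>p. sqrt (g c (fst p) (snd p) (snd p))"
  have "sphere (0::'e) 1 = {u. norm u = 1}" by auto
  moreover have "closed {u::'e. norm u = 1}" by (intro closed_Collect_eq continuous_intros)
  moreover have "bounded (sphere (0::'e) 1)" by (rule bounded_subset[OF bounded_cball[of 0 1]]) auto
  ultimately have "compact (sphere (0::'e) 1)" unfolding compact_eq_bounded_closed by metis
  then have K: "compact ?K" by (intro compact_Times compact_cball)
  have bil: "bilinear (g c (fst p))" if "p \<in> ?K" for p using that sub by (intro bilinear_g[OF c]) auto
  have guv: "continuous_on ?K (\<lambda>p. g c (fst p) u v)" for u v
    by (rule continuous_on_compose2[OF smooth_on_continuous[OF smooth_g[OF c]] continuous_on_fst[OF continuous_on_id]])
      (use sub in auto)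
  have s: "continuous_on ?K (\<lambda>p. snd p)" by (intro continuous_intros)
  have "continuous_on ?K (\<lambda>p. g c (fst p) (snd p) (snd p))"
    by (rule continuous_on_bilinear_family[where L="\<lambda>p. g c (fst p)", OF bil guv s s])
  then have f: "continuous_on ?K ?f" by (rule continuous_on_real_sqrt)
  have ne: "?K \<noteq> {}" using True r by (auto intro!: exI[of _ y0])
  obtain p where p: "p \<in> ?K" "\<And>p'. p' \<in> ?K \<Longrightarrow> ?f p \<le> ?f p'"
    using continuous_attains_inf[OF K ne f] by blast
  obtain q where q: "q \<in> ?K" "\<And>p'. p' \<in> ?K \<Longrightarrow> ?f p' \<le> ?f q"
    using continuous_attains_sup[OF K ne f] by blast
  have "snd p \<noteq> 0" using p(1) by auto
  then have pos: "?f p > 0" using g_pos[OF c, of "fst p" "snd p"] p(1) sub by auto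
  moreover have "?f q > 0" using pos q(2)[OF p(1)] by linarith
  moreover have "?f p * norm u \<le> sqrt (g c y u u) \<and> sqrt (g c y u u) \<le> ?f q * norm u" if y: "y \<in> cball y0 r" for y u
  proof (cases "u = 0")
    case True
    then show ?thesis using g_zero[OF c, of y] y sub by auto
  next
    case False
    let ?e = "u /\<^sub>R norm u"
    have bily: "bilinear (g c y)" using y sub by (intro bilinear_g[OF c]) auto
    have "g c y u u = (norm u)\<^sup>2 * g c y ?e ?e"
      using False by (simp add: field_simps bilinear_lmul[OF bily] bilinear_rmul[OF bily] power2_eq_square)
    then have eq: "sqrt (g c y u u) = norm u * sqrt (g c y ?e ?e)" by (simp add: real_sqrt_mult)
    have "(y, ?e) \<in> ?K" using y False by simp
    then have "?f p \<le> sqrt (g c y ?e ?e)" "sqrt (g c y ?e ?e) \<le> ?f q" using p(2) q(2) by fastforce+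
    then show ?thesis unfolding eq by (auto simp: mult.commute[of _ "norm u"] intro!: mult_left_mono)
  qed
  ultimately show ?thesis by blast
next
  case False
  then have z: "u = 0" for u :: 'e
    by (metis norm_sgn)
  have "sqrt (g c y u u) = 0" if "y \<in> cball y0 r" for y u
    using g_zero[of c y u] z[of u] assms that by (auto simp: coord_ball_def)
  then show ?thesis using z by (intro exI[of _ 1] conjI) (auto simp: z[of "_::'e"])
qed

section \<open>Short chains stay in a coordinate ball\<close>

definition lower_bound :: "('m, 'e) chart \<Rightarrow> 'e \<Rightarrow> real \<Rightarrow> real \<Rightarrow> bool" where
  "lower_bound c y0 r l \<longleftrightarrow> l > 0 \<and> (\<forall>y\<in>cball y0 r. \<forall>u. l * norm u \<le> sqrt (g c y u u))"

lemma open_coord_preimage: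
  assumes "c \<in> A" "open W"
  shows "open {q \<in> fst c. snd c q \<in> W}"
proof -
  have "{q \<in> fst c. snd c q \<in> W} = snd c -` W \<inter> fst c" by auto
  then show ?thesis using continuous_on_open_vimage[OF open_chart[OF assms(1)]] continuous_on_chart[OF assms(1)] assms(2)
    by metis
qed

lemma compact_coord_cball:
  assumes "coord_ball c y0 r" "s \<le> r"
  shows "compact (cinv c ` cball y0 s)"
proof -
  have "cball y0 s \<subseteq> img c" using assms by (auto simp: coord_ball_def subset_iff)
  then show ?thesis using assms(1) continuous_on_subset[OF continuous_on_cinv]
    by (intro compact_continuous_image compact_cball) (auto simp: coord_ball_def)
qed

text \<open>A short curve from the inner part of a coordinate ball cannot leave it: up to the first exit time its
  coordinates stay in a smaller closed ball, whose preimage is closed because it is compact.\<close>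

lemma short_arc_stays:
  assumes cb: "coord_ball c y0 r" and l: "lower_bound c y0 r l"
    and x: "C1_curve_on A {a..b} x" and ab: "a < b" and xa: "x a \<in> fst c"
    and sm: "norm (snd c (x a) - y0) + integral {a..b} (spd x) / l < r"
  shows "x b \<in> fst c \<and> l * norm (snd c (x b) - snd c (x a)) \<le> integral {a..b} (spd x)"
proof -
  have c: "c \<in> A" and r: "r > 0" and sub: "cball y0 r \<subseteq> img c" using cb by (auto simp: coord_ball_def)
  have l0: "l > 0" and lb: "\<And>y u. y \<in> cball y0 r \<Longrightarrow> l * norm u \<le> sqrt (g c y u u)"
    using l by (auto simp: lower_bound_def)
  define V where "V = {q \<in> fst c. snd c q \<in> ball y0 r}"
  define I where "I = integral {a..b} (spd x)"
  \<comment> \<open>The bound that the length of the whole arc gives for the coordinates at all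
    times before a possible exit. That it is strictly below \<open>r\<close> is what excludes the
    exit.\<close>
  define \<rho> where "\<rho> = norm (snd c (x a) - y0) + I / l"
  have oV: "open V" unfolding V_def by (rule open_coord_preimage[OF c open_ball])
  have I0: "I \<ge> 0" unfolding I_def using joined_nonneg[OF joined.arc[OF ab x]] .
  have \<rho>: "\<rho> < r" using sm by (simp add: \<rho>_def I_def)
  have xaV: "x a \<in> V"
  proof -
    have "I / l \<ge> 0" using I0 l0 by simp
    then have "norm (snd c (x a) - y0) < r" using \<rho> unfolding \<rho>_def by linarith
    then show ?thesis using xa by (simp add: V_def dist_norm norm_minus_commute)
  qed
  let ?\<sigma> = "\<lambda>t. sqrt (sq_norm A g (x t) (velocity {a..b} x t))"
  have \<sigma>c: "continuous_on {a..b} ?\<sigma>" by (intro continuous_on_real_sqrt continuous_on_sq_norm_velocity x ab)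
  have \<sigma>I: "integral {a..b} ?\<sigma> = I"
    using spd_has_integral_velocity[OF x ab] unfolding I_def by (rule integral_unique[symmetric])
  \<comment> \<open>The coordinate increment is compared with arc length through their derivatives.
    Only the times before \<open>s\<close> are required to lie in \<open>V\<close>, so the estimate
    is available before it is known that the arc never leaves.\<close>
  have est: "l * norm (snd c (x s) - snd c (x a)) \<le> I" if s: "a < s" "s \<le> b" and V: "x ` {a..<s} \<subseteq> V" "x s \<in> fst c" for s
  proof -
    let ?f = "\<lambda>t. l *\<^sub>R snd c (x t)" and ?\<phi> = "\<lambda>t. integral {a..t} ?\<sigma>"
    have xin: "x t \<in> fst c" if "t \<in> {a..s}" for t 
    proof (cases "t = s")
      case False
      then have "x t \<in> V" using V(1) that by (intro subsetD[OF V(1)] imageI) simp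
      then show ?thesis by (simp add: V_def)
    qed (use V in simp)
    have xs: "continuous_on {a..s} x" using C1_curve_on_continuous_on[OF x] s by (auto intro: continuous_on_subset)
    have "norm (?f s - ?f a) \<le> ?\<phi> s - ?\<phi> a"
    proof (rule differentiable_bound_general[OF s(1)])
      have "continuous_on {a..s} (\<lambda>t. snd c (x t))"
        by (rule continuous_on_compose2[OF continuous_on_chart[OF c] xs]) (use xin in auto)
      then show "continuous_on {a..s} ?f" by (intro continuous_intros)
      have "continuous_on {a..b} ?\<phi>"
        by (rule indefinite_integral_continuous_1[OF integrable_continuous_real[OF \<sigma>c]])
      then show "continuous_on {a..s} ?\<phi>" by (rule continuous_on_subset) (use s in auto)
      fix t assume t: "a < t" "t < s"
      have tab: "t \<in> {a..b}" "t < b" using t s by auto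
      have ts: "x t \<in> V" using V t by auto
      have "((snd c \<circ> x) has_vector_derivative velocity {a..b} x t c) (at t within {a..b})"
        using C1_curve_on_velocity[OF x tab(1) c] ts by (auto simp: V_def)
      from has_vector_derivative_at_within_Icc[OF this t(1) tab(2)]
      have d: "((\<lambda>t. snd c (x t)) has_vector_derivative velocity {a..b} x t c) (at t)" by (simp add: o_def)
      then show "(?f has_vector_derivative l *\<^sub>R velocity {a..b} x t c) (at t)"
        using bounded_linear.has_vector_derivative[OF bounded_linear_scaleR_right] by blast
      show "(?\<phi> has_vector_derivative ?\<sigma> t) (at t)"
        using has_vector_derivative_at_within_Icc[OF integral_has_vector_derivative[OF \<sigma>c tab(1)] t(1) tab(2)] .
      have "?\<sigma> t = sqrt (g c (snd c (x t)) (velocity {a..b} x t c) (velocity {a..b} x t c))"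
        using sq_norm_velocity[OF x tab(1) ab c] ts by (simp add: V_def)
      moreover have "snd c (x t) \<in> cball y0 r" using ts by (simp add: V_def)
      ultimately show "norm (l *\<^sub>R velocity {a..b} x t c) \<le> ?\<sigma> t" using lb l0 by simp
    qed
    then have "l * norm (snd c (x s) - snd c (x a)) \<le> ?\<phi> s"
      using l0 by (simp flip: scaleR_diff_right)
    also have "?\<phi> s \<le> ?\<phi> b"
    proof -
      have i: "?\<sigma> integrable_on {a..b}" by (rule integrable_continuous_real[OF \<sigma>c])
      have "integral {s..b} ?\<sigma> \<ge> 0"
        using integrable_on_subinterval[OF i, of s b] s
        by (intro Henstock_Kurzweil_Integration.integral_nonneg) (auto simp: sq_norm_nonneg)
      then show ?thesis using Henstock_Kurzweil_Integration.integral_combine[OF less_imp_le[OF s(1)] s(2) i] by linarith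
    qed
    finally show ?thesis using \<sigma>I by simp
  qed
  have all: "x ` {a..b} \<subseteq> V"
  proof (rule ccontr)
    assume out: "\<not> x ` {a..b} \<subseteq> V"
    define B where "B = {s \<in> {a..b}. x s \<notin> V}"
    have "B \<noteq> {}" using out unfolding B_def by auto
    have "closedin (top_of_set {a..b}) ({a..b} \<inter> x -` (- V))"
      using C1_curve_on_continuous_on[OF x] oV by (intro continuous_closedin_preimage) auto
    moreover have "{a..b} \<inter> x -` (- V) = B" by (auto simp: B_def)
    ultimately have "closed B" using closedin_closed_trans by (metis closed_atLeastAtMost)
    moreover have bb: "bdd_below B" unfolding B_def by (rule bdd_belowI[of _ a]) auto
    ultimately have s0B: "Inf B \<in> B" using closed_contains_Inf[OF \<open>B \<noteq> {}\<close>] by blast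
    define s where "s = Inf B"
    have s: "s \<in> {a..b}" "x s \<notin> V" using s0B by (auto simp: B_def s_def)
    have "s \<noteq> a" using s xaV by auto
    then have as: "a < s" using s by auto
    have before: "x t \<in> V" if "a \<le> t" "t < s" for t
      using cInf_lower[OF _ bb, of t] that s unfolding s_def[symmetric] by (fastforce simp: B_def)
    define C where "C = cinv c ` cball y0 \<rho>"
    have "compact C" unfolding C_def by (rule compact_coord_cball[OF cb]) (use \<rho> in simp)
    then have clC: "closed C" by (rule compact_imp_closed)
    have CV: "C \<subseteq> V"
    proof
      fix q assume "q \<in> C"
      then obtain y where y: "y \<in> cball y0 \<rho>" "q = cinv c y" by (auto simp: C_def)
      have "y \<in> ball y0 r" using y(1) \<rho> by simp
      moreover then have "y \<in> img c" using sub by auto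
      ultimately show "q \<in> V" using y(2) snd_cinv cinv_in by (auto simp: V_def)
    qed
    have inC: "x t \<in> C" if t: "a \<le> t" "t < s" for t
    proof -
      have xV: "x t \<in> V" using before t by auto
      have "l * norm (snd c (x t) - snd c (x a)) \<le> I"
      proof (cases "t = a")
        case False
        moreover have "x ` {a..<t} \<subseteq> V" using before t by force
        ultimately show ?thesis using est[of t] t s xV by (simp add: V_def)
      qed (use I0 in simp)
      then have "norm (snd c (x t) - snd c (x a)) \<le> I / l" using l0 by (simp add: field_simps)
      then have "norm (snd c (x t) - y0) \<le> \<rho>" unfolding \<rho>_def
        using norm_triangle_ineq[of "snd c (x t) - snd c (x a)" "snd c (x a) - y0"] by simp
      then have "snd c (x t) \<in> cball y0 \<rho>" by (simp add: dist_norm norm_minus_commute)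
      then show ?thesis unfolding C_def using cinv_snd[OF c, of "x t"] xV by (force simp: V_def)
    qed
    have "x s \<in> C"
    proof -
      have xs: "continuous_on {a..s} x" using C1_curve_on_continuous_on[OF x] s by (auto intro: continuous_on_subset)
      have "x ` closure {a..<s} \<subseteq> C"
        by (rule image_closure_subset[OF _ clC]) (use inC xs as in auto)
      then show ?thesis using as by auto
    qed
    then show False using CV s by blast
  qed
  have "x b \<in> V" using all ab by (intro subsetD[OF all] imageI) simp
  then have "x b \<in> fst c" by (simp add: V_def)
  moreover have "x ` {a..<b} \<subseteq> V" using all by auto
  ultimately show ?thesis using est[OF ab order_refl] unfolding I_def by blast
qed

text \<open>Induction over the chain: the first part uses up at most \<open>k / l\<close> of the
  distance to the boundary of the ball, and what remains suffices for the second part.\<close>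

lemma short_joined_stays:
  assumes cb: "coord_ball c y0 r" and l: "lower_bound c y0 r l"
  shows "joined p q k \<Longrightarrow> p \<in> fst c \<Longrightarrow> norm (snd c p - y0) + k / l < r \<Longrightarrow>
    q \<in> fst c \<and> l * norm (snd c q - snd c p) \<le> k"
proof (induction rule: joined.induct)
  case (arc a b x)
  show ?case by (rule short_arc_stays[OF cb l arc(2,1,3,4)])
next
  case (trans p q k s k')
  have l0: "l > 0" using l by (simp add: lower_bound_def)
  have "k' / l \<ge> 0" using joined_nonneg[OF trans(2)] l0 by simp
  then have "norm (snd c p - y0) + k / l < r" using trans.prems(2) by (simp add: add_divide_distrib)
  then have q: "q \<in> fst c" "l * norm (snd c q - snd c p) \<le> k" using trans.IH(1) trans.prems(1) by auto
  then have n: "norm (snd c q - snd c p) \<le> k / l" using l0 by (simp add: field_simps)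
  have "norm (snd c q - y0) \<le> norm (snd c p - y0) + k / l"
    using norm_triangle_ineq[of "snd c q - snd c p" "snd c p - y0"] n by simp
  then have "norm (snd c q - y0) + k' / l < r" using trans.prems(2) by (simp add: add_divide_distrib)
  then have s: "s \<in> fst c" "l * norm (snd c s - snd c q) \<le> k'" using trans.IH(2) q(1) by auto
  have "norm (snd c s - snd c p) \<le> norm (snd c s - snd c q) + norm (snd c q - snd c p)"
    using norm_triangle_ineq[of "snd c s - snd c q" "snd c q - snd c p"] by simp
  then have "l * norm (snd c s - snd c p) \<le> l * (norm (snd c s - snd c q) + norm (snd c q - snd c p))"
    using l0 by (intro mult_left_mono) auto
  then show ?case using s q by (simp add: distrib_left)
qed

text \<open>The coordinate segment stays in the ball by convexity, and its speed is at most
  \<open>L * norm (y2 - y1)\<close>. As a counterpart to \<open>short_joined_stays\<close> it bounds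
  the Riemannian distance by a multiple of the coordinate distance.\<close>

lemma joined_segment:
  assumes cb: "coord_ball c y0 r"
    and L: "\<And>y u. y \<in> cball y0 r \<Longrightarrow> sqrt (g c y u u) \<le> L * norm u"
    and y: "y1 \<in> cball y0 r" "y2 \<in> cball y0 r"
  shows "\<exists>k \<le> L * norm (y2 - y1). joined (cinv c y1) (cinv c y2) k"
proof -
  have c: "c \<in> A" and sub: "cball y0 r \<subseteq> img c" using cb by (auto simp: coord_ball_def)
  let ?z = "\<lambda>t::real. y1 + t *\<^sub>R (y2 - y1)" and ?x = "\<lambda>t::real. cinv c (y1 + t *\<^sub>R (y2 - y1))"
  have z: "?z t \<in> cball y0 r" if "t \<in> {0..1}" for t
  proof -
    have "(1 - t) *\<^sub>R y1 + t *\<^sub>R y2 \<in> cball y0 r"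
      using y that by (intro convexD[OF convex_cball]) auto
    then show ?thesis by (simp add: algebra_simps)
  qed
  have zi: "?z t \<in> img c" if "t \<in> {0..1}" for t using z[OF that] sub by blast
  have xi: "?x ` {0..1} \<subseteq> fst c" using zi cinv_in by auto
  have d: "((snd c \<circ> ?x) has_vector_derivative (y2 - y1)) (at t within {0..1})" if t: "t \<in> {0..1}" for t
  proof -
    have "(?z has_vector_derivative (y2 - y1)) (at t within {0..1})"
      by (auto intro!: derivative_eq_intros)
    then show ?thesis
      by (rule has_vector_derivative_transform[OF t, rotated]) (simp add: snd_cinv zi)
  qed
  have x: "C1_curve_on A {0..1} ?x" and v: "\<And>t. t \<in> {0..1} \<Longrightarrow> velocity {0..1} ?x t c = y2 - y1"
    using C1_curve_in_chart[OF c xi _ d] by auto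
  let ?\<sigma> = "\<lambda>t. sqrt (sq_norm A g (?x t) (velocity {0..1} ?x t))"
  have le: "?\<sigma> t \<le> L * norm (y2 - y1)" if t: "t \<in> {0..1}" for t
  proof -
    have "?x t \<in> fst c" using xi t by blast
    then have "?\<sigma> t = sqrt (g c (?z t) (y2 - y1) (y2 - y1))"
      using sq_norm_velocity[OF x t _ c] v[OF t] snd_cinv[OF zi[OF t]] by simp
    then show ?thesis using L[OF z[OF t]] by simp
  qed
  have "integral {0..1} ?\<sigma> \<le> integral {0..1} (\<lambda>t::real. L * norm (y2 - y1))"
    by (intro integral_le le integrable_continuous_real continuous_on_real_sqrt continuous_on_sq_norm_velocity x continuous_intros) simp
  moreover have "integral {0..1} (spd ?x) = integral {0..1} ?\<sigma>"
    using spd_has_integral_velocity[OF x] by (intro integral_unique) simp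
  ultimately have "integral {0..1} (spd ?x) \<le> integral {0..1} (\<lambda>t::real. L * norm (y2 - y1))" by simp
  then have "integral {0..1} (spd ?x) \<le> L * norm (y2 - y1)" by simp
  moreover have "joined (?x 0) (?x 1) (integral {0..1} (spd ?x))" by (rule joined.arc[OF _ x]) simp
  ultimately show ?thesis by auto
qed

end

section \<open>The Hopf-Rinow theorem\<close>

text \<open>The version for length spaces, which needs no geodesics: the radii of compact balls form an interval
  that is closed by total boundedness and open by local compactness.\<close>

lemma (in Metric_space) hopf_rinow_cohn_vossen:
  assumes complete: mcomplete
    and local_compact: "\<And>q. q \<in> M \<Longrightarrow> \<exists>r>0. compactin mtopology (mcball q r)"
    and len: "\<And>p q a b. p \<in> M \<Longrightarrow> q \<in> M \<Longrightarrow> 0 < a \<Longrightarrow> 0 < b \<Longrightarrow> d p q < a + b \<Longrightarrow>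
      \<exists>m\<in>M. d p m \<le> a \<and> d m q \<le> b"
    and p: "p \<in> M"
  shows "compactin mtopology (mcball p R)"
proof (rule ccontr)
  assume R: "\<not> compactin mtopology (mcball p R)"
  define G where "G = {r. compactin mtopology (mcball p r)}"
  have mono: "r \<in> G" if "r \<le> s" "s \<in> G" for r s
    using closed_compactin[OF _ mcball_subset_concentric[OF that(1)] closedin_mcball] that(2) by (simp add: G_def)
  obtain r0 where r0: "r0 > 0" "r0 \<in> G" using local_compact[OF p] by (auto simp: G_def)
  have RG: "R \<notin> G" using R by (simp add: G_def)
  have bdd: "bdd_above G" using mono RG by (intro bdd_aboveI[of _ R]) (meson linear)
  define S where "S = Sup G"
  have S: "S \<ge> r0" unfolding S_def by (rule cSup_upper[OF r0(2) bdd])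
  have below: "r \<in> G" if "r < S" for r
    using less_cSupE[of r G] that r0(2) mono unfolding S_def by (metis empty_iff less_imp_le)
  have "mtotally_bounded (mcball p S)"
    unfolding mtotally_bounded_def
  proof (intro allI impI)
    fix e :: real assume e: "e > 0"
    \<comment> \<open>By \<open>len\<close> every point of the ball of radius \<open>S\<close> has a
      point of the ball of radius \<open>S - \<delta>\<close> within
      \<open>2 * \<delta> \<le> e / 2\<close>, so an \<open>e/2\<close>-net of the smaller ball is
      an \<open>e\<close>-net of the larger. The bound \<open>S/2\<close> keeps
      \<open>S - \<delta>\<close> positive.\<close>
    define \<delta> where "\<delta> = min (e/4) (S/2)"
    have \<delta>: "\<delta> > 0" "\<delta> \<le> e/4" "\<delta> \<le> S/2" using e S r0 by (auto simp: \<delta>_def)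
    have "S - \<delta> \<in> G" using below \<delta> by simp
    then have "mtotally_bounded (mcball p (S - \<delta>))" unfolding G_def using compactin_imp_mtotally_bounded by blast
    then obtain K where K: "finite K" "K \<subseteq> mcball p (S - \<delta>)" "mcball p (S - \<delta>) \<subseteq> (\<Union>x\<in>K. mball x (e/2))"
      using e unfolding mtotally_bounded_def by (meson half_gt_zero)
    have "mcball p S \<subseteq> (\<Union>x\<in>K. mball x e)"
    proof
      fix q assume q: "q \<in> mcball p S"
      then have "d p q < (S - \<delta>) + 2 * \<delta>" using \<delta> by simp
      then obtain m where m: "m \<in> M" "d p m \<le> S - \<delta>" "d m q \<le> 2 * \<delta>"
        using len[of p q "S - \<delta>" "2 * \<delta>"] p q \<delta> S r0 by auto
      then have "m \<in> mcball p (S - \<delta>)" using p by simp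
      then obtain k where k: "k \<in> K" "m \<in> mball k (e/2)" using K(3) by blast
      have "d k q \<le> d k m + d m q" using k m q by (intro triangle) auto
      then have "d k q < e" using k m \<delta> by simp
      then show "q \<in> (\<Union>x\<in>K. mball x e)" using k q by auto
    qed
    moreover have "K \<subseteq> mcball p S" using K(2) \<delta>(1) by force
    ultimately show "\<exists>K. finite K \<and> K \<subseteq> mcball p S \<and> mcball p S \<subseteq> (\<Union>x\<in>K. mball x e)" using K(1) by blast
  qed
  then have comp: "compactin mtopology (mcball p S)"
    using mtotally_bounded_eq_compact_closure_of[OF complete] closure_of_eq[of mtopology "mcball p S"] by simp
  obtain \<rho> where \<rho>: "\<And>q. q \<in> M \<Longrightarrow> \<rho> q > 0 \<and> compactin mtopology (mcball q (\<rho> q))" using local_compact by metis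
  have "\<exists>F. finite F \<and> F \<subseteq> (\<lambda>q. mball q (\<rho> q / 2)) ` mcball p S \<and> mcball p S \<subseteq> \<Union>F"
    by (rule compactinD[OF comp]) (use \<rho> in \<open>auto intro!: bexI simp: in_mball\<close>)
  then obtain F where F: "finite F" "F \<subseteq> mcball p S" "mcball p S \<subseteq> (\<Union>q\<in>F. mball q (\<rho> q / 2))"
    by (metis (no_types, lifting) finite_subset_image)
  have FM: "F \<subseteq> M" using F(2) by auto
  have "p \<in> mcball p S" using p S r0 by simp
  then have Fne: "F \<noteq> {}" using F(3) by blast
  \<comment> \<open>A Lebesgue number: points within \<open>\<delta>\<close> of the ball of radius
    \<open>S\<close> lie in the union of the finitely many compact balls. The radius
    \<open>S + \<delta>/2\<close> below leaves room for the strict inequality that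
    \<open>len\<close> demands.\<close>
  define \<delta> where "\<delta> = Min ((\<lambda>q. \<rho> q / 2) ` F)"
  have \<delta>: "\<delta> > 0" using F(1) Fne \<rho> FM by (auto simp: \<delta>_def subset_iff)
  have \<delta>le: "\<delta> \<le> \<rho> q / 2" if "q \<in> F" for q
    unfolding \<delta>_def using F(1) that by (intro Min_le) auto
  have "mcball p (S + \<delta>/2) \<subseteq> (\<Union>q\<in>F. mcball q (\<rho> q))"
  proof
    fix x assume x: "x \<in> mcball p (S + \<delta>/2)"
    then have "d p x < S + \<delta>" using \<delta> by simp
    then obtain m where m: "m \<in> M" "d p m \<le> S" "d m x \<le> \<delta>"
      using len[of p x S \<delta>] p x \<delta> S r0 by auto
    then have "m \<in> mcball p S" using p by simp
    then obtain q where q: "q \<in> F" "m \<in> mball q (\<rho> q / 2)" using F(3) by blast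
    have "d q x \<le> d q m + d m x" using q m x by (intro triangle) auto
    then have "d q x \<le> \<rho> q" using q m \<delta>le[OF q(1)] by simp
    then show "x \<in> (\<Union>q\<in>F. mcball q (\<rho> q))" using q x by auto
  qed
  moreover have "compactin mtopology (\<Union>q\<in>F. mcball q (\<rho> q))"
    using F(1) FM \<rho> by (intro compactin_Union) auto
  ultimately have "compactin mtopology (mcball p (S + \<delta>/2))" using closed_compactin closedin_mcball by blast
  then have "S + \<delta>/2 \<in> G" by (simp add: G_def)
  then have "S + \<delta>/2 \<le> S" unfolding S_def by (rule cSup_upper[OF _ bdd])
  then show False using \<delta> by simp
qed

context riemannian
begin

section \<open>Piecewise curves and chains of arcs\<close>

definition piecewise_on :: "real \<Rightarrow> real \<Rightarrow> real set \<Rightarrow> (real \<Rightarrow> 'm) \<Rightarrow> bool" where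
  "piecewise_on a b S x \<longleftrightarrow> finite S \<and> {a, b} \<subseteq> S \<and> S \<subseteq> {a..b} \<and>
     (\<forall>s\<in>S. \<forall>t\<in>S. s < t \<and> {s<..<t} \<inter> S = {} \<longrightarrow> C1_curve_on A {s..t} x)"

lemma piecewise_C1_curve_iff: "piecewise_C1_curve A x \<longleftrightarrow> (\<exists>S. piecewise_on 0 1 S x)"
  by (simp add: piecewise_C1_curve_def piecewise_on_def)

text \<open>Induction on the number of partition points, cutting at an interior one; the general
  interval and the explicit partition in \<open>piecewise_on\<close> serve this cut.\<close>

lemma joined_of_piecewise:
  "piecewise_on a b S x \<Longrightarrow> a < b \<Longrightarrow> \<exists>k. (spd x has_integral k) {a..b} \<and> joined (x a) (x b) k"
proof (induction "card S" arbitrary: a b S rule: less_induct)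
  case less
  have S: "finite S" "{a, b} \<subseteq> S" "S \<subseteq> {a..b}"
    and C1: "\<And>s t. s \<in> S \<Longrightarrow> t \<in> S \<Longrightarrow> s < t \<Longrightarrow> {s<..<t} \<inter> S = {} \<Longrightarrow> C1_curve_on A {s..t} x"
    using less.prems(1) by (auto simp: piecewise_on_def)
  show ?case
  proof (cases "{a<..<b} \<inter> S = {}")
    case True
    then have "C1_curve_on A {a..b} x" using C1 S less.prems by auto
    then show ?thesis using joined.arc spd_integrable less.prems(2) by (blast intro: integrable_integral)
  next
    case False
    then obtain m where m: "m \<in> S" "a < m" "m < b" by auto
    have 1: "piecewise_on a m (S \<inter> {a..m}) x" unfolding piecewise_on_def
    proof (intro conjI ballI impI)
      fix s t assume st: "s \<in> S \<inter> {a..m}" "t \<in> S \<inter> {a..m}" "s < t \<and> {s<..<t} \<inter> (S \<inter> {a..m}) = {}"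
      then have "{s<..<t} \<inter> S = {}" by (auto simp: set_eq_iff)
      then show "C1_curve_on A {s..t} x" using C1 st by auto
    qed (use S m in auto)
    have 2: "piecewise_on m b (S \<inter> {m..b}) x" unfolding piecewise_on_def
    proof (intro conjI ballI impI)
      fix s t assume st: "s \<in> S \<inter> {m..b}" "t \<in> S \<inter> {m..b}" "s < t \<and> {s<..<t} \<inter> (S \<inter> {m..b}) = {}"
      then have "{s<..<t} \<inter> S = {}" by (auto simp: set_eq_iff)
      then show "C1_curve_on A {s..t} x" using C1 st by auto
    qed (use S m in auto)
    have "b \<in> S" "b \<notin> {a..m}" "a \<in> S" "a \<notin> {m..b}" using S m by auto
    then have "S \<inter> {a..m} \<subset> S" "S \<inter> {m..b} \<subset> S" by blast+
    then have c: "card (S \<inter> {a..m}) < card S" "card (S \<inter> {m..b}) < card S"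
      using psubset_card_mono[OF S(1)] by auto
    obtain k where k: "(spd x has_integral k) {a..m}" "joined (x a) (x m) k" using less.hyps[OF c(1) 1 m(2)] by blast
    obtain k' where k': "(spd x has_integral k') {m..b}" "joined (x m) (x b) k'" using less.hyps[OF c(2) 2 m(3)] by blast
    show ?thesis using has_integral_combine[OF _ _ k(1) k'(1)] joined.trans[OF k(2) k'(2)] m by auto
  qed
qed

text \<open>\<open>spd\<close> agrees with the speed in \<open>curve_length\<close> except possibly
  at 0 and 1, and a nonnegative gauge integrable function is Lebesgue integrable with the same
  integral.\<close>

lemma curve_length_eq:
  assumes "(spd x has_integral k) {0..1}"
  shows "curve_length A g x = k"
proof -
  let ?\<sigma> = "\<lambda>t. sqrt (sq_norm A g (x t) (velocity {0..1} x t))"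
  have "(?\<sigma> has_integral k) {0..1}"
    by (rule has_integral_spike_finite[where S="{0,1}", OF _ _ assms]) (auto simp: spd_velocity[of 0 _ 1])
  moreover then have "?\<sigma> absolutely_integrable_on {0..1}"
    by (intro nonnegative_absolutely_integrable_1) (auto simp: sq_norm_nonneg)
  then have "(LINT t:{0..1}|lebesgue. ?\<sigma> t) = integral {0..1} ?\<sigma>" by (rule set_lebesgue_integral_eq_integral(2))
  ultimately show ?thesis unfolding curve_length_def by (simp add: integral_unique)
qed

lemma C1_curve_on_cong:
  assumes x: "C1_curve_on A T x" and eq: "\<And>t. t \<in> T \<Longrightarrow> x t = z t"
  shows "C1_curve_on A T z"
proof -
  have tr: "((snd c \<circ> z) has_vector_derivative v) (at t within T) \<longleftrightarrow> ((snd c \<circ> x) has_vector_derivative v) (at t within T)"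
    if "t \<in> T" for t v and c :: "('m, 'e) chart"
    using has_vector_derivative_transform[OF that, of "snd c \<circ> x" "snd c \<circ> z" v] eq
      has_vector_derivative_transform[OF that, of "snd c \<circ> z" "snd c \<circ> x" v] by auto
  then have v: "velocity T z t c = velocity T x t c" if "t \<in> T" for t and c :: "('m, 'e) chart"
    using that unfolding velocity_def vector_derivative_def by presburger
  have N: "{t \<in> T. z t \<in> fst c} = {t \<in> T. x t \<in> fst c}" for c :: "('m, 'e) chart" using eq by auto
  show ?thesis unfolding C1_curve_on_def N
  proof (intro conjI ballI)
    show "continuous_on T z" using C1_curve_on_continuous_on[OF x] by (rule continuous_on_eq) (rule eq)
    fix c assume c: "c \<in> A"
    show "(snd c \<circ> z) differentiable (at t within T)" if "t \<in> {t \<in> T. x t \<in> fst c}" for t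
    proof -
      have "((snd c \<circ> z) has_vector_derivative velocity T x t c) (at t within T)"
        using C1_curve_on_velocity[OF x _ c] tr that by simp
      then show ?thesis by (rule differentiableI_vector)
    qed
    have "continuous_on {t \<in> T. x t \<in> fst c} (\<lambda>t. velocity T x t c)" using x c by (simp add: C1_curve_on_def)
    then show "continuous_on {t \<in> T. x t \<in> fst c} (\<lambda>t. velocity T z t c)"
      by (rule continuous_on_eq) (simp add: v)
  qed
qed

text \<open>The target interval is arbitrary, so that the two parts of a concatenation can be placed
  on its halves; an affine change of parameter does not affect length.\<close>

lemma piecewise_of_joined:
  "joined p q k \<Longrightarrow> a < b \<Longrightarrow> \<exists>x S. piecewise_on a b S x \<and> x a = p \<and> x b = q \<and> (spd x has_integral k) {a..b}"
proof (induction arbitrary: a b rule: joined.induct)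
  case (arc a0 b0 x)
  define m where "m = (b0 - a0) / (b - a)"
  have m: "m > 0" using arc by (simp add: m_def)
  define k where "k = a0 - m * a"
  define h where "h = (\<lambda>t. m * t + k)"
  have ha: "h a = a0" by (simp add: h_def k_def)
  have "m * (b - a) = b0 - a0" using arc(3) by (simp add: m_def)
  then have hb: "h b = b0" by (simp add: h_def k_def algebra_simps)
  have im: "h ` {a..b} = {a0..b0}"
    using image_affinity_atLeastAtMost[of m k a b] m ha hb arc unfolding h_def by simp
  have x: "C1_curve_on A {a..b} (x \<circ> h)"
    using C1_curve_on_affine(1)[OF arc(2,1) _ h_def im arc(3)] m by simp
  have s: "spd (x \<circ> h) t = m * spd x (h t)" if "a < t" "t < b" for t
    using C1_curve_on_affine(2)[OF arc(2,1) _ h_def im arc(3) that] m by simp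
  have i: "(spd x has_integral integral {a0..b0} (spd x)) (cbox a0 b0)"
    using spd_integrable[OF arc(2,1)] by (simp add: integrable_integral)
  have "((\<lambda>t. spd x (m *\<^sub>R t + k)) has_integral integral {a0..b0} (spd x) /\<^sub>R m ^ DIM(real))
     (cbox ((a0 - k) /\<^sub>R m) ((b0 - k) /\<^sub>R m))"
    by (rule has_integral_affinity'[OF i m])
  moreover have "(a0 - k) /\<^sub>R m = a" "(b0 - k) /\<^sub>R m = b"
    using ha hb m by (auto simp: h_def field_simps)
  ultimately have "((\<lambda>t. spd x (h t)) has_integral integral {a0..b0} (spd x) / m) {a..b}"
    by (simp add: h_def field_simps)
  from has_integral_mult_right[OF this, of m]
  have "((\<lambda>t. m * spd x (h t)) has_integral integral {a0..b0} (spd x)) {a..b}" using m by simp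
  then have "(spd (x \<circ> h) has_integral integral {a0..b0} (spd x)) {a..b}"
    by (rule has_integral_spike_finite[where S="{a,b}", rotated -1]) (auto simp: s)
  moreover have "piecewise_on a b {a,b} (x \<circ> h)" using x arc(3) by (auto simp: piecewise_on_def)
  moreover have "(x \<circ> h) a = x a0" "(x \<circ> h) b = x b0" using ha hb by simp_all
  ultimately show ?case by blast
next
  case (trans p q k r k')
  define m where "m = (a + b) / 2"
  have m: "a < m" "m < b" using trans.prems by (auto simp: m_def)
  obtain x S where x: "piecewise_on a m S x" "x a = p" "x m = q" "(spd x has_integral k) {a..m}"
    using trans.IH(1)[OF m(1)] by blast
  obtain y T where y: "piecewise_on m b T y" "y m = q" "y b = r" "(spd y has_integral k') {m..b}"
    using trans.IH(2)[OF m(2)] by blast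
  define z where "z t = (if t \<le> m then x t else y t)" for t
  have zx: "z t = x t" if "t \<le> m" for t using that by (simp add: z_def)
  have zy: "z t = y t" if "t \<ge> m" for t using that x(3) y(2) by (auto simp: z_def)
  have "piecewise_on a b (S \<union> T) z" unfolding piecewise_on_def
  proof (intro conjI ballI impI)
    show "finite (S \<union> T)" "{a, b} \<subseteq> S \<union> T" "S \<union> T \<subseteq> {a..b}"
      using x(1) y(1) m by (auto simp: piecewise_on_def)
    fix s t assume st: "s \<in> S \<union> T" "t \<in> S \<union> T" "s < t \<and> {s<..<t} \<inter> (S \<union> T) = {}"
    have "m \<in> S \<union> T" using x(1) by (auto simp: piecewise_on_def)
    then have "\<not> (s < m \<and> m < t)" using st(3) by auto
    then consider "t \<le> m" | "s \<ge> m" by linarith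
    then show "C1_curve_on A {s..t} z"
    proof cases
      case 1
      have TS: "T \<inter> {..m} \<subseteq> S" using x(1) y(1) by (auto simp: piecewise_on_def)
      have "s \<in> S" "t \<in> S" using st 1 TS by auto
      then have "C1_curve_on A {s..t} x" using x(1) st(3) unfolding piecewise_on_def by blast
      then show ?thesis by (rule C1_curve_on_cong) (use 1 zx in auto)
    next
      case 2
      have ST: "S \<inter> {m..} \<subseteq> T" using x(1) y(1) by (auto simp: piecewise_on_def)
      have "s \<in> T" "t \<in> T" using st 2 ST by auto
      then have "C1_curve_on A {s..t} y" using y(1) st(3) unfolding piecewise_on_def by blast
      then show ?thesis by (rule C1_curve_on_cong) (use 2 zy in auto)
    qed
  qed
  moreover have "(spd z has_integral k) {a..m}"
    by (rule has_integral_spike_finite[where S="{m}", OF _ _ x(4)])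
      (use zx in \<open>auto intro!: spd_cong_open[of "{..<m}"]\<close>)
  moreover have "(spd z has_integral k') {m..b}"
    by (rule has_integral_spike_finite[where S="{m}", OF _ _ y(4)])
      (use zy in \<open>auto intro!: spd_cong_open[of "{m<..}"]\<close>)
  ultimately show ?case
    using has_integral_combine[of a m b "spd z" k k'] m zx[of a] zy[of b] x(2) y(3)
    by (intro exI[of _ z] exI[of _ "S \<union> T"]) auto
qed

text \<open>All later access to \<open>riem_dist\<close> goes through this equivalence. A strict
  bound by a real number avoids the extended reals and the question whether the infimum is
  attained.\<close>

lemma riem_dist_less_iff: "riem_dist A g p q < ereal e \<longleftrightarrow> (\<exists>k<e. joined p q k)"
proof
  assume "riem_dist A g p q < ereal e"
  then obtain x where x: "piecewise_C1_curve A x" "x 0 = p" "x 1 = q" "curve_length A g x < e"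
    unfolding riem_dist_def by (auto simp: Inf_less_iff)
  then obtain S where "piecewise_on 0 1 S x" using piecewise_C1_curve_iff by blast
  then obtain k where "(spd x has_integral k) {0..1}" "joined (x 0) (x 1) k"
    using joined_of_piecewise by fastforce
  then show "\<exists>k<e. joined p q k" using curve_length_eq x by metis
next
  assume "\<exists>k<e. joined p q k"
  then obtain k where k: "k < e" "joined p q k" by blast
  obtain x S where "piecewise_on 0 1 S x" "x 0 = p" "x 1 = q" "(spd x has_integral k) {0..1}"
    using piecewise_of_joined[OF k(2), of 0 1] by auto
  then show "riem_dist A g p q < ereal e"
    unfolding riem_dist_def using k(1) curve_length_eq piecewise_C1_curve_iff by (force simp: Inf_less_iff)
qed

section \<open>The metric space of a component\<close>

definition rdist :: "'m \<Rightarrow> 'm \<Rightarrow> real" where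
  "rdist p q = (if \<exists>k. joined p q k then Inf {k. joined p q k} else 0)"

text \<open>Any two points of a component are joined, so the default value 0 of \<open>rdist\<close>
  for unjoined points never occurs inside it.\<close>

definition component :: "'m \<Rightarrow> 'm set" where
  "component p = {q. \<exists>k. joined p q k}"

lemma rdist_eq_Inf: "joined p q k \<Longrightarrow> rdist p q = Inf {k. joined p q k}"
  by (auto simp: rdist_def)

lemma bdd_below_joined: "bdd_below {k. joined p q k}"
  by (rule bdd_belowI[of _ 0]) (simp add: joined_nonneg)

lemma rdist_less_iff: "joined p q k0 \<Longrightarrow> rdist p q < e \<longleftrightarrow> (\<exists>k<e. joined p q k)"
  using cInf_less_iff[OF _ bdd_below_joined, of p q e] by (auto simp: rdist_eq_Inf)

lemma rdist_le: "joined p q k \<Longrightarrow> rdist p q \<le> k"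
  using cInf_lower[OF _ bdd_below_joined, of k p q] by (simp add: rdist_eq_Inf)

lemma rdist_nonneg: "rdist p q \<ge> 0"
proof (cases "\<exists>k. joined p q k")
  case True
  then show ?thesis using cInf_greatest[of "{k. joined p q k}" 0] joined_nonneg by (auto simp: rdist_def)
qed (simp add: rdist_def)

lemma component_joined: "p \<in> component b \<Longrightarrow> q \<in> component b \<Longrightarrow> \<exists>k. joined p q k"
  unfolding component_def using joined_sym joined.trans by blast

lemma component_step: "p \<in> component b \<Longrightarrow> joined p q k \<Longrightarrow> q \<in> component b"
  unfolding component_def using joined.trans by blast

lemma lower_bound_exists: "coord_ball c y0 r \<Longrightarrow> \<exists>l. lower_bound c y0 r l"
  using coord_ball_comparison unfolding lower_bound_def by blast

text \<open>A chain shorter than \<open>l * r\<close> cannot leave the coordinate ball around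
  \<open>p\<close> and moves the coordinates by at most its length over \<open>l\<close>; letting
  the length tend to 0 identifies the coordinates.\<close>

lemma joined_arbitrarily_short:
  assumes "\<And>e. e > 0 \<Longrightarrow> \<exists>k<e. joined p q k"
  shows "p = q"
proof -
  let ?c = "chart_at A p"
  obtain r where cb: "coord_ball ?c (snd ?c p) r" using coord_ball_exists[OF chart_at] by blast
  obtain l where l: "lower_bound ?c (snd ?c p) r l" using lower_bound_exists[OF cb] by blast
  have l0: "l > 0" and r: "r > 0" using l cb by (auto simp: lower_bound_def coord_ball_def)
  have *: "q \<in> fst ?c \<and> l * norm (snd ?c q - snd ?c p) \<le> e" if e: "e > 0" "e \<le> l * r" for e
  proof -
    obtain k where k: "k < e" "joined p q k" using assms[OF e(1)] by blast
    have "k / l < r" using k e(2) l0 by (simp add: field_simps)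
    then show ?thesis using short_joined_stays[OF cb l k(2) chart_at(2)] k(1) by simp
  qed
  have q: "q \<in> fst ?c" using *[of "l * r"] l0 r by simp
  have "l * norm (snd ?c q - snd ?c p) \<le> 0"
  proof (rule field_le_epsilon)
    fix e :: real assume "e > 0"
    then have "min e (l * r) > 0" using l0 r by simp
    from *[OF this] show "l * norm (snd ?c q - snd ?c p) \<le> 0 + e" by simp
  qed
  then have "snd ?c q = snd ?c p" using l0 by (simp add: mult_le_0_iff)
  then show ?thesis using cinv_snd[OF chart_at(1)] q chart_at(2) by metis
qed

lemma Metric_space_component: "Metric_space (component b) rdist"
proof
  show "0 \<le> rdist p q" for p q by (rule rdist_nonneg)
  show "rdist p q = rdist q p" for p q
  proof -
    have "joined p q = joined q p" using joined_sym by blast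
    then show ?thesis by (simp add: rdist_def)
  qed
  show "rdist p q = 0 \<longleftrightarrow> p = q" if pq: "p \<in> component b" "q \<in> component b" for p q
  proof
    obtain k where k: "joined p q k" using component_joined[OF pq] by blast
    assume "rdist p q = 0"
    then show "p = q" using rdist_less_iff[OF k] by (intro joined_arbitrarily_short) auto
  next
    assume "p = q"
    then show "rdist p q = 0" using rdist_le[OF joined_refl, of q] rdist_nonneg[of q q] by simp
  qed
  show "rdist p s \<le> rdist p q + rdist q s" if pqs: "p \<in> component b" "q \<in> component b" "s \<in> component b" for p q s
  proof (rule field_le_epsilon)
    fix e :: real assume e: "e > 0"
    obtain i j where ij: "joined p q i" "joined q s j"
      using component_joined[OF pqs(1,2)] component_joined[OF pqs(2,3)] by blast
    obtain k where k: "joined p q k" "k < rdist p q + e/2"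
      using rdist_less_iff[OF ij(1), of "rdist p q + e/2"] e by auto
    obtain k' where k': "joined q s k'" "k' < rdist q s + e/2"
      using rdist_less_iff[OF ij(2), of "rdist q s + e/2"] e by auto
    show "rdist p s \<le> rdist p q + rdist q s + e"
      using rdist_le[OF joined.trans[OF k(1) k'(1)]] k(2) k'(2) by linarith
  qed
qed

text \<open>Compactness is meant in the topology of \<open>rdist\<close>, not in that of the
  manifold. By coordinate segments the inverse chart is Lipschitz into \<open>rdist\<close>, so it
  carries convergent subsequences over.\<close>

lemma compactin_coord_ball_component:
  assumes cb: "coord_ball c y0 r" and b: "cinv c y0 \<in> component b"
  shows "compactin (Metric_space.mtopology (component b) rdist) (cinv c ` cball y0 r)"
proof -
  interpret M: Metric_space "component b" rdist by (rule Metric_space_component)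
  obtain L where L: "L > 0" "\<And>y u. y \<in> cball y0 r \<Longrightarrow> sqrt (g c y u u) \<le> L * norm u"
    using coord_ball_comparison[OF cb] by blast
  have r: "r > 0" using cb by (simp add: coord_ball_def)
  have in_comp: "cinv c y \<in> component b" if "y \<in> cball y0 r" for y
    using joined_segment[OF cb L(2) _ that, of y0] r component_step[OF b] by auto
  have d: "rdist (cinv c y1) (cinv c y2) \<le> L * norm (y2 - y1)" if "y1 \<in> cball y0 r" "y2 \<in> cball y0 r" for y1 y2
    using joined_segment[OF cb L(2) that] rdist_le order_trans by blast
  show ?thesis unfolding M.compactin_sequentially
  proof (intro conjI allI impI)
    show "cinv c ` cball y0 r \<subseteq> component b" using in_comp by auto
    fix \<sigma> :: "nat \<Rightarrow> 'm" assume "range \<sigma> \<subseteq> cinv c ` cball y0 r"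
    then have "\<sigma> n \<in> cinv c ` cball y0 r" for n by blast
    then have "\<forall>n. \<exists>y. y \<in> cball y0 r \<and> \<sigma> n = cinv c y" by blast
    then obtain y where y: "\<And>n. y n \<in> cball y0 r" "\<And>n. \<sigma> n = cinv c (y n)" by metis
    obtain z h where z: "z \<in> cball y0 r" "strict_mono (h::nat\<Rightarrow>nat)" "(y \<circ> h) \<longlonglongrightarrow> z"
      using compact_cball[of y0 r] y(1) unfolding compact_def by metis
    have "limitin M.mtopology (\<sigma> \<circ> h) (cinv c z) sequentially"
      unfolding M.limit_metric_sequentially
    proof (intro conjI allI impI)
      show "cinv c z \<in> component b" using in_comp z by blast
      fix e :: real assume "e > 0"
      then obtain N where N: "\<And>n. n \<ge> N \<Longrightarrow> norm (y (h n) - z) < e / L"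
        using z(3) L(1) unfolding LIMSEQ_iff by (metis comp_apply divide_pos_pos)
      have "rdist ((\<sigma> \<circ> h) n) (cinv c z) < e" if "n \<ge> N" for n
        using d[OF y(1) z(1), of "h n"] N[OF that] L(1) y(2) by (simp add: norm_minus_commute field_simps)
      then show "\<exists>N. \<forall>n\<ge>N. (\<sigma> \<circ> h) n \<in> component b \<and> rdist ((\<sigma> \<circ> h) n) (cinv c z) < e"
        using in_comp y by auto
    qed
    then show "\<exists>l h. l \<in> cinv c ` cball y0 r \<and> strict_mono h \<and> limitin M.mtopology (\<sigma> \<circ> h) l sequentially"
      using z by blast
  qed
qed

text \<open>\<open>riem_complete\<close> provides a limit somewhere in the manifold; being at finite
  distance from the sequence, it lies in the same component.\<close>

lemma mcomplete_component:
  assumes "riem_complete A g"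
  shows "Metric_space.mcomplete (component b) rdist"
proof -
  interpret M: Metric_space "component b" rdist by (rule Metric_space_component)
  show ?thesis unfolding M.mcomplete_def
  proof (intro allI impI)
    fix s assume s: "M.MCauchy s"
    have sb: "s n \<in> component b" for n using s by (auto simp: M.MCauchy_def)
    have "\<exists>N. \<forall>m\<ge>N. \<forall>n\<ge>N. riem_dist A g (s m) (s n) < ereal e" if e: "e > 0" for e
    proof -
      obtain N where N: "\<And>m n. m \<ge> N \<Longrightarrow> n \<ge> N \<Longrightarrow> rdist (s m) (s n) < e"
        using s e unfolding M.MCauchy_def by meson
      have "riem_dist A g (s m) (s n) < ereal e" if "m \<ge> N" "n \<ge> N" for m n
        using rdist_less_iff component_joined[OF sb sb, of m n] N[OF that] unfolding riem_dist_less_iff by blast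
      then show ?thesis by blast
    qed
    then obtain l where l: "(\<lambda>n. riem_dist A g (s n) l) \<longlonglongrightarrow> 0" using assms unfolding riem_complete_def by blast
    have ev: "\<exists>N. \<forall>n\<ge>N. \<exists>k<e. joined (s n) l k" if "e > 0" for e
    proof -
      have "eventually (\<lambda>n. riem_dist A g (s n) l < ereal e) sequentially"
        using l that by (intro order_tendstoD(2)[OF l]) (simp add: zero_ereal_def)
      then show ?thesis unfolding riem_dist_less_iff eventually_sequentially .
    qed
    have "l \<in> component b" using ev[of 1] component_step[OF sb] by force
    moreover have "\<exists>N. \<forall>n\<ge>N. s n \<in> component b \<and> rdist (s n) l < e" if "e > 0" for e
      using ev[OF that] sb rdist_le by (meson order_le_less_trans)
    ultimately show "\<exists>x. limitin M.mtopology s x sequentially" unfolding M.limit_metric_sequentially by blast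
  qed
qed

text \<open>A chain of length below \<open>u + v\<close> is cut at length \<open>u\<close>; if it is
  not longer than that, \<open>q\<close> itself serves as the intermediate point.\<close>

lemma rdist_split:
  assumes "p \<in> component b" "q \<in> component b" "0 < u" "0 < v" "rdist p q < u + v"
  shows "\<exists>m\<in>component b. rdist p m \<le> u \<and> rdist m q \<le> v"
proof -
  obtain k where k: "k < u + v" "joined p q k"
    using component_joined[OF assms(1,2)] rdist_less_iff assms(5) by blast
  show ?thesis
  proof (cases "u < k")
    case True
    obtain m where "joined p m u" "joined m q (k - u)" using joined_split[OF k(2) assms(3) True] by blast
    then show ?thesis using component_step[OF assms(1)] rdist_le[of p m u] rdist_le[of m q "k - u"] k(1) by force
  next
    case False
    then show ?thesis using rdist_le[OF k(2)] rdist_le[OF joined_refl, of q] assms by (intro bexI[of _ q]) auto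
  qed
qed

text \<open>A chain shorter than \<open>l * r\<close> that starts at the centre stays in the
  coordinate ball. In this way closeness in \<open>rdist\<close> yields a common chart.\<close>

lemma rdist_ball_subset_coord_ball:
  assumes cb: "coord_ball c (snd c q) r" and l: "lower_bound c (snd c q) r l"
    and q: "q \<in> fst c" "q \<in> component b" and x: "x \<in> component b" "rdist q x < l * r"
  shows "x \<in> cinv c ` cball (snd c q) r"
proof -
  have c: "c \<in> A" and l0: "l > 0" using l cb by (auto simp: lower_bound_def coord_ball_def)
  obtain k where k: "k < l * r" "joined q x k"
    using component_joined[OF q(2) x(1)] x(2) rdist_less_iff by auto
  have kr: "k / l < r" using k l0 by (simp add: field_simps)
  then have xc: "x \<in> fst c" "l * norm (snd c x - snd c q) \<le> k"
    using short_joined_stays[OF cb l k(2) q(1)] by auto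
  then have "l * norm (snd c x - snd c q) \<le> l * r" using k by simp
  then have "snd c x \<in> cball (snd c q) r" using l0 by (simp add: dist_norm norm_minus_commute)
  then show ?thesis using cinv_snd[OF c xc(1)] by force
qed

theorem compactin_rdist_ball:
  assumes "riem_complete A g" and p: "p \<in> component b"
  shows "compactin (Metric_space.mtopology (component b) rdist) (Metric_space.mcball (component b) rdist p R)"
proof -
  interpret M: Metric_space "component b" rdist by (rule Metric_space_component)
  show ?thesis
  proof (rule M.hopf_rinow_cohn_vossen[OF mcomplete_component[OF assms(1)] _ rdist_split p])
    fix q assume q: "q \<in> component b"
    let ?c = "chart_at A q"
    obtain r where cb: "coord_ball ?c (snd ?c q) r" using coord_ball_exists[OF chart_at] by blast
    obtain l where l: "lower_bound ?c (snd ?c q) r l" using lower_bound_exists[OF cb] by blast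
    have l0: "l > 0" and r: "r > 0" using l cb by (auto simp: lower_bound_def coord_ball_def)
    have "M.mcball q (l * r / 2) \<subseteq> cinv ?c ` cball (snd ?c q) r"
    proof
      fix x assume x: "x \<in> M.mcball q (l * r / 2)"
      moreover have "l * r > 0" using l0 r by simp
      ultimately have "x \<in> component b" "rdist q x < l * r" by auto
      then show "x \<in> cinv ?c ` cball (snd ?c q) r"
        by (rule rdist_ball_subset_coord_ball[OF cb l chart_at(2) q])
    qed
    moreover have "compactin M.mtopology (cinv ?c ` cball (snd ?c q) r)"
      using compactin_coord_ball_component[OF cb] cinv_snd[OF chart_at] q by simp
    ultimately have "compactin M.mtopology (M.mcball q (l * r / 2))"
      using closed_compactin M.closedin_mcball by blast
    then show "\<exists>r>0. compactin M.mtopology (M.mcball q r)" using l0 r by (intro exI[of _ "l * r / 2"]) simp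
  qed
qed

end

section \<open>Curves of bounded energy\<close>

context riemannian
begin

section \<open>Continuity and growth of the Christoffel symbols\<close>

lemma bilinear_dg:
  assumes "c \<in> A" "y \<in> img c"
  shows "bilinear (\<lambda>u v. dg c y u v z)"
  using linear_dg[OF assms] by (auto simp: bilinear_def)

lemma continuous_on_dg:
  assumes c: "c \<in> A" and p: "continuous_on T p" "p ` T \<subseteq> img c"
    and u: "continuous_on T u" and v: "continuous_on T v" and w: "continuous_on T w"
  shows "continuous_on T (\<lambda>s. dg c (p s) (u s) (v s) (w s))"
proof (rule continuous_on_bilinear_family[where L="\<lambda>s u v. dg c (p s) u v (w s)", OF _ _ u v])
  show "bilinear (\<lambda>u v. dg c (p s) u v (w s))" if "s \<in> T" for s
    using p(2) that by (intro bilinear_dg[OF c]) auto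
  show "continuous_on T (\<lambda>s. dg c (p s) u v (w s))" for u v
    by (rule smooth_on_continuous_frechet_derivative[OF smooth_g[OF c] p w])
qed

lemma continuous_on_g:
  assumes c: "c \<in> A" and p: "continuous_on T p" "p ` T \<subseteq> img c"
    and u: "continuous_on T u" and v: "continuous_on T v"
  shows "continuous_on T (\<lambda>s. g c (p s) (u s) (v s))"
proof (rule continuous_on_bilinear_family[where L="\<lambda>s. g c (p s)", OF _ _ u v])
  show "bilinear (g c (p s))" if "s \<in> T" for s using p(2) that by (intro bilinear_g[OF c]) auto
  show "continuous_on T (\<lambda>s. g c (p s) u v)" for u v
    by (rule continuous_on_compose2[OF smooth_on_continuous[OF smooth_g[OF c]] p])
qed

text \<open>The symbols are given implicitly, so continuity is read off from the defining equation:
  the difference of the values at \<open>s\<close> and \<open>t\<close> solves it with a small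
  right-hand side, and the lower bound on the metric makes the solution small.\<close>

lemma continuous_on_christoffel:
  fixes p :: "'c::topological_space \<Rightarrow> 'e"
  assumes cb: "coord_ball c y0 r" and p: "continuous_on T p" "p ` T \<subseteq> cball y0 r" and u: "continuous_on T u"
  shows "continuous_on T (\<lambda>s. christoffel g c (p s) (u s) (u s))"
proof -
  have c: "c \<in> A" and sub: "cball y0 r \<subseteq> img c" using cb by (auto simp: coord_ball_def)
  obtain l where l: "lower_bound c y0 r l" using lower_bound_exists[OF cb] by blast
  have l0: "l > 0" and lb: "\<And>y u. y \<in> cball y0 r \<Longrightarrow> l * norm u \<le> sqrt (g c y u u)"
    using l by (auto simp: lower_bound_def)
  have pi: "p ` T \<subseteq> img c" using p(2) sub by blast
  let ?W = "\<lambda>s. christoffel g c (p s) (u s) (u s)"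
  show ?thesis unfolding continuous_on_def
  proof
    fix t assume t: "t \<in> T"
    \<comment> \<open>The residual of the defining equation at \<open>s\<close> when the solution at
      \<open>t\<close> is inserted; it is continuous and vanishes at \<open>t\<close>.\<close>
    define h where "h b s = first_kind c (p s) (u s) (u s) b - g c (p s) (?W t) b" for b s
    have hc: "continuous_on T (h b)" for b unfolding h_def
      by (intro continuous_intros continuous_on_dg[OF c p(1) pi] continuous_on_g[OF c p(1) pi] u) simp
    have ht: "h b t = 0" for b using christoffel[OF c, of "p t" "u t" "u t" b] pi t by (auto simp: h_def)
    have bound: "norm (?W s - ?W t) \<le> (\<Sum>b\<in>onb. \<bar>h b s\<bar>) / l\<^sup>2" if s: "s \<in> T" for s
    proof -
      let ?z = "?W s - ?W t"
      have ps: "p s \<in> cball y0 r" "p s \<in> img c" using p(2) pi s by auto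
      note bil = bilinear_g[OF c ps(2)]
      have gz: "g c (p s) ?z w = first_kind c (p s) (u s) (u s) w - g c (p s) (?W t) w" for w
        using christoffel[OF c ps(2)] bilinear_lsub[OF bil] by simp
      have lin: "linear (g c (p s) ?z)" using bil by (simp add: bilinear_def)
      have "(l * norm ?z)\<^sup>2 \<le> g c (p s) ?z ?z"
        using power_mono[OF lb[OF ps(1), of ?z], of 2] l0 g_nonneg[OF c ps(2)] by simp
      also have "\<dots> = (\<Sum>b\<in>onb. (?z \<bullet> b) * h b s)"
        using linear_onb_expand[OF lin, of ?z] by (simp add: gz h_def)
      also have "\<dots> \<le> (\<Sum>b\<in>onb. norm ?z * \<bar>h b s\<bar>)"
      proof (rule sum_mono)
        fix b :: 'e assume b: "b \<in> onb"
        have "(?z \<bullet> b) * h b s \<le> \<bar>?z \<bullet> b\<bar> * \<bar>h b s\<bar>"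
          using abs_ge_self[of "(?z \<bullet> b) * h b s"] by (simp only: abs_mult)
        also have "\<dots> \<le> norm ?z * \<bar>h b s\<bar>"
          using Cauchy_Schwarz_ineq2[of ?z b] norm_onb[OF b] by (intro mult_right_mono) auto
        finally show "(?z \<bullet> b) * h b s \<le> norm ?z * \<bar>h b s\<bar>" .
      qed
      also have "\<dots> = norm ?z * (\<Sum>b\<in>onb. \<bar>h b s\<bar>)" by (simp only: sum_distrib_left)
      finally have *: "norm ?z * (l\<^sup>2 * norm ?z) \<le> norm ?z * (\<Sum>b\<in>onb. \<bar>h b s\<bar>)"
        by (simp only: power2_eq_square ac_simps)
      show ?thesis
      proof (cases "norm ?z = 0")
        case True
        then show ?thesis by (simp add: sum_nonneg)
      next
        case False
        then have "l\<^sup>2 * norm ?z \<le> (\<Sum>b\<in>onb. \<bar>h b s\<bar>)" using * mult_le_cancel_left_pos by simp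
        then show ?thesis using l0 by (simp add: field_simps)
      qed
    qed
    have "((\<lambda>s. (\<Sum>b\<in>onb. \<bar>h b s\<bar>) / l\<^sup>2) \<longlongrightarrow> (\<Sum>b\<in>onb. \<bar>h b t\<bar>) / l\<^sup>2) (at t within T)"
      using hc t l0 by (intro tendsto_intros) (auto simp: continuous_on_def)
    then have "((\<lambda>s. (\<Sum>b\<in>onb. \<bar>h b s\<bar>) / l\<^sup>2) \<longlongrightarrow> 0) (at t within T)" by (simp add: ht)
    moreover have "eventually (\<lambda>s. norm (?W s - ?W t) \<le> (\<Sum>b\<in>onb. \<bar>h b s\<bar>) / l\<^sup>2) (at t within T)"
      using bound by (simp add: eventually_at_filter)
    ultimately have "((\<lambda>s. ?W s - ?W t) \<longlongrightarrow> 0) (at t within T)" by (rule Lim_null_comparison[rotated])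
    then show "(?W \<longlongrightarrow> ?W t) (at t within T)" by (simp add: LIM_zero_iff)
  qed
qed

lemma christoffel_scale:
  assumes c: "c \<in> A" "y \<in> img c"
  shows "christoffel g c y (k *\<^sub>R u) (k *\<^sub>R u) = k\<^sup>2 *\<^sub>R christoffel g c y u u"
proof (rule g_eqI[OF c])
  fix z
  have "first_kind c y (k *\<^sub>R u) (k *\<^sub>R u) z = k\<^sup>2 * first_kind c y u u z"
    using linear_cmul[OF linear_dg(1)[OF c]] linear_cmul[OF linear_dg(2)[OF c]] linear_cmul[OF linear_dg(3)[OF c]]
    by (simp add: power2_eq_square algebra_simps)
  then show "g c y (christoffel g c y (k *\<^sub>R u) (k *\<^sub>R u)) z = g c y (k\<^sup>2 *\<^sub>R christoffel g c y u u) z"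
    by (simp only: christoffel[OF c] bilinear_lmul[OF bilinear_g[OF c]] real_scaleR_def)
qed

text \<open>Compactness of the product with the unit ball, then quadratic homogeneity. The ball
  instead of the sphere lets \<open>sgn u\<close> cover the case \<open>u = 0\<close>.\<close>

lemma christoffel_bound:
  assumes cb: "coord_ball c y0 r"
  shows "\<exists>G\<ge>0. \<forall>y\<in>cball y0 r. \<forall>u. norm (christoffel g c y u u) \<le> G * (norm u)\<^sup>2"
proof -
  have c: "c \<in> A" and sub: "cball y0 r \<subseteq> img c" using cb by (auto simp: coord_ball_def)
  let ?K = "cball y0 r \<times> cball (0::'e) 1"
  have "compact ?K" by (intro compact_Times compact_cball)
  moreover have "continuous_on ?K (\<lambda>p. christoffel g c (fst p) (snd p) (snd p))"
    by (rule continuous_on_christoffel[OF cb]) (auto intro: continuous_intros)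
  ultimately have "bounded ((\<lambda>p. christoffel g c (fst p) (snd p) (snd p)) ` ?K)"
    using compact_continuous_image compact_imp_bounded by blast
  then obtain G where G: "G > 0" "\<And>p. p \<in> ?K \<Longrightarrow> norm (christoffel g c (fst p) (snd p) (snd p)) \<le> G"
    unfolding bounded_pos by blast
  have "norm (christoffel g c y u u) \<le> G * (norm u)\<^sup>2" if y: "y \<in> cball y0 r" for y u
  proof -
    have yi: "y \<in> img c" using y sub by blast
    let ?e = "sgn u"
    have "u = norm u *\<^sub>R ?e" by (cases "u = 0") (simp_all add: sgn_div_norm)
    then have "christoffel g c y u u = (norm u)\<^sup>2 *\<^sub>R christoffel g c y ?e ?e"
      using christoffel_scale[OF c yi] by metis
    moreover have "norm (christoffel g c y ?e ?e) \<le> G"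
      using G(2)[of "(y, ?e)"] y by (simp add: norm_sgn)
    ultimately show ?thesis
      using mult_left_mono[of "norm (christoffel g c y ?e ?e)" G "(norm u)\<^sup>2"] by (simp add: mult.commute)
  qed
  then show ?thesis using G(1) by (intro exI[of _ G]) auto
qed

section \<open>Energy densities of H^2 curves\<close>

abbreviation energy1 :: "(real \<Rightarrow> 'm) \<Rightarrow> real \<Rightarrow> real" where
  "energy1 x t \<equiv> sq_norm A g (x t) (velocity {0..1} x t)"

abbreviation energy2 :: "(real \<Rightarrow> 'm) \<Rightarrow> real \<Rightarrow> real" where
  "energy2 x t \<equiv> sq_norm A g (x t) (cov_deriv g {0..1} x (velocity {0..1} x) t)"

lemma H2_C1: "x \<in> H2_curves A \<Longrightarrow> C1_curve_on A {0..1} x"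
  by (simp add: H2_curves_def C1_curves_def)

text \<open>The functional sees the pointwise derivative of the velocity, while the class
  \<open>H2\<close> supplies a weak one. They agree almost everywhere because the velocity is an
  indefinite integral of \<open>w\<close>; the end points join the exceptional set, as
  differentiability is obtained in the open interval.\<close>

lemma H2_weak_derivative:
  assumes x: "x \<in> H2_curves A" and c: "c \<in> A" and ab: "0 \<le> a" "a < b" "b \<le> 1" and xc: "x ` {a..b} \<subseteq> fst c"
  shows "\<exists>w N. w \<in> borel_measurable (lebesgue_on {a..b}) \<and> integrable (lebesgue_on {a..b}) (\<lambda>s. (norm (w s))\<^sup>2) \<and>
     (\<forall>s t. a \<le> s \<and> s \<le> t \<and> t \<le> b \<longrightarrow> (w has_integral (velocity {0..1} x t c - velocity {0..1} x s c)) {s..t}) \<and>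
     negligible N \<and>
     (\<forall>t\<in>{a..b}-N. energy2 x t = g c (snd c (x t))
        (w t + christoffel g c (snd c (x t)) (velocity {0..1} x t c) (velocity {0..1} x t c))
        (w t + christoffel g c (snd c (x t)) (velocity {0..1} x t c) (velocity {0..1} x t c)))"
proof -
  let ?v = "\<lambda>t. velocity {0..1} x t c"
  have "H1_on a b ?v" using x c ab xc by (auto simp: H2_curves_def)
  then obtain w where w: "w \<in> borel_measurable (lebesgue_on {a..b})"
    "integrable (lebesgue_on {a..b}) (\<lambda>s. (norm (w s))\<^sup>2)"
    "\<And>t. t \<in> {a..b} \<Longrightarrow> (w has_integral (?v t - ?v a)) {a..t}" unfolding H1_on_def by blast
  have wst: "(w has_integral (?v t - ?v s)) {s..t}" if st: "a \<le> s" "s \<le> t" "t \<le> b" for s t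
  proof -
    have i: "w integrable_on {a..t}" using w(3)[of t] st by auto
    have "integral {a..s} w + integral {s..t} w = integral {a..t} w"
      by (rule Henstock_Kurzweil_Integration.integral_combine[OF st(1,2) i])
    then have "integral {s..t} w = ?v t - ?v s"
      using integral_unique[OF w(3)[of s]] integral_unique[OF w(3)[of t]] st by (simp add: algebra_simps)
    moreover have "w integrable_on {s..t}" using integrable_on_subinterval[OF i] st by auto
    ultimately show ?thesis by (metis integrable_integral)
  qed
  have "\<exists>N. negligible N \<and> (\<forall>t\<in>{a<..<b}-N. (?v has_vector_derivative w t) (at t))"
    by (rule indefinite_integral_has_vector_derivative_ae[OF w(3)])
  then obtain N where N: "negligible N" "\<And>t. t \<in> {a<..<b} - N \<Longrightarrow> (?v has_vector_derivative w t) (at t)"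
    by blast
  have "energy2 x t = g c (snd c (x t)) (w t + christoffel g c (snd c (x t)) (?v t) (?v t))
      (w t + christoffel g c (snd c (x t)) (?v t) (?v t))" if t: "t \<in> {a..b} - (N \<union> {a, b})" for t
  proof (rule sq_norm_cov_deriv[OF H2_C1[OF x] _ _ c])
    show "t \<in> {0..1}" "x t \<in> fst c" using t ab xc by auto
    show "(?v has_vector_derivative w t) (at t within {0..1})"
    proof (rule has_vector_derivative_at_within)
      have "t \<in> {a<..<b} - N" using t by auto
      then show "(?v has_vector_derivative w t) (at t)" by (rule N(2))
    qed
  qed simp
  moreover have "negligible (N \<union> {a, b})" by (rule negligible_Un[OF N(1) negligible_finite]) simp
  ultimately show ?thesis using w(1,2) wst by blast
qed

lemma continuous_on_coords:
  assumes x: "C1_curve_on A T x" and c: "c \<in> A" and S: "S \<subseteq> T" "x ` S \<subseteq> fst c"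
  shows "continuous_on S (\<lambda>t. snd c (x t))" "continuous_on S (\<lambda>t. velocity T x t c)"
proof -
  have N: "S \<subseteq> {t \<in> T. x t \<in> fst c}" using S by auto
  show "continuous_on S (\<lambda>t. velocity T x t c)"
    by (rule continuous_on_subset[OF _ N]) (use x c in \<open>simp add: C1_curve_on_def\<close>)
  show "continuous_on S (\<lambda>t. snd c (x t))"
    by (rule continuous_on_compose2[OF continuous_on_chart[OF c] continuous_on_subset[OF C1_curve_on_continuous_on[OF x] S(1)] S(2)])
qed

lemma coord_ball_image:
  assumes cb: "coord_ball c y0 r" and xc: "x ` S \<subseteq> cinv c ` cball y0 r"
  shows "x ` S \<subseteq> fst c" "\<And>t. t \<in> S \<Longrightarrow> snd c (x t) \<in> cball y0 r"
proof -
  have *: "x t \<in> fst c \<and> snd c (x t) \<in> cball y0 r" if "t \<in> S" for t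
  proof -
    have "x t \<in> cinv c ` cball y0 r" using xc that by blast
    then obtain y where y: "x t = cinv c y" "y \<in> cball y0 r" by (rule imageE)
    then have "y \<in> img c" using cb by (auto simp: coord_ball_def)
    then show ?thesis using y snd_cinv cinv_in by simp
  qed
  then show "x ` S \<subseteq> fst c" "\<And>t. t \<in> S \<Longrightarrow> snd c (x t) \<in> cball y0 r" by blast+
qed

text \<open>Without integrability the Lebesgue integral in the functional would be 0 by convention.
  The density is quadratic in the sum of \<open>w\<close> and a bounded term, with bounded
  coefficients, and \<open>w\<close> is square integrable.\<close>

lemma energy2_integrable_chart:
  assumes x: "x \<in> H2_curves A" and cb: "coord_ball c y0 r" and ab: "0 \<le> a" "a < b" "b \<le> 1"
    and xc: "x ` {a..b} \<subseteq> cinv c ` cball y0 r"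
  shows "energy2 x integrable_on {a..b}"
proof -
  have c: "c \<in> A" and sub: "cball y0 r \<subseteq> img c" using cb by (auto simp: coord_ball_def)
  have xin: "x ` {a..b} \<subseteq> fst c" and yin: "\<And>t. t \<in> {a..b} \<Longrightarrow> snd c (x t) \<in> cball y0 r"
    by (rule coord_ball_image[OF cb xc])+
  let ?T = "{a..b}" and ?y = "\<lambda>t. snd c (x t)" and ?v = "\<lambda>t. velocity {0..1} x t c"
  let ?G = "\<lambda>t. christoffel g c (?y t) (?v t) (?v t)"
  obtain w N where w: "w \<in> borel_measurable (lebesgue_on ?T)" "integrable (lebesgue_on ?T) (\<lambda>s. (norm (w s))\<^sup>2)"
     and N: "negligible N" "\<And>t. t \<in> ?T - N \<Longrightarrow> energy2 x t = g c (?y t) (w t + ?G t) (w t + ?G t)"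
    using H2_weak_derivative[OF x c ab xin] by blast
  have T01: "?T \<subseteq> {0..1}" using ab by auto
  note co = continuous_on_coords[OF H2_C1[OF x] c T01 xin]
  have yi: "?y ` ?T \<subseteq> cball y0 r" using yin by auto
  have yimg: "?y ` ?T \<subseteq> img c" using yi sub by blast
  have Gc: "continuous_on ?T ?G" by (rule continuous_on_christoffel[OF cb co(1) yi co(2)])
  then have "bounded (?G ` ?T)" by (intro compact_imp_bounded compact_continuous_image) auto
  then obtain B where B: "\<And>t. t \<in> ?T \<Longrightarrow> norm (?G t) \<le> B" unfolding bounded_iff by blast
  obtain L where L: "L > 0" "\<And>y u. y \<in> cball y0 r \<Longrightarrow> sqrt (g c y u u) \<le> L * norm u"
    using coord_ball_comparison[OF cb] by blast
  define z where "z t = w t + ?G t" for t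
  have zm: "z \<in> borel_measurable (lebesgue_on ?T)" unfolding z_def
    by (intro borel_measurable_add w(1) continuous_imp_measurable_on_sets_lebesgue Gc) auto
  have gm: "(\<lambda>t. g c (?y t) u v) \<in> borel_measurable (lebesgue_on ?T)" for u v
    by (intro continuous_imp_measurable_on_sets_lebesgue continuous_on_g[OF c co(1) yimg] continuous_intros) auto
  \<comment> \<open>The expansion in \<open>onb\<close> turns a bilinear form evaluated at a
    measurable vector into sums of products of measurable functions.\<close>
  let ?\<phi> = "\<lambda>t. \<Sum>b\<in>onb. \<Sum>b'\<in>onb. (z t \<bullet> b) * (z t \<bullet> b') * g c (?y t) b b'"
  have \<phi>: "g c (?y t) (z t) (z t) = ?\<phi> t" if "t \<in> ?T" for t
    using bilinear_onb_expand[OF bilinear_g[OF c]] yimg that by blast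
  have "integrable (lebesgue_on ?T) ?\<phi>"
  proof (rule Bochner_Integration.integrable_bound)
    show "integrable (lebesgue_on ?T) (\<lambda>t. L\<^sup>2 * (2 * (norm (w t))\<^sup>2 + 2 * B\<^sup>2))"
      using w(2) by (intro integrable_mult_right Bochner_Integration.integrable_add) auto
    show "?\<phi> \<in> borel_measurable (lebesgue_on ?T)"
      by (intro borel_measurable_sum borel_measurable_times borel_measurable_inner zm gm) auto
    show "AE t in lebesgue_on ?T. norm (?\<phi> t) \<le> norm (L\<^sup>2 * (2 * (norm (w t))\<^sup>2 + 2 * B\<^sup>2))"
    proof (rule AE_I2)
      fix t assume "t \<in> space (lebesgue_on ?T)"
      then have t: "t \<in> ?T" by simp
      have nn: "g c (?y t) (z t) (z t) \<ge> 0" using g_nonneg[OF c] yimg t by blast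
      have "norm (z t) \<le> norm (w t) + B" unfolding z_def
        using norm_triangle_ineq[of "w t" "?G t"] B[OF t] by linarith
      then have "(norm (z t))\<^sup>2 \<le> (norm (w t) + B)\<^sup>2" by (intro power_mono) auto
      also have "\<dots> \<le> 2 * (norm (w t))\<^sup>2 + 2 * B\<^sup>2"
        using zero_le_power2[of "norm (w t) - B"] by (simp add: power2_eq_square algebra_simps)
      finally have 1: "(norm (z t))\<^sup>2 \<le> 2 * (norm (w t))\<^sup>2 + 2 * B\<^sup>2" .
      have "g c (?y t) (z t) (z t) \<le> (L * norm (z t))\<^sup>2"
        using power_mono[OF L(2)[OF yin[OF t], of "z t"], of 2] nn by simp
      also have "\<dots> \<le> L\<^sup>2 * (2 * (norm (w t))\<^sup>2 + 2 * B\<^sup>2)"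
        using 1 by (simp add: power_mult_distrib mult_left_mono)
      finally show "norm (?\<phi> t) \<le> norm (L\<^sup>2 * (2 * (norm (w t))\<^sup>2 + 2 * B\<^sup>2))"
        using nn by (simp add: \<phi>[OF t, symmetric])
    qed
  qed
  then have "?\<phi> integrable_on ?T" by (rule integrable_on_lebesgue_on) auto
  then show ?thesis
    by (rule integrable_spike[OF _ N(1)]) (use N(2) \<phi> in \<open>simp add: z_def\<close>)
qed

lemma energy1_continuous: "x \<in> H2_curves A \<Longrightarrow> continuous_on {0..1} (energy1 x)"
  using continuous_on_sq_norm_velocity[OF H2_C1] by simp

text \<open>Every time has a neighbourhood on which the curve stays in one coordinate ball, and
  integrability over a compact interval is a local property.\<close>

lemma energy2_integrable:
  assumes x: "x \<in> H2_curves A"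
  shows "energy2 x integrable_on {0..1}"
proof -
  have "energy2 x integrable_on cbox 0 1"
  proof (rule integrable_on_little_subintervals, intro ballI)
    fix t :: real assume t: "t \<in> cbox 0 1"
    let ?c = "chart_at A (x t)"
    obtain r where cb: "coord_ball ?c (snd ?c (x t)) r" using coord_ball_exists[OF chart_at] by blast
    have c: "?c \<in> A" and r: "r > 0" using cb by (auto simp: coord_ball_def)
    define W where "W = {q \<in> fst ?c. snd ?c q \<in> ball (snd ?c (x t)) r}"
    have "open W" unfolding W_def by (rule open_coord_preimage[OF c open_ball])
    moreover have "x t \<in> W" using chart_at r by (simp add: W_def)
    moreover have "continuous (at t within {0..1}) x" using C1_curve_on_continuous[OF H2_C1[OF x]] t by simp
    ultimately obtain d where d: "d > 0" "\<And>s. s \<in> {0..1} \<Longrightarrow> dist s t < d \<Longrightarrow> x s \<in> W"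
      unfolding continuous_within_topological open_dist by (metis open_ball centre_in_ball mem_ball openE subset_eq dist_commute open_dist)
    have "energy2 x integrable_on cbox u v" if uv: "t \<in> cbox u v \<and> cbox u v \<subseteq> ball t d \<and> cbox u v \<subseteq> cbox 0 1" for u v
    proof (cases "u < v")
      case True
      have "x ` {u..v} \<subseteq> cinv ?c ` cball (snd ?c (x t)) r"
      proof
        fix q assume "q \<in> x ` {u..v}"
        then obtain s where s: "s \<in> {u..v}" "q = x s" by blast
        have "s \<in> ball t d" "s \<in> {0..1}" using uv s(1) unfolding interval_cbox by blast+
        then have "q \<in> W" using d(2) s(2) by (simp add: dist_commute)
        then show "q \<in> cinv ?c ` cball (snd ?c (x t)) r"
          using cinv_snd[OF c, of q] by (force simp: W_def intro!: image_eqI[of _ _ "snd ?c q"])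
      qed
      moreover have "0 \<le> u" "v \<le> 1" using uv True by auto
      ultimately show ?thesis using energy2_integrable_chart[OF x cb _ True] by simp
    next
      case False
      then have "u = v" using uv by auto
      then show ?thesis using integrable_on_refl by blast
    qed
    then show "\<exists>d>0. \<forall>u v. t \<in> cbox u v \<and> cbox u v \<subseteq> ball t d \<and> cbox u v \<subseteq> cbox 0 1 \<longrightarrow> energy2 x integrable_on cbox u v"
      using d(1) by blast
  qed
  then show ?thesis by simp
qed

lemma energy1_integrable: "x \<in> H2_curves A \<Longrightarrow> energy1 x integrable_on {0..1}"
  by (rule integrable_continuous_real[OF energy1_continuous])

lemma tension_energy_eq:
  assumes x: "x \<in> H2_curves A"
  shows "tension_energy A g \<tau> x = (integral {0..1} (energy2 x) + \<tau>\<^sup>2 * integral {0..1} (energy1 x)) / 2"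
proof -
  let ?f = "\<lambda>t. energy2 x t + \<tau>\<^sup>2 * energy1 x t"
  have i: "?f integrable_on {0..1}"
    by (intro integrable_add energy2_integrable[OF x] integrable_on_mult_right energy1_integrable[OF x])
  then have "?f absolutely_integrable_on {0..1}"
    by (intro nonnegative_absolutely_integrable_1) (simp_all add: sq_norm_nonneg)
  then have "(LINT t:{0..1}|lebesgue. ?f t) = integral {0..1} ?f" by (rule set_lebesgue_integral_eq_integral(2))
  also have "\<dots> = integral {0..1} (energy2 x) + \<tau>\<^sup>2 * integral {0..1} (energy1 x)"
    using energy2_integrable[OF x] energy1_integrable[OF x] integrable_on_mult_right[OF energy1_integrable[OF x], of "\<tau>\<^sup>2"]
    by (simp add: Henstock_Kurzweil_Integration.integral_add)
  finally show ?thesis by (simp add: tension_energy_def)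
qed

lemma energy_bounds:
  assumes x: "x \<in> H2_curves A" and J: "tension_energy A g \<tau> x \<le> C" and \<tau>: "\<tau> \<noteq> 0"
  shows "integral {0..1} (energy1 x) \<le> 2 * C / \<tau>\<^sup>2" "integral {0..1} (energy2 x) \<le> 2 * C"
proof -
  have 1: "integral {0..1} (energy1 x) \<ge> 0" and 2: "integral {0..1} (energy2 x) \<ge> 0"
    using energy1_integrable[OF x] energy2_integrable[OF x]
    by (auto intro!: Henstock_Kurzweil_Integration.integral_nonneg simp: sq_norm_nonneg)
  have t: "\<tau>\<^sup>2 > 0" using \<tau> by simp
  have s: "integral {0..1} (energy2 x) + \<tau>\<^sup>2 * integral {0..1} (energy1 x) \<le> 2 * C"
    using J by (simp add: tension_energy_eq[OF x])
  have "\<tau>\<^sup>2 * integral {0..1} (energy1 x) \<ge> 0" using 1 t by simp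
  then show "integral {0..1} (energy2 x) \<le> 2 * C" using s by linarith
  show "integral {0..1} (energy1 x) \<le> 2 * C / \<tau>\<^sup>2" using s 2 t by (simp add: field_simps)
qed

section \<open>Velocity estimates in coordinates\<close>

lemma integral_subinterval_le:
  assumes f: "f integrable_on {0..1::real}" "\<And>t. f t \<ge> (0::real)" and st: "0 \<le> s" "s \<le> t" "t \<le> 1"
  shows "integral {s..t} f \<le> integral {0..1} f"
  using st f(2) by (intro integral_subset_le integrable_on_subinterval[OF f(1)] f(1)) auto

text \<open>Young's inequality \<open>\<parallel>z\<parallel> \<le> \<eta>\<parallel>z\<parallel>\<^sup>2 + 1/(4\<eta>)\<close> replaces the Cauchy-Schwarz inequality.\<close>

lemma H2_velocity_increment:
  assumes x: "x \<in> H2_curves A" and cb: "coord_ball c y0 r" and ab: "0 \<le> a" "a < b" "b \<le> 1"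
    and xc: "x ` {a..b} \<subseteq> cinv c ` cball y0 r"
    and l: "lower_bound c y0 r l"
    and G: "G \<ge> 0" "\<And>y u. y \<in> cball y0 r \<Longrightarrow> norm (christoffel g c y u u) \<le> G * (norm u)\<^sup>2"
    and E: "integral {0..1} (energy2 x) \<le> E" and \<eta>: "\<eta> > 0"
    and K: "\<And>s t. a \<le> s \<Longrightarrow> s \<le> t \<Longrightarrow> t \<le> b \<Longrightarrow> integral {s..t} (\<lambda>t. (norm (velocity {0..1} x t c))\<^sup>2) \<le> k s t"
    and st: "a \<le> s" "s \<le> t" "t \<le> b"
  shows "norm (velocity {0..1} x t c - velocity {0..1} x s c) \<le> \<eta> * E / l\<^sup>2 + (t - s) / (4 * \<eta>) + G * k s t"
proof -
  have c: "c \<in> A" and sub: "cball y0 r \<subseteq> img c" using cb by (auto simp: coord_ball_def)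
  have l0: "l > 0" and lb: "\<And>y u. y \<in> cball y0 r \<Longrightarrow> l * norm u \<le> sqrt (g c y u u)"
    using l by (auto simp: lower_bound_def)
  have xin: "x ` {a..b} \<subseteq> fst c" and yin: "\<And>t. t \<in> {a..b} \<Longrightarrow> snd c (x t) \<in> cball y0 r"
    by (rule coord_ball_image[OF cb xc])+
  let ?y = "\<lambda>t. snd c (x t)" and ?v = "\<lambda>t. velocity {0..1} x t c"
  let ?G = "\<lambda>t. christoffel g c (?y t) (?v t) (?v t)"
  obtain w N where w: "\<And>s t. a \<le> s \<Longrightarrow> s \<le> t \<Longrightarrow> t \<le> b \<Longrightarrow> (w has_integral (?v t - ?v s)) {s..t}"
     and N: "negligible N" "\<And>t. t \<in> {a..b} - N \<Longrightarrow> energy2 x t = g c (?y t) (w t + ?G t) (w t + ?G t)"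
    using H2_weak_derivative[OF x c ab xin] by blast
  \<comment> \<open>The bound on the integral wants a bound on the integrand at every time, so the
    weak derivative is set to 0 on the null set where its relation to \<open>energy2\<close> is
    unknown.\<close>
  define w' where "w' t = (if t \<in> N then 0 else w t)" for t
  define \<phi> where "\<phi> t = \<eta> / l\<^sup>2 * energy2 x t + 1 / (4 * \<eta>) + G * (norm (?v t))\<^sup>2" for t
  have w': "(w' has_integral (?v t - ?v s)) {s..t}"
    by (rule has_integral_spike[OF N(1) _ w[OF st]]) (simp add: w'_def)
  have st01: "0 \<le> s" "t \<le> 1" using st ab by auto
  have e2: "energy2 x integrable_on {s..t}"
    using integrable_on_subinterval[OF energy2_integrable[OF x]] st01 by auto
  have vc: "continuous_on {a..b} ?v"
    using continuous_on_coords(2)[OF H2_C1[OF x] c _ xin] ab by auto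
  have v2: "(\<lambda>t. (norm (?v t))\<^sup>2) integrable_on {s..t}"
    by (intro integrable_continuous_real continuous_intros continuous_on_subset[OF vc]) (use st in auto)
  have \<phi>i: "(\<phi> has_integral (\<eta> / l\<^sup>2 * integral {s..t} (energy2 x) + (t - s) * (1 / (4 * \<eta>)) + G * integral {s..t} (\<lambda>t. (norm (?v t))\<^sup>2))) {s..t}"
    unfolding \<phi>_def
    using has_integral_const_real[of "1 / (4 * \<eta>)" s t] st(2)
    by (intro has_integral_add has_integral_mult_right integrable_integral e2 v2) simp
  have "norm (w' u) \<le> \<phi> u" if u: "u \<in> {s..t}" for u
  proof (cases "u \<in> N")
    case True
    then show ?thesis using \<eta> G(1) l0 sq_norm_nonneg by (simp add: w'_def \<phi>_def)
  next
    case False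
    have uab: "u \<in> {a..b}" using u st by auto
    let ?z = "w u + ?G u"
    have "(l * norm ?z)\<^sup>2 \<le> (sqrt (energy2 x u))\<^sup>2"
      using lb[OF yin[OF uab], of ?z] N(2)[of u] uab False l0 by (intro power_mono) auto
    then have "l\<^sup>2 * (norm ?z)\<^sup>2 \<le> energy2 x u" by (simp add: power_mult_distrib sq_norm_nonneg)
    then have 1: "\<eta> * (norm ?z)\<^sup>2 \<le> \<eta> / l\<^sup>2 * energy2 x u" using l0 \<eta> by (simp add: field_simps)
    have "(2 * \<eta> * norm ?z - 1)\<^sup>2 / (4 * \<eta>) \<ge> 0" using \<eta> by simp
    also have "(2 * \<eta> * norm ?z - 1)\<^sup>2 / (4 * \<eta>) = \<eta> * (norm ?z)\<^sup>2 + 1 / (4 * \<eta>) - norm ?z"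
      using \<eta> by (simp add: power2_eq_square field_simps)
    finally have 2: "norm ?z \<le> \<eta> * (norm ?z)\<^sup>2 + 1 / (4 * \<eta>)" by simp
    have "norm (w u) \<le> norm ?z + norm (?G u)" using norm_triangle_ineq4[of ?z "?G u"] by simp
    also have "norm (?G u) \<le> G * (norm (?v u))\<^sup>2" using G(2)[OF yin[OF uab]] .
    finally show ?thesis using 1 2 False by (simp add: w'_def \<phi>_def)
  qed
  then have "norm (integral {s..t} w') \<le> integral {s..t} \<phi>"
    using w' \<phi>i by (intro integral_norm_bound_integral) (auto simp: integrable_on_def)
  then have "norm (?v t - ?v s) \<le> \<eta> / l\<^sup>2 * integral {s..t} (energy2 x) + (t - s) * (1 / (4 * \<eta>)) + G * integral {s..t} (\<lambda>t. (norm (?v t))\<^sup>2)"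
    by (simp only: integral_unique[OF w'] integral_unique[OF \<phi>i])
  also have "\<eta> / l\<^sup>2 * integral {s..t} (energy2 x) \<le> \<eta> / l\<^sup>2 * E"
    using integral_subinterval_le[OF energy2_integrable[OF x] sq_norm_nonneg st01(1) st(2) st01(2)] E \<eta> l0
    by (intro mult_left_mono) auto
  also have "G * integral {s..t} (\<lambda>t. (norm (?v t))\<^sup>2) \<le> G * k s t" using K[OF st] G(1) by (rule mult_left_mono)
  finally show ?thesis by simp
qed

text \<open>Two passes through \<open>H2_velocity_increment\<close>. The first, with
  \<open>\<eta> = 1\<close>, bounds the oscillation of the velocity and hence its size, since its
  mean square is bounded; the second uses this size to bound its square integral over
  \<open>[s,t]\<close> by a multiple of \<open>t - s\<close>. The order of quantifiers matters:
  \<open>V\<close> serves all \<open>\<eta>\<close>, and \<open>M\<close> depends neither on the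
  curve nor on the position of the interval.\<close>

lemma H2_velocity_estimate:
  assumes cb: "coord_ball c y0 r" and \<delta>: "\<delta> > 0"
  shows "\<exists>V. \<forall>\<eta>>0. \<exists>M\<ge>0. \<forall>x a b. x \<in> H2_curves A \<and> integral {0..1} (energy1 x) \<le> E \<and> integral {0..1} (energy2 x) \<le> E \<and>
     0 \<le> a \<and> b \<le> 1 \<and> b - a = \<delta> \<and> x ` {a..b} \<subseteq> cinv c ` cball y0 r \<longrightarrow>
     (\<forall>t\<in>{a..b}. norm (velocity {0..1} x t c) \<le> V) \<and>
     (\<forall>s\<in>{a..b}. \<forall>t\<in>{a..b}. norm (velocity {0..1} x t c - velocity {0..1} x s c) \<le> \<eta> + M * \<bar>t - s\<bar>)"
proof -
  have c: "c \<in> A" and sub: "cball y0 r \<subseteq> img c" using cb by (auto simp: coord_ball_def)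
  obtain l where l: "lower_bound c y0 r l" using lower_bound_exists[OF cb] by blast
  have l0: "l > 0" and lb: "\<And>y u. y \<in> cball y0 r \<Longrightarrow> l * norm u \<le> sqrt (g c y u u)"
    using l by (auto simp: lower_bound_def)
  obtain G where G: "G \<ge> 0" "\<And>y u. y \<in> cball y0 r \<Longrightarrow> norm (christoffel g c y u u) \<le> G * (norm u)\<^sup>2"
    using christoffel_bound[OF cb] by blast
  \<comment> \<open>The increment bound for \<open>\<eta> = 1\<close>, when the interval has length
    \<open>\<delta>\<close> and the square integral of the velocity is at most
    \<open>E / l\<^sup>2\<close>.\<close>
  define K where "K = 1 * E / l\<^sup>2 + \<delta> / (4 * 1) + G * (E / l\<^sup>2)"
  \<comment> \<open>At some time the squared velocity is at most
    \<open>E / (l\<^sup>2 * \<delta>)\<close>, a bound for its mean, and from there the velocity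
    changes by at most \<open>K\<close>.\<close>
  define V where "V = sqrt (E / (l\<^sup>2 * \<delta>)) + K"
  have main: "\<exists>M\<ge>0. \<forall>x a b. x \<in> H2_curves A \<and> integral {0..1} (energy1 x) \<le> E \<and> integral {0..1} (energy2 x) \<le> E \<and>
     0 \<le> a \<and> b \<le> 1 \<and> b - a = \<delta> \<and> x ` {a..b} \<subseteq> cinv c ` cball y0 r \<longrightarrow>
     (\<forall>t\<in>{a..b}. norm (velocity {0..1} x t c) \<le> V) \<and>
     (\<forall>s\<in>{a..b}. \<forall>t\<in>{a..b}. norm (velocity {0..1} x t c - velocity {0..1} x s c) \<le> \<eta> + M * \<bar>t - s\<bar>)"
    if \<eta>: "\<eta> > 0" for \<eta>
  proof -
    \<comment> \<open>Scaled so that the energy term \<open>\<eta>' * E / l\<^sup>2\<close> is at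
      most \<open>\<eta>\<close>; the absolute value and the summand 1 cover every value of
      \<open>E\<close>.\<close>
    define \<eta>' where "\<eta>' = \<eta> * l\<^sup>2 / (\<bar>E\<bar> + 1)"
    have \<eta>': "\<eta>' > 0" using \<eta> l0 by (simp add: \<eta>'_def)
    have \<eta>'E: "\<eta>' * E / l\<^sup>2 \<le> \<eta>"
    proof -
      have "\<eta>' * E / l\<^sup>2 = \<eta> * (E / (\<bar>E\<bar> + 1))" using l0 by (simp add: \<eta>'_def)
      also have "\<dots> \<le> \<eta> * 1" using \<eta> by (intro mult_left_mono) (auto simp: field_simps)
      finally show ?thesis by simp
    qed
    define M where "M = 1 / (4 * \<eta>') + G * V\<^sup>2"
    have M: "M \<ge> 0" using \<eta>' G(1) by (simp add: M_def)
    have "(\<forall>t\<in>{a..b}. norm (velocity {0..1} x t c) \<le> V) \<and>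
        (\<forall>s\<in>{a..b}. \<forall>t\<in>{a..b}. norm (velocity {0..1} x t c - velocity {0..1} x s c) \<le> \<eta> + M * \<bar>t - s\<bar>)"
      if x: "x \<in> H2_curves A" and E1: "integral {0..1} (energy1 x) \<le> E" and E2: "integral {0..1} (energy2 x) \<le> E"
        and ab: "0 \<le> a" "b \<le> 1" "b - a = \<delta>" and xc: "x ` {a..b} \<subseteq> cinv c ` cball y0 r" for x a b
    proof -
      let ?v = "\<lambda>t. velocity {0..1} x t c"
      have ab': "a < b" using ab \<delta> by simp
      have xin: "x ` {a..b} \<subseteq> fst c" and yin: "\<And>t. t \<in> {a..b} \<Longrightarrow> snd c (x t) \<in> cball y0 r"
        by (rule coord_ball_image[OF cb xc])+
      have vc: "continuous_on {a..b} ?v"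
        using continuous_on_coords(2)[OF H2_C1[OF x] c _ xin] ab by auto
      have v2: "(\<lambda>t. (norm (?v t))\<^sup>2) integrable_on {a..b}"
        by (intro integrable_continuous_real continuous_intros vc)
      have ve: "l\<^sup>2 * (norm (?v t))\<^sup>2 \<le> energy1 x t" if t: "t \<in> {a..b}" for t
      proof -
        have "energy1 x t = g c (snd c (x t)) (?v t) (?v t)"
          using sq_norm_velocity[OF H2_C1[OF x] _ _ c subsetD[OF xin imageI[OF t]]] t ab by simp
        then have "(l * norm (?v t))\<^sup>2 \<le> (sqrt (energy1 x t))\<^sup>2"
          using lb[OF yin[OF t], of "?v t"] l0 by (intro power_mono) auto
        then show ?thesis by (simp add: power_mult_distrib sq_norm_nonneg)
      qed
      have Kv: "integral {s..t} (\<lambda>t. (norm (?v t))\<^sup>2) \<le> E / l\<^sup>2" if st: "a \<le> s" "s \<le> t" "t \<le> b" for s t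
      proof -
        have i: "(\<lambda>t. (norm (?v t))\<^sup>2) integrable_on {s..t}" using integrable_on_subinterval[OF v2] st by auto
        have "integral {s..t} (\<lambda>t. l\<^sup>2 * (norm (?v t))\<^sup>2) \<le> integral {s..t} (energy1 x)"
          using ve st ab by (intro integral_le integrable_on_mult_right i integrable_on_subinterval[OF energy1_integrable[OF x]]) auto
        also have "\<dots> \<le> E"
          using integral_subinterval_le[OF energy1_integrable[OF x] sq_norm_nonneg, of s t] st ab E1 by auto
        finally show ?thesis using l0 by (simp add: field_simps)
      qed
      have inc1: "norm (?v t - ?v s) \<le> K" if st: "a \<le> s" "s \<le> t" "t \<le> b" for s t
      proof -
        have "norm (?v t - ?v s) \<le> 1 * E / l\<^sup>2 + (t - s) / (4 * 1) + G * (E / l\<^sup>2)"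
          by (rule H2_velocity_increment[where k="\<lambda>s t. E / l\<^sup>2", OF x cb ab(1) ab' ab(2) xc l G E2 zero_less_one Kv st])
        also have "\<dots> \<le> K" using st ab by (simp add: K_def)
        finally show ?thesis .
      qed
      have inc: "norm (?v t - ?v s) \<le> K" if "s \<in> {a..b}" "t \<in> {a..b}" for s t
        using inc1[of s t] inc1[of t s] that by (cases "s \<le> t") (auto simp: norm_minus_commute)
      have "\<exists>s\<in>{a..b}. (norm (?v s))\<^sup>2 \<le> E / (l\<^sup>2 * \<delta>)"
      proof (rule ccontr)
        assume "\<not> ?thesis"
        then have gt: "(norm (?v s))\<^sup>2 > E / (l\<^sup>2 * \<delta>)" if "s \<in> {a..b}" for s using that by force
        obtain s0 where s0: "s0 \<in> {a..b}" "\<And>s. s \<in> {a..b} \<Longrightarrow> (norm (?v s0))\<^sup>2 \<le> (norm (?v s))\<^sup>2"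
        proof -
          have "continuous_on {a..b} (\<lambda>t. (norm (?v t))\<^sup>2)" by (intro continuous_intros vc)
          moreover have "{a..b} \<noteq> {}" using ab' by simp
          ultimately show ?thesis using continuous_attains_inf[OF compact_Icc] that by blast
        qed
        have "integral {a..b} (\<lambda>t. (norm (?v s0))\<^sup>2) \<le> integral {a..b} (\<lambda>t. (norm (?v t))\<^sup>2)"
          using s0(2) v2 by (intro integral_le) auto
        then have "\<delta> * (norm (?v s0))\<^sup>2 \<le> E / l\<^sup>2" using Kv[of a b] ab ab' by simp
        moreover have "E / l\<^sup>2 < \<delta> * (norm (?v s0))\<^sup>2" using gt[OF s0(1)] \<delta> l0 by (simp add: field_simps)
        ultimately show False by simp
      qed
      then obtain s where s: "s \<in> {a..b}" "(norm (?v s))\<^sup>2 \<le> E / (l\<^sup>2 * \<delta>)" by blast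
      have "norm (?v s) \<le> sqrt (E / (l\<^sup>2 * \<delta>))" using s(2) by (rule real_le_rsqrt)
      then have bnd: "norm (?v t) \<le> V" if "t \<in> {a..b}" for t
        using inc[OF s(1) that] norm_triangle_ineq[of "?v t - ?v s" "?v s"] by (simp add: V_def)
      have V: "V \<ge> 0" using order_trans[OF norm_ge_zero bnd[of a]] ab' by simp
      have Kv': "integral {s..t} (\<lambda>t. (norm (?v t))\<^sup>2) \<le> (t - s) * V\<^sup>2" if st: "a \<le> s" "s \<le> t" "t \<le> b" for s t
      proof -
        have "integral {s..t} (\<lambda>t. (norm (?v t))\<^sup>2) \<le> integral {s..t} (\<lambda>t. V\<^sup>2)"
          using integrable_on_subinterval[OF v2, of s t] st bnd by (intro integral_le) (auto intro!: power_mono)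
        then show ?thesis using st by simp
      qed
      have inc2: "norm (?v t - ?v s) \<le> \<eta> + M * \<bar>t - s\<bar>" if st: "a \<le> s" "s \<le> t" "t \<le> b" for s t
      proof -
        have "norm (?v t - ?v s) \<le> \<eta>' * E / l\<^sup>2 + (t - s) / (4 * \<eta>') + G * ((t - s) * V\<^sup>2)"
          by (rule H2_velocity_increment[OF x cb ab(1) ab' ab(2) xc l G E2 \<eta>' Kv' st])
        also have "\<dots> \<le> \<eta> + M * \<bar>t - s\<bar>" using \<eta>'E st by (simp add: M_def algebra_simps)
        finally show ?thesis .
      qed
      have "norm (?v t - ?v s) \<le> \<eta> + M * \<bar>t - s\<bar>" if "s \<in> {a..b}" "t \<in> {a..b}" for s t
        using inc2[of s t] inc2[of t s] that by (cases "s \<le> t") (auto simp: norm_minus_commute abs_minus_commute)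
      then show ?thesis using bnd by blast
    qed
    then show ?thesis using M by blast
  qed
  then show ?thesis by (intro exI[of _ V]) blast
qed

end

section \<open>The space of curves of class C1\<close>

context riemannian
begin

text \<open>The points converge because the inverse chart is continuous, so they enter
  \<open>fst d\<close> eventually. The components in \<open>d\<close> converge because the
  derivative of the transition map is jointly continuous in base point and vector.\<close>

lemma chart_limit:
  assumes c: "c \<in> A" and d: "d \<in> A"
    and q: "\<And>n. q n \<in> fst c" and Y: "Y \<in> img c" "(\<lambda>n. snd c (q n)) \<longlonglongrightarrow> Y" and w: "w \<longlonglongrightarrow> W"
  shows "q \<longlonglongrightarrow> cinv c Y"
    and "cinv c Y \<in> fst d \<Longrightarrow> eventually (\<lambda>n. q n \<in> fst d) sequentially"
    and "cinv c Y \<in> fst d \<Longrightarrow> (\<lambda>n. snd d (q n)) \<longlonglongrightarrow> snd d (cinv c Y)"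
    and "cinv c Y \<in> fst d \<Longrightarrow> (\<lambda>n. Dtr c d (snd c (q n)) (w n)) \<longlonglongrightarrow> Dtr c d Y W"
proof -
  have "isCont (cinv c) Y"
    using continuous_on_eq_continuous_at[OF open_img[OF c], of "cinv c"] continuous_on_cinv[OF c] Y(1) by blast
  from isCont_tendsto_compose[OF this Y(2)] show lim: "q \<longlonglongrightarrow> cinv c Y" by (simp add: cinv_snd[OF c q])
  show "eventually (\<lambda>n. q n \<in> fst d) sequentially" if "cinv c Y \<in> fst d"
    using topological_tendstoD[OF lim open_chart[OF d] that] .
  show "(\<lambda>n. snd d (q n)) \<longlonglongrightarrow> snd d (cinv c Y)" if "cinv c Y \<in> fst d"
  proof -
    have "isCont (snd d) (cinv c Y)"
      using continuous_on_chart[OF d] open_chart[OF d] that by (simp add: continuous_on_eq_continuous_at)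
    from isCont_tendsto_compose[OF this lim] show ?thesis .
  qed
  show "(\<lambda>n. Dtr c d (snd c (q n)) (w n)) \<longlonglongrightarrow> Dtr c d Y W" if Yd: "cinv c Y \<in> fst d"
  proof -
    let ?O = "overlap c d \<times> (UNIV :: 'e set)"
    have o: "open ?O" by (intro open_Times open_overlap c d open_UNIV)
    have "continuous_on ?O (\<lambda>p. Dtr c d (fst p) (snd p))"
      by (rule smooth_on_continuous_frechet_derivative[OF smooth_transition[OF c d]])
        (auto intro: continuous_intros)
    moreover have "(Y, W) \<in> ?O" using Y(1) Yd by (simp add: overlap_iff[OF c])
    ultimately have "isCont (\<lambda>p. Dtr c d (fst p) (snd p)) (Y, W)"
      using o by (metis continuous_on_eq_continuous_at)
    from isCont_tendsto_compose[OF this tendsto_Pair[OF Y(2) w]] show ?thesis by simp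
  qed
qed

text \<open>Away from \<open>b\<close> nothing changes locally. At \<open>b\<close> the two
  one-sided derivatives agree in every chart, which is differentiability there, and continuity of
  the velocity is checked on two relatively closed sets of times.\<close>

lemma C1_curve_on_glue:
  assumes x1: "C1_curve_on A {a..b} x" and x2: "C1_curve_on A {b..e} x" and abe: "a < b" "b < e"
    and eq: "\<And>d. d \<in> A \<Longrightarrow> x b \<in> fst d \<Longrightarrow> velocity {a..b} x b d = velocity {b..e} x b d"
  shows "C1_curve_on A {a..e} x"
    "\<And>t d. t \<in> {a..b} \<Longrightarrow> d \<in> A \<Longrightarrow> x t \<in> fst d \<Longrightarrow> velocity {a..e} x t d = velocity {a..b} x t d"
    "\<And>t d. t \<in> {b..e} \<Longrightarrow> d \<in> A \<Longrightarrow> x t \<in> fst d \<Longrightarrow> velocity {a..e} x t d = velocity {b..e} x t d"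
proof -
  have un: "{a..e} = {a..b} \<union> {b..e}" using abe by auto
  have at_b: "((snd d \<circ> x) has_vector_derivative velocity {a..b} x b d) (at b within {a..e})"
    if d: "d \<in> A" "x b \<in> fst d" for d
  proof -
    have 1: "((snd d \<circ> x) has_vector_derivative velocity {a..b} x b d) (at b within {a..b})"
      using C1_curve_on_velocity[OF x1 _ d] abe by simp
    have 2: "((snd d \<circ> x) has_vector_derivative velocity {a..b} x b d) (at b within {b..e})"
      using C1_curve_on_velocity[OF x2 _ d] abe eq[OF d] by simp
    show ?thesis using 1 2 unfolding un has_vector_derivative_def has_derivative_within unfolding at_within_union
      by (simp add: filterlim_sup)
  qed
  have nhd1: "at t within {a..e} = at t within {a..b}" if "t < b" for t
    by (rule at_within_nhd[of _ "{..<b}"]) (use that abe in auto)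
  have nhd2: "at t within {a..e} = at t within {b..e}" if "b < t" for t
    by (rule at_within_nhd[of _ "{b<..}"]) (use that abe in auto)
  have d1: "((snd d \<circ> x) has_vector_derivative velocity {a..b} x t d) (at t within {a..e})"
    if t: "t \<in> {a..b}" "d \<in> A" "x t \<in> fst d" for t d
  proof (cases "t = b")
    case False
    then show ?thesis using nhd1[of t] C1_curve_on_velocity[OF x1 t] t(1) by auto
  qed (use at_b t in simp)
  have d2: "((snd d \<circ> x) has_vector_derivative velocity {b..e} x t d) (at t within {a..e})"
    if t: "t \<in> {b..e}" "d \<in> A" "x t \<in> fst d" for t d
  proof (cases "t = b")
    case False
    then show ?thesis using nhd2[of t] C1_curve_on_velocity[OF x2 t] t(1) by auto
  qed (use at_b[of d] eq[of d] t in simp)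
  show v1: "velocity {a..e} x t d = velocity {a..b} x t d" if t: "t \<in> {a..b}" "d \<in> A" "x t \<in> fst d" for t d
    using vector_derivative_within_cbox[of a e t "snd d \<circ> x"] d1[OF t] abe t(1)
    unfolding velocity_def[of "{a..e}"] by auto
  show v2: "velocity {a..e} x t d = velocity {b..e} x t d" if t: "t \<in> {b..e}" "d \<in> A" "x t \<in> fst d" for t d
    using vector_derivative_within_cbox[of a e t "snd d \<circ> x"] d2[OF t] abe t(1)
    unfolding velocity_def[of "{a..e}"] by auto
  show "C1_curve_on A {a..e} x" unfolding C1_curve_on_def
  proof (intro conjI ballI)
    show xc: "continuous_on {a..e} x" unfolding un
      by (intro continuous_on_closed_Un C1_curve_on_continuous_on x1 x2) auto
    fix d assume d: "d \<in> A"
    show "(snd d \<circ> x) differentiable (at t within {a..e})" if t: "t \<in> {t \<in> {a..e}. x t \<in> fst d}" for t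
      using d1[of t d] d2[of t d] t d by (cases "t \<le> b") (auto intro: differentiableI_vector)
    let ?N = "\<lambda>T. {t \<in> T. x t \<in> fst d}"
    have N: "?N {a..e} = ?N {a..b} \<union> ?N {b..e}" using un by auto
    have "?N {a..b} = ?N {a..e} \<inter> {a..b}" "?N {b..e} = ?N {a..e} \<inter> {b..e}" using abe by auto
    then have cl: "closedin (top_of_set (?N {a..e})) (?N {a..b})" "closedin (top_of_set (?N {a..e})) (?N {b..e})"
      unfolding closedin_closed using closed_atLeastAtMost by blast+
    have 1: "continuous_on (?N {a..b}) (\<lambda>t. velocity {a..e} x t d)"
      by (rule continuous_on_eq[of _ "\<lambda>t. velocity {a..b} x t d"]) (use x1 d v1 in \<open>auto simp: C1_curve_on_def\<close>)
    have 2: "continuous_on (?N {b..e}) (\<lambda>t. velocity {a..e} x t d)"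
      by (rule continuous_on_eq[of _ "\<lambda>t. velocity {b..e} x t d"]) (use x2 d v2 in \<open>auto simp: C1_curve_on_def\<close>)
    show "continuous_on (?N {a..e}) (\<lambda>t. velocity {a..e} x t d)"
      using continuous_on_Un_local[OF cl[unfolded N] 1 2] unfolding N .
  qed
qed

section \<open>The topology of C1 convergence\<close>

lemma topspace_C1_topology: "topspace (C1_topology A) = C1_curves A"
proof
  show "topspace (C1_topology A) \<subseteq> C1_curves A"
    unfolding C1_topology_def topology_generated_by_topspace by (auto simp: C1_nbhd_def)
  show "C1_curves A \<subseteq> topspace (C1_topology A)"
  proof
    fix x assume x: "x \<in> C1_curves A"
    \<comment> \<open>An empty set of parameters imposes no condition, so this subbasic set is all
      of \<open>C1_curves A\<close>.\<close>
    have "C1_nbhd A x (chart_at A undefined) {} 1 \<in> {C1_nbhd A x c K e | x c K e.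
        x \<in> C1_curves A \<and> c \<in> A \<and> compact K \<and> K \<subseteq> {0..1} \<and> x ` K \<subseteq> fst c \<and> e > 0}"
      using x chart_at by fastforce
    moreover have "x \<in> C1_nbhd A x (chart_at A undefined) {} 1" using x by (simp add: C1_nbhd_def)
    ultimately show "x \<in> topspace (C1_topology A)"
      unfolding C1_topology_def topology_generated_by_topspace by blast
  qed
qed

lemma openin_C1_nbhd:
  assumes "x \<in> C1_curves A" "c \<in> A" "compact K" "K \<subseteq> {0..1}" "x ` K \<subseteq> fst c" "e > 0"
  shows "openin (C1_topology A) (C1_nbhd A x c K e)"
  unfolding C1_topology_def by (rule topology_generated_by_Basis) (use assms in blast)

lemma C1_nbhd_pointwise:
  assumes x: "x \<in> C1_curves A" and t: "t \<in> {0..1}" and P: "open P" "x t \<in> P"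
  shows "\<exists>W. openin (C1_topology A) W \<and> x \<in> W \<and> (\<forall>z\<in>W. z t \<in> P)"
proof -
  let ?c = "chart_at A (x t)"
  note c = chart_at[of "x t"]
  have "img ?c \<inter> cinv ?c -` P = cinv ?c -` P \<inter> img ?c" by blast
  then have "open (img ?c \<inter> cinv ?c -` P)"
    using continuous_on_open_vimage[OF open_img[OF c(1)]] continuous_on_cinv[OF c(1)] P(1) by metis
  moreover have "snd ?c (x t) \<in> img ?c \<inter> cinv ?c -` P" using c P(2) by (simp add: cinv_snd)
  ultimately obtain e where e: "e > 0" "ball (snd ?c (x t)) e \<subseteq> img ?c \<inter> cinv ?c -` P" using openE by blast
  have o: "openin (C1_topology A) (C1_nbhd A x ?c {t} e)"
    by (rule openin_C1_nbhd) (use x c t e in auto)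
  have "z t \<in> P" if z: "z \<in> C1_nbhd A x ?c {t} e" for z
  proof -
    have zt: "z t \<in> fst ?c" "norm (snd ?c (z t) - snd ?c (x t)) < e" using z by (auto simp: C1_nbhd_def)
    then have "snd ?c (z t) \<in> ball (snd ?c (x t)) e" by (simp add: dist_norm norm_minus_commute)
    then have "cinv ?c (snd ?c (z t)) \<in> P" using e(2) by blast
    then show ?thesis by (simp add: cinv_snd[OF c(1) zt(1)])
  qed
  moreover have "x \<in> C1_nbhd A x ?c {t} e" using x c e by (simp add: C1_nbhd_def)
  ultimately show ?thesis using o by blast
qed

text \<open>Evaluations are continuous by \<open>C1_nbhd_pointwise\<close>, and curves that are
  normalised outside \<open>[0,1]\<close> differ at some time inside if they differ at all. The
  theorem relies on it because a compact set then contains the closures of its subsets.\<close>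

lemma Hausdorff_C1_topology: "Hausdorff_space (C1_topology A)"
  unfolding Hausdorff_space_def topspace_C1_topology
proof (intro allI impI)
  fix x y assume xy: "x \<in> C1_curves A \<and> y \<in> C1_curves A \<and> x \<noteq> y"
  then have ext: "x \<in> extensional {0..1}" "y \<in> extensional {0..1}" by (auto simp: C1_curves_def)
  have "\<exists>t\<in>{0..1}. x t \<noteq> y t"
  proof (rule ccontr)
    assume "\<not> (\<exists>t\<in>{0..1}. x t \<noteq> y t)"
    then have "x = y" using extensionalityI[OF ext] by blast
    then show False using xy by simp
  qed
  then obtain t where t: "t \<in> {0..1}" "x t \<noteq> y t" by blast
  obtain P Q where PQ: "open P" "open Q" "x t \<in> P" "y t \<in> Q" "P \<inter> Q = {}" using hausdorff[OF t(2)] by blast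
  obtain W where W: "openin (C1_topology A) W" "x \<in> W" "\<And>z. z \<in> W \<Longrightarrow> z t \<in> P"
    using C1_nbhd_pointwise[of x, OF _ t(1) PQ(1,3)] xy by blast
  obtain W' where W': "openin (C1_topology A) W'" "y \<in> W'" "\<And>z. z \<in> W' \<Longrightarrow> z t \<in> Q"
    using C1_nbhd_pointwise[of y, OF _ t(1) PQ(2,4)] xy by blast
  have "disjnt W W'" using W(3) W'(3) PQ(5) by (auto simp: disjnt_iff)
  then show "\<exists>U V. openin (C1_topology A) U \<and> openin (C1_topology A) V \<and> x \<in> U \<and> y \<in> V \<and> disjnt U V"
    using W W' by blast
qed

end

section \<open>Curves with a given itinerary\<close>

locale itinerary = riemannian A g
  for A :: "('m::t2_space, 'e::finite_dim_space) chart set" and g :: "('m, 'e) metric_rep" +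
  fixes N :: nat and c :: "nat \<Rightarrow> ('m, 'e) chart" and y0 :: "nat \<Rightarrow> 'e" and r :: "nat \<Rightarrow> real"
  assumes N: "N > 0" and cb: "\<And>j. j < N \<Longrightarrow> coord_ball (c j) (y0 j) (r j)"
begin

definition piece :: "nat \<Rightarrow> real set" where
  "piece j = {real j / real N .. (real j + 1) / real N}"

text \<open>Pieces with different numbers have distance at least 1 in this compact subset of the plane, so that one
  application of the theorem of Arzela and Ascoli treats all of them.\<close>

definition idx :: "(real \<times> real) set" where
  "idx = (\<Union>j<N. {real j} \<times> piece j)"

text \<open>Coordinates and velocity at time \<open>snd p\<close> in the chart of the piece whose
  number is \<open>fst p\<close>; the floor recovers the number from a real.\<close>

definition jet :: "(real \<Rightarrow> 'm) \<Rightarrow> real \<times> real \<Rightarrow> 'e \<times> 'e" where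
  "jet x p = (snd (c (nat \<lfloor>fst p\<rfloor>)) (x (snd p)), velocity {0..1} x (snd p) (c (nat \<lfloor>fst p\<rfloor>)))"

text \<open>Class \<open>C1\<close> and closed balls are conditions that survive the limits taken
  below.\<close>

definition curves :: "(real \<Rightarrow> 'm) set" where
  "curves = {x \<in> C1_curves A. \<forall>j<N. x ` piece j \<subseteq> cinv (c j) ` cball (y0 j) (r j)}"

text \<open>\<open>Metric_space\<close> asks for symmetry and nonnegativity at all arguments, hence
  the value 0 for pairs not in \<open>curves\<close>.\<close>

definition jet_dist :: "(real \<Rightarrow> 'm) \<Rightarrow> (real \<Rightarrow> 'm) \<Rightarrow> real" where
  "jet_dist x z = (if x \<in> curves \<and> z \<in> curves then SUP p\<in>idx. norm (jet x p - jet z p) else 0)"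

section \<open>Pieces of the parameter interval and the jet metric\<close>

lemma chart_in: "j < N \<Longrightarrow> c j \<in> A" and ball_img: "j < N \<Longrightarrow> cball (y0 j) (r j) \<subseteq> img (c j)"
  using cb by (auto simp: coord_ball_def)

lemma jet_eq [simp]: "jet x (real j, t) = (snd (c j) (x t), velocity {0..1} x t (c j))"
  by (simp add: jet_def)

lemma piece_less: "real j / real N < (real j + 1) / real N"
  using N by (simp add: divide_strict_right_mono)

lemma piece_subset:
  assumes "j < N"
  shows "piece j \<subseteq> {0..1}"
proof -
  have "real j + 1 \<le> real N" using assms by linarith
  then have "(real j + 1) / real N \<le> 1" using N by simp
  moreover have "0 \<le> real j / real N" by simp
  ultimately show ?thesis unfolding piece_def by (intro atLeastatMost_subset_iff[THEN iffD2]) blast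
qed

lemma piece_cover:
  assumes t: "t \<in> {0..1}"
  shows "\<exists>j<N. t \<in> piece j"
proof (cases "t = 1")
  \<comment> \<open>The floor of \<open>t * real N\<close> would be \<open>N\<close> here, one too
    many, so \<open>t = 1\<close> goes to the last piece.\<close>
  case True
  have "real (N - 1) + 1 = real N" using N by simp
  then have "t \<in> piece (N - 1)" using True N by (simp add: piece_def)
  then show ?thesis using N by (intro exI[of _ "N - 1"]) simp
next
  case False
  define j where "j = nat \<lfloor>t * real N\<rfloor>"
  have nn: "t * real N \<ge> 0" using t by simp
  then have 1: "real j \<le> t * real N" "t * real N < real j + 1" unfolding j_def by linarith+
  have "t * real N < 1 * real N" using False t N by (intro mult_strict_right_mono) auto
  then have "j < N" using 1 by linarith
  moreover have "t \<in> piece j" unfolding piece_def using 1 N by (simp add: field_simps)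
  ultimately show ?thesis by blast
qed

lemma idx_iff: "p \<in> idx \<longleftrightarrow> (\<exists>j<N. \<exists>t\<in>piece j. p = (real j, t))"
  by (auto simp: idx_def)

lemma compact_idx: "compact idx"
  unfolding idx_def by (intro compact_UN compact_Times) (auto simp: piece_def)

lemma idx_nonempty: "idx \<noteq> {}"
proof -
  obtain j where "j < N" "0 \<in> piece j" using piece_cover[of 0] by auto
  then have "(real j, 0) \<in> idx" unfolding idx_iff by blast
  then show ?thesis by blast
qed

lemma curves_C1: "x \<in> curves \<Longrightarrow> C1_curve_on A {0..1} x"
  by (simp add: curves_def C1_curves_def)

lemma curves_piece:
  assumes "x \<in> curves" "j < N" "t \<in> piece j"
  shows "x t \<in> fst (c j)" "snd (c j) (x t) \<in> cball (y0 j) (r j)"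
proof -
  have "x ` piece j \<subseteq> cinv (c j) ` cball (y0 j) (r j)" using assms by (simp add: curves_def)
  from coord_ball_image[OF cb[OF assms(2)] this] assms(3)
  show "x t \<in> fst (c j)" "snd (c j) (x t) \<in> cball (y0 j) (r j)" by auto
qed

lemma continuous_on_jet:
  assumes x: "x \<in> curves"
  shows "continuous_on idx (jet x)"
  unfolding idx_def
proof (rule continuous_on_closed_Union)
  fix j assume "j \<in> {..<N}"
  then have j: "j < N" by simp
  show "closed ({real j} \<times> piece j)" by (intro closed_Times) (auto simp: piece_def)
  have sub: "x ` piece j \<subseteq> fst (c j)" using curves_piece(1)[OF x j] by auto
  note co = continuous_on_coords[OF curves_C1[OF x] chart_in[OF j] piece_subset[OF j] sub]
  have "continuous_on ({real j} \<times> piece j) (\<lambda>p. (snd (c j) (x (snd p)), velocity {0..1} x (snd p) (c j)))"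
    by (intro continuous_on_Pair continuous_on_compose2[OF co(1)] continuous_on_compose2[OF co(2)]
        continuous_on_snd continuous_on_id) auto
  then show "continuous_on ({real j} \<times> piece j) (jet x)"
    by (rule continuous_on_eq) auto
qed auto

lemma jet_dist_bdd:
  assumes "x \<in> curves" "z \<in> curves"
  shows "bdd_above ((\<lambda>p. norm (jet x p - jet z p)) ` idx)"
proof -
  have "continuous_on idx (\<lambda>p. norm (jet x p - jet z p))"
    by (intro continuous_intros continuous_on_jet assms)
  then have "compact ((\<lambda>p. norm (jet x p - jet z p)) ` idx)"
    by (rule compact_continuous_image[OF _ compact_idx])
  then show ?thesis by (intro bounded_imp_bdd_above compact_imp_bounded)
qed

lemma jet_dist_upper: "x \<in> curves \<Longrightarrow> z \<in> curves \<Longrightarrow> p \<in> idx \<Longrightarrow> norm (jet x p - jet z p) \<le> jet_dist x z"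
  using cSUP_upper[OF _ jet_dist_bdd] by (simp add: jet_dist_def)

lemma jet_dist_least:
  "x \<in> curves \<Longrightarrow> z \<in> curves \<Longrightarrow> (\<And>p. p \<in> idx \<Longrightarrow> norm (jet x p - jet z p) \<le> e) \<Longrightarrow> jet_dist x z \<le> e"
  using cSUP_least[OF idx_nonempty, of "\<lambda>p. norm (jet x p - jet z p)" e] by (simp add: jet_dist_def)

lemma jet_dist_nonneg: "jet_dist x z \<ge> 0"
proof (cases "x \<in> curves \<and> z \<in> curves")
  case True
  obtain p where "p \<in> idx" using idx_nonempty by blast
  then show ?thesis using order_trans[OF norm_ge_zero jet_dist_upper] True by blast
qed (auto simp: jet_dist_def)

lemma jet_inject:
  assumes x: "x \<in> curves" and z: "z \<in> curves" and eq: "\<And>p. p \<in> idx \<Longrightarrow> jet x p = jet z p"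
  shows "x = z"
proof (rule extensionalityI[of _ "{0..1}"])
  show "x \<in> extensional {0..1}" "z \<in> extensional {0..1}" using x z by (auto simp: curves_def C1_curves_def)
  fix t :: real assume "t \<in> {0..1}"
  then obtain j where j: "j < N" "t \<in> piece j" using piece_cover by blast
  then have "(real j, t) \<in> idx" by (auto simp: idx_iff)
  from eq[OF this] have "cinv (c j) (snd (c j) (x t)) = cinv (c j) (snd (c j) (z t))" by simp
  then show "x t = z t"
    unfolding cinv_snd[OF chart_in[OF j(1)] curves_piece(1)[OF x j]] cinv_snd[OF chart_in[OF j(1)] curves_piece(1)[OF z j]] .
qed

lemma Metric_space_curves: "Metric_space curves jet_dist"
proof
  show "0 \<le> jet_dist x z" for x z by (rule jet_dist_nonneg)
  show "jet_dist x z = jet_dist z x" for x z by (simp add: jet_dist_def norm_minus_commute)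
  show "jet_dist x z = 0 \<longleftrightarrow> x = z" if xz: "x \<in> curves" "z \<in> curves" for x z
  proof
    assume 0: "jet_dist x z = 0"
    have "jet x p = jet z p" if "p \<in> idx" for p using jet_dist_upper[OF xz that] 0 by simp
    then show "x = z" by (rule jet_inject[OF xz])
  next
    assume "x = z"
    then show "jet_dist x z = 0" using jet_dist_least[OF xz, of 0] jet_dist_nonneg[of x z] by simp
  qed
  show "jet_dist x w \<le> jet_dist x z + jet_dist z w" if "x \<in> curves" "z \<in> curves" "w \<in> curves" for x z w
  proof (rule jet_dist_least[OF that(1,3)])
    fix p assume p: "p \<in> idx"
    have "norm (jet x p - jet w p) \<le> norm (jet x p - jet z p) + norm (jet z p - jet w p)"
      using norm_triangle_ineq[of "jet x p - jet z p" "jet z p - jet w p"] by simp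
    then show "norm (jet x p - jet w p) \<le> jet_dist x z + jet_dist z w"
      using jet_dist_upper[OF that(1,2) p] jet_dist_upper[OF that(2,3) p] by linarith
  qed
qed

text \<open>On each piece the limit of the coordinates has the limit of the velocities as its
  derivative, since the latter converge uniformly. The curves converge pointwise in the manifold, so
  the pieces fit together, and so do their velocities: at a joint both one-sided velocities are the
  limit of the same sequence.\<close>

lemma curves_limit:
  fixes \<sigma> :: "nat \<Rightarrow> real \<Rightarrow> 'm"
  assumes \<sigma>: "\<And>n. \<sigma> n \<in> curves" and G: "continuous_on idx G"
    and conv: "\<And>e. e > 0 \<Longrightarrow> \<exists>n0. \<forall>n\<ge>n0. \<forall>p\<in>idx. norm (jet (\<sigma> n) p - G p) < e"
  shows "\<exists>x\<in>curves. \<forall>p\<in>idx. jet x p = G p"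
proof -
  define Y where "Y j t = fst (G (real j, t))" for j t
  define W where "W j t = snd (G (real j, t))" for j t
  have lim: "(\<lambda>n. jet (\<sigma> n) p) \<longlonglongrightarrow> G p" if "p \<in> idx" for p
    using conv that unfolding LIMSEQ_iff by meson
  have inD: "(real j, t) \<in> idx" if "j < N" "t \<in> piece j" for j t using that by (auto simp: idx_iff)
  have limY: "(\<lambda>n. snd (c j) (\<sigma> n t)) \<longlonglongrightarrow> Y j t" if "j < N" "t \<in> piece j" for j t
    using tendsto_fst[OF lim[OF inD[OF that]]] by (simp add: Y_def)
  have limW: "(\<lambda>n. velocity {0..1} (\<sigma> n) t (c j)) \<longlonglongrightarrow> W j t" if "j < N" "t \<in> piece j" for j t
    using tendsto_snd[OF lim[OF inD[OF that]]] by (simp add: W_def)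
  have Yball: "Y j t \<in> cball (y0 j) (r j)" if "j < N" "t \<in> piece j" for j t
    using closed_sequentially[OF closed_cball _ limY[OF that]] curves_piece(2)[OF \<sigma> that] by blast
  have Yimg: "Y j t \<in> img (c j)" if "j < N" "t \<in> piece j" for j t using Yball[OF that] ball_img[OF that(1)] by blast
  have dY: "(Y j has_vector_derivative W j t) (at t within piece j)" if j: "j < N" and t: "t \<in> piece j" for j t
  proof -
    \<comment> \<open>Termwise differentiation yields some limit function \<open>h\<close>, which
      uniqueness of limits then identifies with \<open>Y j\<close> on the piece.\<close>
    have "\<exists>h. \<forall>t\<in>piece j. (\<lambda>n. snd (c j) (\<sigma> n t)) \<longlonglongrightarrow> h t \<and> (h has_derivative (\<lambda>u. u *\<^sub>R W j t)) (at t within piece j)"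
    proof (rule has_derivative_sequence[where f="\<lambda>n t. snd (c j) (\<sigma> n t)" and f'="\<lambda>n t u. u *\<^sub>R velocity {0..1} (\<sigma> n) t (c j)"
          and ?x0.0=t, OF _ _ _ t limY[OF j t]])
      show "convex (piece j)" by (simp add: piece_def)
      fix n s assume s: "s \<in> piece j"
      have "((snd (c j) \<circ> \<sigma> n) has_vector_derivative velocity {0..1} (\<sigma> n) s (c j)) (at s within {0..1})"
        using C1_curve_on_velocity[OF curves_C1[OF \<sigma>] _ chart_in[OF j] curves_piece(1)[OF \<sigma> j s]] s piece_subset[OF j] by blast
      then have "((snd (c j) \<circ> \<sigma> n) has_vector_derivative velocity {0..1} (\<sigma> n) s (c j)) (at s within piece j)"
        using piece_subset[OF j] by (rule has_vector_derivative_within_subset)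
      then show "((\<lambda>t. snd (c j) (\<sigma> n t)) has_derivative (\<lambda>u. u *\<^sub>R velocity {0..1} (\<sigma> n) s (c j))) (at s within piece j)"
        by (simp add: has_vector_derivative_def o_def)
    next
      fix e :: real assume "e > 0"
      then obtain n0 where n0: "\<And>n p. n \<ge> n0 \<Longrightarrow> p \<in> idx \<Longrightarrow> norm (jet (\<sigma> n) p - G p) < e" using conv by meson
      have "norm (u *\<^sub>R velocity {0..1} (\<sigma> n) s (c j) - u *\<^sub>R W j s) \<le> e * norm u" if n: "n \<ge> n0" and s: "s \<in> piece j" for n s u
      proof -
        have "norm (snd (jet (\<sigma> n) (real j, s) - G (real j, s))) \<le> norm (jet (\<sigma> n) (real j, s) - G (real j, s))"
          by (metis norm_snd_le prod.collapse)
        then have "norm (velocity {0..1} (\<sigma> n) s (c j) - W j s) \<le> e"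
          using n0[OF n inD[OF j s]] by (simp add: W_def)
        then have "\<bar>u\<bar> * norm (velocity {0..1} (\<sigma> n) s (c j) - W j s) \<le> \<bar>u\<bar> * e" by (intro mult_left_mono) auto
        then show ?thesis by (simp add: mult.commute flip: scaleR_diff_right)
      qed
      then show "\<forall>\<^sub>F n in sequentially. \<forall>s\<in>piece j. \<forall>u. norm (u *\<^sub>R velocity {0..1} (\<sigma> n) s (c j) - u *\<^sub>R W j s) \<le> e * norm u"
        unfolding eventually_sequentially by blast
    qed
    then obtain h where h: "\<And>t. t \<in> piece j \<Longrightarrow> (\<lambda>n. snd (c j) (\<sigma> n t)) \<longlonglongrightarrow> h t"
      "\<And>t. t \<in> piece j \<Longrightarrow> (h has_vector_derivative W j t) (at t within piece j)"
      unfolding has_vector_derivative_def by blast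
    have "h s = Y j s" if "s \<in> piece j" for s using LIMSEQ_unique[OF h(1)[OF that] limY[OF j that]] .
    then show ?thesis using has_vector_derivative_transform[OF t _ h(2)[OF t], of "Y j"] by simp
  qed
  \<comment> \<open>At a joint two pieces qualify; the choice is immaterial by uniqueness of limits
    in the Hausdorff manifold.\<close>
  define J where "J t = (SOME j. j < N \<and> t \<in> piece j)" for t
  have J: "J t < N" "t \<in> piece (J t)" if "t \<in> {0..1}" for t
    using someI_ex[of "\<lambda>j. j < N \<and> t \<in> piece j"] piece_cover[OF that] unfolding J_def by auto
  define x where "x t = (if t \<in> {0..1} then cinv (c (J t)) (Y (J t) t) else undefined)" for t
  have lim\<sigma>: "(\<lambda>n. \<sigma> n t) \<longlonglongrightarrow> cinv (c j) (Y j t)" if "j < N" "t \<in> piece j" for j t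
    by (rule chart_limit(1)[OF chart_in[OF that(1)] chart_in[OF that(1)] curves_piece(1)[OF \<sigma> that] Yimg[OF that] limY[OF that] tendsto_const])
  have x: "x t = cinv (c j) (Y j t)" if jt: "j < N" "t \<in> piece j" for j t
  proof -
    have t: "t \<in> {0..1}" using jt piece_subset by blast
    show ?thesis using LIMSEQ_unique[OF lim\<sigma>[OF J[OF t]] lim\<sigma>[OF jt]] t by (simp add: x_def)
  qed
  have xc: "x t \<in> fst (c j)" "snd (c j) (x t) = Y j t" if "j < N" "t \<in> piece j" for j t
    using cinv_in[OF Yimg[OF that]] snd_cinv[OF Yimg[OF that]] x[OF that] by auto
  have C1p: "C1_curve_on A (piece j) x" and vp: "\<And>t. t \<in> piece j \<Longrightarrow> velocity (piece j) x t (c j) = W j t" if j: "j < N" for j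
  proof -
    have sub: "x ` piece j \<subseteq> fst (c j)" using xc(1)[OF j] by auto
    have d: "((snd (c j) \<circ> x) has_vector_derivative W j t) (at t within piece j)" if t: "t \<in> piece j" for t
      by (rule has_vector_derivative_transform[OF t _ dY[OF j t]]) (simp add: xc(2)[OF j])
    have "continuous_on (piece j) (\<lambda>t. G (real j, t))"
      by (rule continuous_on_compose2[OF G]) (auto intro!: continuous_intros inD[OF j])
    then have wc: "continuous_on (piece j) (W j)" unfolding W_def[abs_def] by (rule continuous_on_snd)
    show "C1_curve_on A (piece j) x" "\<And>t. t \<in> piece j \<Longrightarrow> velocity (piece j) x t (c j) = W j t"
      using C1_curve_in_chart[OF chart_in[OF j] sub[unfolded piece_def] piece_less d[unfolded piece_def] wc[unfolded piece_def]]
      unfolding piece_def by blast+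
  qed
  have limv: "(\<lambda>n. velocity {0..1} (\<sigma> n) t d) \<longlonglongrightarrow> velocity (piece j) x t d"
    if j: "j < N" and t: "t \<in> piece j" and d: "d \<in> A" "x t \<in> fst d" for j t d
  proof -
    have Yd: "cinv (c j) (Y j t) \<in> fst d" using d(2) x[OF j t] by simp
    note cl = chart_limit[OF chart_in[OF j] d(1) curves_piece(1)[OF \<sigma> j t] Yimg[OF j t] limY[OF j t] limW[OF j t]]
    have "velocity (piece j) x t d = Dtr (c j) d (Y j t) (W j t)"
      using velocity_transition[OF C1p[OF j, unfolded piece_def] _ piece_less chart_in[OF j] xc(1)[OF j t] d] t vp[OF j t] xc(2)[OF j t]
      by (simp add: piece_def)
    moreover have "eventually (\<lambda>n. Dtr (c j) d (snd (c j) (\<sigma> n t)) (velocity {0..1} (\<sigma> n) t (c j)) = velocity {0..1} (\<sigma> n) t d) sequentially"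
      using cl(2)[OF Yd]
    proof (rule eventually_mono)
      fix n assume "\<sigma> n t \<in> fst d"
      moreover have "t \<in> {0..1}" using t piece_subset[OF j] by blast
      ultimately show "Dtr (c j) d (snd (c j) (\<sigma> n t)) (velocity {0..1} (\<sigma> n) t (c j)) = velocity {0..1} (\<sigma> n) t d"
        using velocity_transition[OF curves_C1[OF \<sigma>] _ _ chart_in[OF j] curves_piece(1)[OF \<sigma> j t] d(1)] by simp
    qed
    ultimately show ?thesis using Lim_transform_eventually[OF cl(4)[OF Yd]] by simp
  qed
  \<comment> \<open>The induction carries along the convergence of the velocities in every chart,
    for it supplies the agreement of the one-sided velocities at the next joint.\<close>
  have glue: "k < N \<Longrightarrow> C1_curve_on A {0..(real k + 1) / real N} x \<and>
      (\<forall>t\<in>{0..(real k + 1) / real N}. \<forall>d\<in>A. x t \<in> fst d \<longrightarrow>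
        (\<lambda>n. velocity {0..1} (\<sigma> n) t d) \<longlonglongrightarrow> velocity {0..(real k + 1) / real N} x t d)" for k
  proof (induction k)
    case 0
    have "{0..(real 0 + 1) / real N} = piece 0" by (simp add: piece_def)
    then show ?case using C1p[OF 0] limv[OF 0] by simp
  next
    case (Suc k)
    let ?b = "(real k + 1) / real N" and ?e = "(real (Suc k) + 1) / real N"
    have p: "piece (Suc k) = {?b..?e}" by (simp add: piece_def add.commute)
    have be: "0 < ?b" "?b < ?e" using N piece_less[of "Suc k"] by (auto simp: add.commute)
    have IH: "C1_curve_on A {0..?b} x"
      "\<And>t d. t \<in> {0..?b} \<Longrightarrow> d \<in> A \<Longrightarrow> x t \<in> fst d \<Longrightarrow> (\<lambda>n. velocity {0..1} (\<sigma> n) t d) \<longlonglongrightarrow> velocity {0..?b} x t d"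
      using Suc by auto
    have x2: "C1_curve_on A {?b..?e} x" using C1p[OF Suc.prems] unfolding p .
    have l2: "(\<lambda>n. velocity {0..1} (\<sigma> n) t d) \<longlonglongrightarrow> velocity {?b..?e} x t d"
      if "t \<in> {?b..?e}" "d \<in> A" "x t \<in> fst d" for t d
      using limv[OF Suc.prems, unfolded p, OF that] .
    have eq: "velocity {0..?b} x ?b d = velocity {?b..?e} x ?b d" if d: "d \<in> A" "x ?b \<in> fst d" for d
      using LIMSEQ_unique[OF IH(2)[OF _ d] l2[OF _ d]] be by simp
    have gl1: "C1_curve_on A {0..?e} x" by (rule C1_curve_on_glue(1)[OF IH(1) x2 be eq])
    have gl2: "velocity {0..?e} x t d = velocity {0..?b} x t d" if "t \<in> {0..?b}" "d \<in> A" "x t \<in> fst d" for t d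
      by (rule C1_curve_on_glue(2)[OF IH(1) x2 be eq that])
    have gl3: "velocity {0..?e} x t d = velocity {?b..?e} x t d" if "t \<in> {?b..?e}" "d \<in> A" "x t \<in> fst d" for t d
      by (rule C1_curve_on_glue(3)[OF IH(1) x2 be eq that])
    have "(\<lambda>n. velocity {0..1} (\<sigma> n) t d) \<longlonglongrightarrow> velocity {0..?e} x t d"
      if t: "t \<in> {0..?e}" and d: "d \<in> A" "x t \<in> fst d" for t d
    proof (cases "t \<le> ?b")
      case True
      then have tb: "t \<in> {0..?b}" using t by simp
      show ?thesis using IH(2)[OF tb d] gl2[OF tb d] by simp
    next
      case False
      then have tb: "t \<in> {?b..?e}" using t by simp
      show ?thesis using l2[OF tb d] gl3[OF tb d] by simp
    qed
    then show ?case using gl1 by blast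
  qed
  have "real (N - 1) + 1 = real N" using N by simp
  then have "(real (N - 1) + 1) / real N = 1" using N by simp
  then have C1: "C1_curve_on A {0..1} x"
    and lv: "\<And>t d. t \<in> {0..1} \<Longrightarrow> d \<in> A \<Longrightarrow> x t \<in> fst d \<Longrightarrow> (\<lambda>n. velocity {0..1} (\<sigma> n) t d) \<longlonglongrightarrow> velocity {0..1} x t d"
    using glue[of "N - 1"] N by auto
  have "x \<in> extensional {0..1}" unfolding extensional_def x_def by auto
  moreover have "x ` piece j \<subseteq> cinv (c j) ` cball (y0 j) (r j)" if j: "j < N" for j
    using x[OF j] Yball[OF j] by auto
  ultimately have "x \<in> curves" using C1 by (simp add: curves_def C1_curves_def)
  moreover have "jet x p = G p" if "p \<in> idx" for p
  proof -
    obtain j t where j: "j < N" and t: "t \<in> piece j" and p: "p = (real j, t)" using \<open>p \<in> idx\<close> by (auto simp: idx_iff)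
    have "t \<in> {0..1}" using t piece_subset[OF j] by blast
    then have "velocity {0..1} x t (c j) = W j t"
      using LIMSEQ_unique[OF lv[OF _ chart_in[OF j] xc(1)[OF j t]] limW[OF j t]] by simp
    then show ?thesis using xc(2)[OF j t] by (simp add: p Y_def W_def prod_eq_iff)
  qed
  ultimately show ?thesis by blast
qed

section \<open>Compactness of equicontinuous families\<close>

definition equi_curves :: "real \<Rightarrow> (real \<Rightarrow> real) \<Rightarrow> (real \<Rightarrow> 'm) set" where
  "equi_curves B M = {x \<in> curves. (\<forall>p\<in>idx. norm (jet x p) \<le> B) \<and>
     (\<forall>\<eta>>0. \<forall>j<N. \<forall>s\<in>piece j. \<forall>t\<in>piece j. norm (jet x (real j, t) - jet x (real j, s)) \<le> \<eta> + M \<eta> * \<bar>t - s\<bar>)}"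

text \<open>Arzela-Ascoli for the jets on \<open>idx\<close> gives a uniform limit, and
  \<open>curves_limit\<close> shows that it is the jet of a curve. The modulus of continuity, one
  affine bound for every \<open>\<eta>\<close>, has the form delivered by the velocity estimate and
  passes to pointwise limits, as does the bound \<open>B\<close>.\<close>

lemma compactin_equi_curves:
  assumes M: "\<And>\<eta>. \<eta> > 0 \<Longrightarrow> M \<eta> \<ge> 0"
  shows "compactin (Metric_space.mtopology curves jet_dist) (equi_curves B M)"
proof -
  interpret X: Metric_space curves jet_dist by (rule Metric_space_curves)
  show ?thesis unfolding X.compactin_sequentially
  proof (intro conjI allI impI)
    show "equi_curves B M \<subseteq> curves" by (auto simp: equi_curves_def)
    fix \<sigma> :: "nat \<Rightarrow> real \<Rightarrow> 'm" assume "range \<sigma> \<subseteq> equi_curves B M"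
    then have s: "\<sigma> n \<in> equi_curves B M" for n by blast
    have sc: "\<sigma> n \<in> curves" and sB: "\<And>p. p \<in> idx \<Longrightarrow> norm (jet (\<sigma> n) p) \<le> B"
      and sM: "\<And>\<eta> j s t. \<eta> > 0 \<Longrightarrow> j < N \<Longrightarrow> s \<in> piece j \<Longrightarrow> t \<in> piece j \<Longrightarrow>
        norm (jet (\<sigma> n) (real j, t) - jet (\<sigma> n) (real j, s)) \<le> \<eta> + M \<eta> * \<bar>t - s\<bar>" for n
      using s[of n] unfolding equi_curves_def by blast+
    have equi: "\<exists>d. 0 < d \<and> (\<forall>n p'. p' \<in> idx \<and> norm (p - p') < d \<longrightarrow> norm (jet (\<sigma> n) p - jet (\<sigma> n) p') < e)"
      if p: "p \<in> idx" and e: "0 < e" for p e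
    proof -
      \<comment> \<open>The bound 1 forces nearby points of \<open>idx\<close> to have the same
        piece number; the other bound makes the Lipschitz part at most \<open>e / 4\<close>.\<close>
      define d where "d = min 1 (e / (4 * (M (e/2) + 1)))"
      have M0: "M (e/2) \<ge> 0" using M e by simp
      then have d: "d > 0" "d \<le> 1" "d \<le> e / (4 * (M (e/2) + 1))" using e by (auto simp: d_def)
      have "norm (jet (\<sigma> n) p - jet (\<sigma> n) p') < e" if p': "p' \<in> idx" "norm (p - p') < d" for n p'
      proof -
        obtain j t where j: "j < N" "t \<in> piece j" "p = (real j, t)" using p by (auto simp: idx_iff)
        obtain j' t' where j': "j' < N" "t' \<in> piece j'" "p' = (real j', t')" using p'(1) by (auto simp: idx_iff)
        have "norm (fst (p - p')) \<le> norm (p - p')" "norm (snd (p - p')) \<le> norm (p - p')"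
          by (metis norm_fst_le norm_snd_le prod.collapse)+
        then have "\<bar>real j - real j'\<bar> < 1" and tt: "\<bar>t - t'\<bar> \<le> d" using p'(2) d by (auto simp: j j')
        then have jj: "j' = j" by linarith
        have "norm (jet (\<sigma> n) p - jet (\<sigma> n) p') \<le> e/2 + M (e/2) * \<bar>t - t'\<bar>"
          using sM[of "e/2" j t' t n] e j j' jj by simp
        also have "M (e/2) * \<bar>t - t'\<bar> \<le> (M (e/2) + 1) * (e / (4 * (M (e/2) + 1)))"
          using M0 tt d by (intro mult_mono) auto
        also have "\<dots> = e / 4" using M0 by (simp add: field_simps)
        finally show ?thesis using e by simp
      qed
      then show ?thesis using d(1) by blast
    qed
    obtain G k where G: "continuous_on idx G" and k: "strict_mono (k :: nat \<Rightarrow> nat)"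
      and conv: "\<And>e. 0 < e \<Longrightarrow> \<exists>n0. \<forall>n p. n \<ge> n0 \<and> p \<in> idx \<longrightarrow> norm (jet (\<sigma> (k n)) p - G p) < e"
      using Arzela_Ascoli[OF compact_idx, of "\<lambda>n. jet (\<sigma> n)" B, OF sB equi] by blast
    have conv': "\<exists>n0. \<forall>n\<ge>n0. \<forall>p\<in>idx. norm (jet (\<sigma> (k n)) p - G p) < e" if "e > 0" for e
      using conv[OF that] by blast
    obtain x where x: "x \<in> curves" "\<And>p. p \<in> idx \<Longrightarrow> jet x p = G p"
      using curves_limit[of "\<lambda>n. \<sigma> (k n)", OF sc G conv'] by blast
    have lim: "(\<lambda>n. jet (\<sigma> (k n)) p) \<longlonglongrightarrow> jet x p" if "p \<in> idx" for p
      using conv' that unfolding LIMSEQ_iff x(2)[OF that] by meson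
    have inD: "(real j, t) \<in> idx" if "j < N" "t \<in> piece j" for j t using that by (auto simp: idx_iff)
    have "x \<in> equi_curves B M" unfolding equi_curves_def
    proof (intro CollectI conjI ballI allI impI)
      show "norm (jet x p) \<le> B" if p: "p \<in> idx" for p
        by (rule LIMSEQ_le_const2[OF tendsto_norm[OF lim[OF p]]]) (use sB p in blast)
      show "norm (jet x (real j, t) - jet x (real j, s)) \<le> \<eta> + M \<eta> * \<bar>t - s\<bar>"
        if h: "0 < \<eta>" "j < N" "s \<in> piece j" "t \<in> piece j" for \<eta> j s t
        by (rule LIMSEQ_le_const2[OF tendsto_norm[OF tendsto_diff[OF lim[OF inD[OF h(2,4)]] lim[OF inD[OF h(2,3)]]]]])
          (use sM[OF h] in blast)
    qed (rule x(1))
    moreover have "limitin X.mtopology (\<sigma> \<circ> k) x sequentially"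
      unfolding X.limit_metric_sequentially
    proof (intro conjI allI impI)
      show "x \<in> curves" by (rule x(1))
      fix e :: real assume e: "e > 0"
      then obtain n0 where n0: "\<And>n p. n \<ge> n0 \<Longrightarrow> p \<in> idx \<Longrightarrow> norm (jet (\<sigma> (k n)) p - G p) < e/2"
        using conv'[of "e/2"] by auto
      have "jet_dist ((\<sigma> \<circ> k) n) x \<le> e/2" if n: "n \<ge> n0" for n
        by (rule jet_dist_least) (use sc x n0[OF n] in \<open>auto intro: less_imp_le\<close>)
      then show "\<exists>n0. \<forall>n\<ge>n0. (\<sigma> \<circ> k) n \<in> curves \<and> jet_dist ((\<sigma> \<circ> k) n) x < e"
        using sc e by (intro exI[of _ n0]) fastforce
    qed
    ultimately show "\<exists>l h. l \<in> equi_curves B M \<and> strict_mono h \<and> limitin X.mtopology (\<sigma> \<circ> h) l sequentially"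
      using k by blast
  qed
qed

text \<open>The set \<open>K\<close> may meet several pieces, and \<open>d\<close> need not be one
  of their charts. If no ball fits, curves \<open>z n\<close> tending to \<open>y\<close> violate
  the conditions at times \<open>t n\<close>; compactness yields a limit time in one piece, and
  \<open>chart_limit\<close> turns convergence of jets into convergence in \<open>d\<close>, against
  the strict inequalities for \<open>y\<close>.\<close>

lemma C1_nbhd_contains_ball:
  assumes x0: "x0 \<in> C1_curves A" and d: "d \<in> A" and K: "compact K" "K \<subseteq> {0..1}" "x0 ` K \<subseteq> fst d"
    and y: "y \<in> C1_nbhd A x0 d K e" "y \<in> curves"
  shows "\<exists>\<delta>>0. \<forall>z\<in>curves. jet_dist y z < \<delta> \<longrightarrow> z \<in> C1_nbhd A x0 d K e"
proof (rule ccontr)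
  assume neg: "\<not> ?thesis"
  let ?bad = "\<lambda>z t. \<not> (z t \<in> fst d \<and> norm (snd d (z t) - snd d (x0 t)) < e \<and>
      norm (velocity {0..1} z t d - velocity {0..1} x0 t d) < e)"
  have "\<exists>z j t. z \<in> curves \<and> jet_dist y z < 1 / real (Suc n) \<and> t \<in> K \<and> j < N \<and> t \<in> piece j \<and> ?bad z t" for n
  proof -
    obtain z where z: "z \<in> curves" "jet_dist y z < 1 / real (Suc n)" "z \<notin> C1_nbhd A x0 d K e"
      using neg by (metis of_nat_0_less_iff zero_less_Suc zero_less_divide_1_iff)
    have "z \<in> C1_curves A" using z(1) by (simp add: curves_def)
    then obtain t where t: "t \<in> K" "?bad z t" using z(3) unfolding C1_nbhd_def by blast
    moreover obtain j where "j < N" "t \<in> piece j" using piece_cover K(2) t(1) by blast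
    ultimately show ?thesis using z by blast
  qed
  then obtain z j t where z: "\<And>n. z n \<in> curves" "\<And>n. jet_dist y (z n) < 1 / real (Suc n)"
    and t: "\<And>n. t n \<in> K" "\<And>n. j n < N" "\<And>n. t n \<in> piece (j n)" and bad: "\<And>n. ?bad (z n) (t n)"
    by metis
  have "compact (idx \<inter> UNIV \<times> K)"
    by (intro compact_Int_closed compact_idx closed_Times closed_UNIV compact_imp_closed K(1))
  moreover have "(real (j n), t n) \<in> idx \<inter> UNIV \<times> K" for n using t[of n] by (auto simp: idx_iff)
  ultimately obtain p h where p: "p \<in> idx \<inter> UNIV \<times> K" "strict_mono (h :: nat \<Rightarrow> nat)"
    "((\<lambda>n. (real (j n), t n)) \<circ> h) \<longlonglongrightarrow> p" unfolding compact_def by meson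
  then obtain i s where i: "i < N" "s \<in> piece i" "p = (real i, s)" "s \<in> K" by (auto simp: idx_iff)
  have lj: "(\<lambda>n. real (j (h n))) \<longlonglongrightarrow> real i" using tendsto_fst[OF p(3)] by (simp add: i o_def)
  have lt: "(\<lambda>n. t (h n)) \<longlonglongrightarrow> s" using tendsto_snd[OF p(3)] by (simp add: i o_def)
  \<comment> \<open>A convergent sequence of integers is eventually constant, so from
    \<open>n1\<close> on all violations along the subsequence lie in the piece
    \<open>i\<close>.\<close>
  obtain n1 where n1: "\<And>n. n \<ge> n1 \<Longrightarrow> norm (real (j (h n)) - real i) < 1"
    using lj unfolding LIMSEQ_iff by (metis zero_less_one)
  have ji: "j (h (n + n1)) = i" for n using n1[of "n + n1"] by simp
  define Z where "Z n = z (h (n + n1))" for n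
  define \<theta> where "\<theta> n = t (h (n + n1))" for n
  have Zc: "Z n \<in> curves" for n using z by (simp add: Z_def)
  have \<theta>: "\<theta> n \<in> piece i" "\<theta> n \<in> K" "\<theta> n \<in> {0..1}" for n
    using t(3)[of "h (n + n1)"] t(1)[of "h (n + n1)"] ji[of n] K(2) by (auto simp: \<theta>_def)
  have l\<theta>: "\<theta> \<longlonglongrightarrow> s" unfolding \<theta>_def using LIMSEQ_ignore_initial_segment[OF lt] .
  have inD: "(real i, \<theta> n) \<in> idx" for n using \<theta> i by (auto simp: idx_iff)
  have ld: "(\<lambda>n. jet (Z n) (real i, \<theta> n) - jet y (real i, \<theta> n)) \<longlonglongrightarrow> 0"
  proof (rule Lim_null_comparison)
    have "norm (jet (Z n) (real i, \<theta> n) - jet y (real i, \<theta> n)) \<le> 1 / real (Suc n)" for n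
    proof -
      have "norm (jet (Z n) (real i, \<theta> n) - jet y (real i, \<theta> n)) \<le> jet_dist y (Z n)"
        using jet_dist_upper[OF y(2) Zc inD] by (simp only: norm_minus_commute)
      also have "\<dots> \<le> 1 / real (Suc (h (n + n1)))" using z(2)[of "h (n + n1)"] by (simp add: Z_def)
      also have "\<dots> \<le> 1 / real (Suc n)" using seq_suble[OF p(2), of "n + n1"] by (intro divide_left_mono) auto
      finally show ?thesis .
    qed
    then show "\<forall>\<^sub>F n in sequentially. norm (jet (Z n) (real i, \<theta> n) - jet y (real i, \<theta> n)) \<le> 1 / real (Suc n)" by simp
    show "(\<lambda>n. 1 / real (Suc n)) \<longlonglongrightarrow> 0" by (rule LIMSEQ_Suc[OF lim_1_over_n])
  qed
  have ly: "(\<lambda>n. jet y (real i, \<theta> n)) \<longlonglongrightarrow> jet y (real i, s)"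
    using continuous_on_tendsto_compose[OF continuous_on_jet[OF y(2)] tendsto_Pair[OF tendsto_const l\<theta>], of "real i"]
      inD i by (auto simp: idx_iff)
  have lJ: "(\<lambda>n. jet (Z n) (real i, \<theta> n)) \<longlonglongrightarrow> jet y (real i, s)"
    using tendsto_add[OF ld ly] by (simp del: jet_eq)
  have lY: "(\<lambda>n. snd (c i) (Z n (\<theta> n))) \<longlonglongrightarrow> snd (c i) (y s)" using tendsto_fst[OF lJ] by simp
  have lW: "(\<lambda>n. velocity {0..1} (Z n) (\<theta> n) (c i)) \<longlonglongrightarrow> velocity {0..1} y s (c i)" using tendsto_snd[OF lJ] by simp
  have ci: "c i \<in> A" by (rule chart_in[OF i(1)])
  have ys: "y s \<in> fst (c i)" by (rule curves_piece(1)[OF y(2) i(1,2)])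
  have s01: "s \<in> {0..1}" using i(4) K(2) by blast
  have yd: "y s \<in> fst d" "norm (snd d (y s) - snd d (x0 s)) < e" "norm (velocity {0..1} y s d - velocity {0..1} x0 s d) < e"
    using y(1) i(4) by (auto simp: C1_nbhd_def)
  have yinv: "cinv (c i) (snd (c i) (y s)) = y s" by (rule cinv_snd[OF ci ys])
  note cl = chart_limit[OF ci d curves_piece(1)[OF Zc i(1) \<theta>(1)] imageI[OF ys] lY lW, unfolded yinv]
  have ev: "\<forall>\<^sub>F n in sequentially. Z n (\<theta> n) \<in> fst d" by (rule cl(2)[OF yd(1)])
  have l1: "(\<lambda>n. snd d (Z n (\<theta> n))) \<longlonglongrightarrow> snd d (y s)" by (rule cl(3)[OF yd(1)])
  have "velocity {0..1} y s d = Dtr (c i) d (snd (c i) (y s)) (velocity {0..1} y s (c i))"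
    using velocity_transition[OF curves_C1[OF y(2)] s01 _ ci ys d yd(1)] by simp
  moreover have "\<forall>\<^sub>F n in sequentially. Dtr (c i) d (snd (c i) (Z n (\<theta> n))) (velocity {0..1} (Z n) (\<theta> n) (c i)) = velocity {0..1} (Z n) (\<theta> n) d"
    using ev by (rule eventually_mono)
      (use velocity_transition[OF curves_C1[OF Zc] \<theta>(3) _ ci curves_piece(1)[OF Zc i(1) \<theta>(1)] d] in simp)
  ultimately have l2: "(\<lambda>n. velocity {0..1} (Z n) (\<theta> n) d) \<longlonglongrightarrow> velocity {0..1} y s d"
    using Lim_transform_eventually[OF cl(4)[OF yd(1)]] by simp
  have x0C: "C1_curve_on A {0..1} x0" using x0 by (simp add: C1_curves_def)
  note co = continuous_on_coords[OF x0C d K(2,3)]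
  have m1: "(\<lambda>n. snd d (x0 (\<theta> n))) \<longlonglongrightarrow> snd d (x0 s)"
    by (rule continuous_on_tendsto_compose[OF co(1) l\<theta> i(4)]) (simp add: \<theta>(2))
  have m2: "(\<lambda>n. velocity {0..1} x0 (\<theta> n) d) \<longlonglongrightarrow> velocity {0..1} x0 s d"
    by (rule continuous_on_tendsto_compose[OF co(2) l\<theta> i(4)]) (simp add: \<theta>(2))
  have "\<forall>\<^sub>F n in sequentially. norm (snd d (Z n (\<theta> n)) - snd d (x0 (\<theta> n))) < e"
    using order_tendstoD(2)[OF tendsto_norm[OF tendsto_diff[OF l1 m1]] yd(2)] .
  moreover have "\<forall>\<^sub>F n in sequentially. norm (velocity {0..1} (Z n) (\<theta> n) d - velocity {0..1} x0 (\<theta> n) d) < e"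
    using order_tendstoD(2)[OF tendsto_norm[OF tendsto_diff[OF l2 m2]] yd(3)] .
  ultimately have "\<forall>\<^sub>F n in sequentially. \<not> ?bad (Z n) (\<theta> n)" using ev by eventually_elim simp
  then obtain n where "\<not> ?bad (Z n) (\<theta> n)" unfolding eventually_sequentially by blast
  then show False using bad[of "h (n + n1)"] unfolding Z_def \<theta>_def by blast
qed

lemma continuous_map_curves_C1:
  "continuous_map (Metric_space.mtopology curves jet_dist) (C1_topology A) (\<lambda>x. x)"
proof -
  interpret X: Metric_space curves jet_dist by (rule Metric_space_curves)
  show ?thesis unfolding C1_topology_def
  proof (rule continuous_on_generated_topo)
    fix U assume "U \<in> {C1_nbhd A x c K e | x c K e.
        x \<in> C1_curves A \<and> c \<in> A \<and> compact K \<and> K \<subseteq> {0..1} \<and> x ` K \<subseteq> fst c \<and> e > 0}"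
    then obtain x0 d K e where U: "U = C1_nbhd A x0 d K e" "x0 \<in> C1_curves A" "d \<in> A" "compact K" "K \<subseteq> {0..1}" "x0 ` K \<subseteq> fst d"
      by blast
    show "openin X.mtopology ((\<lambda>x. x) -` U \<inter> topspace X.mtopology)"
      unfolding X.openin_mtopology
    proof (intro conjI allI impI)
      fix y assume "y \<in> (\<lambda>x. x) -` U \<inter> topspace X.mtopology"
      then have y: "y \<in> U" "y \<in> curves" by auto
      obtain \<delta> where "\<delta> > 0" "\<And>z. z \<in> curves \<Longrightarrow> jet_dist y z < \<delta> \<Longrightarrow> z \<in> U"
        using C1_nbhd_contains_ball[OF U(2-6), of y e] y unfolding U(1) by blast
      then show "\<exists>r>0. X.mball y r \<subseteq> (\<lambda>x. x) -` U \<inter> topspace X.mtopology"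
        by (intro exI[of _ \<delta>]) auto
    qed auto
  next
    show "(\<lambda>x. x) ` topspace X.mtopology \<subseteq> \<Union> {C1_nbhd A x c K e | x c K e.
        x \<in> C1_curves A \<and> c \<in> A \<and> compact K \<and> K \<subseteq> {0..1} \<and> x ` K \<subseteq> fst c \<and> e > 0}"
    proof -
      have "curves \<subseteq> C1_curves A" by (auto simp: curves_def)
      then show ?thesis
        using topspace_C1_topology unfolding C1_topology_def topology_generated_by_topspace X.topspace_mtopology by simp
    qed
  qed
qed

lemma compactin_C1_equi_curves:
  assumes "\<And>\<eta>. \<eta> > 0 \<Longrightarrow> M \<eta> \<ge> 0"
  shows "compactin (C1_topology A) (equi_curves B M)"
  using image_compactin[OF compactin_equi_curves[OF assms] continuous_map_curves_C1] by simp

end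

section \<open>Weak properness\<close>

text \<open>The velocity estimates for the single pieces, each of length \<open>1 / real N\<close>,
  are merged into one bound and one modulus for the jets. The coordinates lie in balls and are
  Lipschitz with the velocity bound as constant.\<close>

lemma (in itinerary) bounded_energy_compact:
  "\<exists>Z. compactin (C1_topology A) Z \<and>
     {x \<in> H2_curves A. integral {0..1} (energy1 x) \<le> E \<and> integral {0..1} (energy2 x) \<le> E \<and>
        (\<forall>j<N. x ` piece j \<subseteq> cinv (c j) ` cball (y0 j) (r j))} \<subseteq> Z"
proof -
  define P where "P j V \<eta> M \<longleftrightarrow> (\<forall>x a b. x \<in> H2_curves A \<and> integral {0..1} (energy1 x) \<le> E \<and> integral {0..1} (energy2 x) \<le> E \<and>
     0 \<le> a \<and> b \<le> 1 \<and> b - a = 1 / real N \<and> x ` {a..b} \<subseteq> cinv (c j) ` cball (y0 j) (r j) \<longrightarrow>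
     (\<forall>t\<in>{a..b}. norm (velocity {0..1} x t (c j)) \<le> V) \<and>
     (\<forall>s\<in>{a..b}. \<forall>t\<in>{a..b}. norm (velocity {0..1} x t (c j) - velocity {0..1} x s (c j)) \<le> \<eta> + M * \<bar>t - s\<bar>))"
    for j V \<eta> M
  have "\<forall>j. \<exists>V. j < N \<longrightarrow> (\<forall>\<eta>>0. \<exists>M\<ge>0. P j V \<eta> M)"
    unfolding P_def using H2_velocity_estimate[OF cb, of _ "1 / real N" E] N by simp
  then obtain V where V: "\<And>j \<eta>. j < N \<Longrightarrow> \<eta> > 0 \<Longrightarrow> \<exists>M\<ge>0. P j (V j) \<eta> M" by metis
  then have "\<forall>j \<eta>. \<exists>M. j < N \<longrightarrow> \<eta> > 0 \<longrightarrow> M \<ge> 0 \<and> P j (V j) \<eta> M" by blast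
  then obtain m where m0: "\<And>j \<eta>. j < N \<Longrightarrow> \<eta> > 0 \<Longrightarrow> m j \<eta> \<ge> 0"
    and m: "\<And>j \<eta>. j < N \<Longrightarrow> \<eta> > 0 \<Longrightarrow> P j (V j) \<eta> (m j \<eta>)" by metis
  \<comment> \<open>Sums over the pieces dominate the constants of every single piece.\<close>
  define B where "B = (\<Sum>j<N. norm (y0 j) + \<bar>r j\<bar> + \<bar>V j\<bar>)"
  define M where "M \<eta> = (\<Sum>j<N. \<bar>m j \<eta>\<bar> + \<bar>V j\<bar>)" for \<eta>
  have BJ: "norm (y0 j) + \<bar>r j\<bar> + \<bar>V j\<bar> \<le> B" if "j < N" for j
    unfolding B_def using that by (intro member_le_sum) auto
  have MJ: "\<bar>m j \<eta>\<bar> + \<bar>V j\<bar> \<le> M \<eta>" if "j < N" for j \<eta>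
    unfolding M_def using that by (intro member_le_sum) auto
  have M0: "M \<eta> \<ge> 0" for \<eta> unfolding M_def by (intro sum_nonneg) auto
  have "x \<in> equi_curves B M"
    if x: "x \<in> H2_curves A" and E1: "integral {0..1} (energy1 x) \<le> E" and E2: "integral {0..1} (energy2 x) \<le> E"
      and px: "\<And>j. j < N \<Longrightarrow> x ` piece j \<subseteq> cinv (c j) ` cball (y0 j) (r j)" for x
  proof -
    have xc: "x \<in> curves" using x px by (auto simp: curves_def H2_curves_def)
    have len: "(real j + 1) / real N - real j / real N = 1 / real N" for j
      by (simp add: diff_divide_distrib[symmetric])
    have est: "(\<forall>t\<in>piece j. norm (velocity {0..1} x t (c j)) \<le> V j) \<and>
       (\<forall>s\<in>piece j. \<forall>t\<in>piece j. norm (velocity {0..1} x t (c j) - velocity {0..1} x s (c j)) \<le> \<eta> + m j \<eta> * \<bar>t - s\<bar>)"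
      if j: "j < N" and \<eta>: "\<eta> > 0" for j \<eta>
    proof -
      have "0 \<le> real j / real N" "(real j + 1) / real N \<le> 1"
        using piece_subset[OF j] piece_less[of j] unfolding piece_def by auto
      then show ?thesis
        using m[OF j \<eta>, unfolded P_def] x E1 E2 len[of j] px[OF j] unfolding piece_def by blast
    qed
    have vb: "norm (velocity {0..1} x t (c j)) \<le> \<bar>V j\<bar>" if "j < N" "t \<in> piece j" for j t
      using est[OF that(1) zero_less_one] that(2) abs_ge_self[of "V j"] order_trans by blast
    have lip1: "norm (snd (c j) (x t) - snd (c j) (x s)) \<le> \<bar>V j\<bar> * (t - s)"
      if j: "j < N" and st: "s \<in> piece j" "t \<in> piece j" "s < t" for j s t
    proof -
      have sub: "{s..t} \<subseteq> piece j" using st by (auto simp: piece_def)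
      have sub': "x ` {s..t} \<subseteq> fst (c j)" using curves_piece(1)[OF xc j] sub by blast
      have sub01: "{s..t} \<subseteq> {0..1}" using sub piece_subset[OF j] by blast
      have "norm (snd (c j) (x t) - snd (c j) (x s)) \<le> \<bar>V j\<bar> * t - \<bar>V j\<bar> * s"
      proof (rule differentiable_bound_general[OF st(3)])
        show "continuous_on {s..t} (\<lambda>u. snd (c j) (x u))"
          by (rule continuous_on_coords(1)[OF curves_C1[OF xc] chart_in[OF j] sub01 sub'])
        show "continuous_on {s..t} (\<lambda>u. \<bar>V j\<bar> * u)" by (intro continuous_intros)
        fix u assume u: "s < u" "u < t"
        have up: "u \<in> piece j" using u sub by auto
        have u01: "0 < u" "u < 1" "u \<in> {0..1}" using u sub01 by auto
        have "((snd (c j) \<circ> x) has_vector_derivative velocity {0..1} x u (c j)) (at u within {0..1})"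
          by (rule C1_curve_on_velocity[OF curves_C1[OF xc] u01(3) chart_in[OF j] curves_piece(1)[OF xc j up]])
        from has_vector_derivative_at_within_Icc[OF this u01(1,2)]
        show "((\<lambda>u. snd (c j) (x u)) has_vector_derivative velocity {0..1} x u (c j)) (at u)" by (simp add: o_def)
        show "((\<lambda>u. \<bar>V j\<bar> * u) has_vector_derivative \<bar>V j\<bar>) (at u)"
          by (auto intro!: derivative_eq_intros)
        show "norm (velocity {0..1} x u (c j)) \<le> \<bar>V j\<bar>" by (rule vb[OF j up])
      qed
      then show ?thesis by (simp add: right_diff_distrib)
    qed
    have lip: "norm (snd (c j) (x t) - snd (c j) (x s)) \<le> \<bar>V j\<bar> * \<bar>t - s\<bar>"
      if j: "j < N" and st: "s \<in> piece j" "t \<in> piece j" for j s t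
      using lip1[OF j st] lip1[OF j st(2,1)] by (cases s t rule: linorder_cases) (auto simp: norm_minus_commute)
    show ?thesis unfolding equi_curves_def
    proof (intro CollectI conjI ballI allI impI)
      fix p assume "p \<in> idx"
      then obtain j t where j: "j < N" "t \<in> piece j" "p = (real j, t)" by (auto simp: idx_iff)
      have "norm (snd (c j) (x t)) \<le> norm (y0 j) + norm (snd (c j) (x t) - y0 j)"
        by (rule norm_triangle_sub)
      also have "norm (snd (c j) (x t) - y0 j) \<le> \<bar>r j\<bar>"
        using curves_piece(2)[OF xc j(1,2)] by (simp add: dist_norm norm_minus_commute)
      finally have "norm (snd (c j) (x t)) \<le> norm (y0 j) + \<bar>r j\<bar>" by simp
      moreover have "norm (jet x p) \<le> norm (snd (c j) (x t)) + norm (velocity {0..1} x t (c j))"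
        unfolding j(3) jet_eq by (rule norm_Pair_le)
      ultimately show "norm (jet x p) \<le> B" using vb[OF j(1,2)] BJ[OF j(1)] by linarith
    next
      fix \<eta> :: real and j s t assume h: "0 < \<eta>" "j < N" "s \<in> piece j" "t \<in> piece j"
      have "norm (jet x (real j, t) - jet x (real j, s)) \<le>
          norm (snd (c j) (x t) - snd (c j) (x s)) + norm (velocity {0..1} x t (c j) - velocity {0..1} x s (c j))"
        unfolding jet_eq diff_Pair by (rule norm_Pair_le)
      also have "\<dots> \<le> \<bar>V j\<bar> * \<bar>t - s\<bar> + (\<eta> + m j \<eta> * \<bar>t - s\<bar>)"
        using lip[OF h(2-4)] est[OF h(2,1)] h(3,4) by (intro add_mono) auto
      also have "\<dots> \<le> \<eta> + (\<bar>m j \<eta>\<bar> + \<bar>V j\<bar>) * \<bar>t - s\<bar>"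
        using m0[OF h(2,1)] by (simp add: distrib_right)
      also have "\<dots> \<le> \<eta> + M \<eta> * \<bar>t - s\<bar>" using MJ[OF h(2)] by (intro add_left_mono mult_right_mono) auto
      finally show "norm (jet x (real j, t) - jet x (real j, s)) \<le> \<eta> + M \<eta> * \<bar>t - s\<bar>" .
    qed (rule xc)
  qed
  then show ?thesis using compactin_C1_equi_curves[of M B, OF M0] by (intro exI[of _ "equi_curves B M"]) blast
qed

context riemannian
begin

section \<open>Equicontinuity in the Riemannian distance\<close>

lemma H2_curve_joined:
  assumes x: "x \<in> H2_curves A" and E: "integral {0..1} (energy1 x) \<le> E" and st: "0 \<le> s" "s < t" "t \<le> 1" and \<eta>: "\<eta> > 0"
  shows "\<exists>k \<le> \<eta> * E + (t - s) / (4 * \<eta>). joined (x s) (x t) k"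
proof -
  have x': "C1_curve_on A {s..t} x" by (rule C1_curve_on_subinterval(1)[OF H2_C1[OF x] st])
  let ?\<sigma> = "\<lambda>u. sqrt (sq_norm A g (x u) (velocity {s..t} x u))"
  have e1: "energy1 x integrable_on {s..t}"
    using integrable_on_subinterval[OF energy1_integrable[OF x]] st by auto
  have "((\<lambda>u. \<eta> * energy1 x u + 1 / (4 * \<eta>)) has_integral (\<eta> * integral {s..t} (energy1 x) + (t - s) * (1 / (4 * \<eta>)))) {s..t}"
    using has_integral_const_real[of "1 / (4 * \<eta>)" s t] st(2)
    by (intro has_integral_add has_integral_mult_right integrable_integral e1) simp
  moreover have "?\<sigma> u \<le> \<eta> * energy1 x u + 1 / (4 * \<eta>)" if u: "u \<in> {s..t}" for u
  proof -
    have "sq_norm A g (x u) (velocity {s..t} x u) = energy1 x u"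
      unfolding sq_norm_def Let_def using C1_curve_on_subinterval(2)[OF H2_C1[OF x] st u chart_at] by simp
    then have eq: "?\<sigma> u = sqrt (energy1 x u)" by simp
    \<comment> \<open>Young's inequality again: the speed is at most \<open>\<eta>\<close> times its
      square plus \<open>1 / (4 * \<eta>)\<close>, so a bound on the energy controls the length of
      the arc.\<close>
    have "(2 * \<eta> * sqrt (energy1 x u) - 1)\<^sup>2 / (4 * \<eta>) \<ge> 0" using \<eta> by simp
    also have "(2 * \<eta> * sqrt (energy1 x u) - 1)\<^sup>2 / (4 * \<eta>) = \<eta> * (sqrt (energy1 x u))\<^sup>2 + 1 / (4 * \<eta>) - sqrt (energy1 x u)"
      using \<eta> by (simp add: power2_diff power_mult_distrib field_simps power2_eq_square[of \<eta>])
    finally show ?thesis unfolding eq by (simp add: sq_norm_nonneg)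
  qed
  moreover have "(?\<sigma> has_integral integral {s..t} ?\<sigma>) {s..t}"
    by (intro integrable_integral integrable_continuous_real continuous_on_real_sqrt continuous_on_sq_norm_velocity x' st(2))
  ultimately have "integral {s..t} ?\<sigma> \<le> \<eta> * integral {s..t} (energy1 x) + (t - s) * (1 / (4 * \<eta>))"
    by (meson has_integral_le)
  also have "integral {s..t} (energy1 x) \<le> E"
    using integral_subinterval_le[OF energy1_integrable[OF x] sq_norm_nonneg, of s t] st E by linarith
  finally have "integral {s..t} ?\<sigma> \<le> \<eta> * E + (t - s) / (4 * \<eta>)" using \<eta> by simp
  moreover have "integral {s..t} (spd x) = integral {s..t} ?\<sigma>"
    by (rule integral_unique[OF spd_has_integral_velocity[OF x' st(2)]])
  ultimately show ?thesis using joined.arc[OF st(2) x'] by auto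
qed

lemma H2_curve_rdist:
  assumes x: "x \<in> H2_curves A" and E: "integral {0..1} (energy1 x) \<le> E" "E \<ge> 0"
    and st: "s \<in> {0..1}" "t \<in> {0..1}" and \<eta>: "\<eta> > 0"
  shows "\<exists>k. joined (x s) (x t) k" "rdist (x s) (x t) \<le> \<eta> * E + \<bar>t - s\<bar> / (4 * \<eta>)"
proof -
  have "\<exists>k \<le> \<eta> * E + \<bar>t - s\<bar> / (4 * \<eta>). joined (x s) (x t) k"
  proof (cases s t rule: linorder_cases)
    case less
    then show ?thesis using H2_curve_joined[OF x E(1) _ less _ \<eta>] st by auto
  next
    case equal
    then show ?thesis using joined_refl \<eta> E(2) by (intro exI[of _ 0]) auto
  next
    case greater
    then show ?thesis using H2_curve_joined[OF x E(1) _ greater _ \<eta>] st joined_sym by fastforce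
  qed
  then show "\<exists>k. joined (x s) (x t) k" "rdist (x s) (x t) \<le> \<eta> * E + \<bar>t - s\<bar> / (4 * \<eta>)"
    using rdist_le order_trans by blast+
qed

lemma bounded_tension_energy_compact:
  assumes complete: "riem_complete A g" and \<tau>: "\<tau> \<noteq> 0" and t0: "t0 \<in> {0..1}"
    and U: "\<And>x. x \<in> U \<Longrightarrow> x \<in> H2_curves A \<and> x t0 = b \<and> tension_energy A g \<tau> x \<le> C"
  shows "\<exists>Z. compactin (C1_topology A) Z \<and> U \<subseteq> Z"
proof -
  interpret X: Metric_space "component b" rdist by (rule Metric_space_component)
  \<comment> \<open>One bound for both energies; the 1 makes it positive, so that it can serve as a
    divisor below.\<close>
  define E where "E = max 1 (max (2 * C / \<tau>\<^sup>2) (2 * C))"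
  have E: "E > 0" by (simp add: E_def)
  have UE: "integral {0..1} (energy1 x) \<le> E" "integral {0..1} (energy2 x) \<le> E" if "x \<in> U" for x
    using energy_bounds[of x \<tau> C] U[OF that] \<tau> by (auto simp: E_def)
  have Uc: "x s \<in> component b" if "x \<in> U" "s \<in> {0..1}" for x s
    using H2_curve_rdist(1)[of x E t0 s 1] U[OF that(1)] UE[OF that(1)] E t0 that(2) by (auto simp: component_def)
  have bb: "b \<in> component b" using joined_refl by (auto simp: component_def)
  \<comment> \<open>The radius is the distance estimate with \<open>\<eta> = 1\<close> and a time
    difference of at most 1, starting at \<open>b\<close>.\<close>
  define K where "K = X.mcball b (E + 1/4)"
  have UK: "x s \<in> K" if x: "x \<in> U" "s \<in> {0..1}" for x s
  proof -
    have "rdist (x t0) (x s) \<le> 1 * E + \<bar>s - t0\<bar> / (4 * 1)"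
      using H2_curve_rdist(2)[of x E t0 s 1] U[OF x(1)] UE[OF x(1)] E t0 x(2) by auto
    moreover have "\<bar>s - t0\<bar> \<le> 1" using t0 x(2) by auto
    ultimately show ?thesis using U[OF x(1)] Uc[OF x] bb by (auto simp: K_def)
  qed
  have K: "compactin X.mtopology K" unfolding K_def by (rule compactin_rdist_ball[OF complete bb])
  obtain r where r: "\<And>q. coord_ball (chart_at A q) (snd (chart_at A q) q) (r q)"
    using coord_ball_exists[OF chart_at] by metis
  obtain l where l: "\<And>q. lower_bound (chart_at A q) (snd (chart_at A q) q) (r q) (l q)"
    using lower_bound_exists[OF r] by metis
  \<comment> \<open>Half of the distance \<open>l q * r q\<close> below which a point is in the
    coordinate ball of \<open>q\<close>: one half for the start of a piece, the other for the motion
    during the piece.\<close>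
  define \<rho> where "\<rho> q = l q * r q / 2" for q
  have \<rho>: "\<rho> q > 0" for q using r[of q] l[of q] by (simp add: \<rho>_def coord_ball_def lower_bound_def)
  have KM: "K \<subseteq> component b" by (auto simp: K_def)
  have "\<exists>F. finite F \<and> F \<subseteq> (\<lambda>q. X.mball q (\<rho> q)) ` K \<and> K \<subseteq> \<Union>F"
    by (rule compactinD[OF K]) (use \<rho> KM in auto)
  then obtain F where F: "finite F" "F \<subseteq> K" "K \<subseteq> (\<Union>q\<in>F. X.mball q (\<rho> q))"
    by (metis (no_types, lifting) finite_subset_image)
  have "b \<in> K" using bb E by (simp add: K_def)
  then have Fne: "F \<noteq> {}" using F(3) by blast
  define \<delta> where "\<delta> = Min (\<rho> ` F)"
  have \<delta>: "\<delta> > 0" using F(1) Fne \<rho> by (simp add: \<delta>_def)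
  have \<delta>\<rho>: "\<delta> \<le> \<rho> q" if "q \<in> F" for q unfolding \<delta>_def using F(1) that by simp
  \<comment> \<open>Then \<open>\<eta> * E\<close> is \<open>\<delta> / 4\<close>, and pieces of
    length at most \<open>\<delta> * \<eta>\<close> contribute another \<open>\<delta> / 4\<close>,
    so a curve moves by less than \<open>\<delta>\<close> during each piece.\<close>
  define \<eta> where "\<eta> = \<delta> / (4 * E)"
  have \<eta>: "\<eta> > 0" using \<delta> E by (simp add: \<eta>_def)
  define N where "N = nat \<lceil>1 / (\<delta> * \<eta>)\<rceil> + 1"
  have N: "N > 0" by (simp add: N_def)
  have "real N \<ge> 1 / (\<delta> * \<eta>)" unfolding N_def by linarith
  then have N\<delta>: "1 / real N \<le> \<delta> * \<eta>" using N \<delta> \<eta> by (simp add: field_simps)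
  have short: "rdist (x s) (x t) < \<delta>" if x: "x \<in> U" and st: "s \<in> {0..1}" "t \<in> {0..1}" "\<bar>t - s\<bar> \<le> 1 / real N" for x s t
  proof -
    have "rdist (x s) (x t) \<le> \<eta> * E + \<bar>t - s\<bar> / (4 * \<eta>)"
      using H2_curve_rdist(2)[OF _ _ _ st(1,2) \<eta>, of x E] U[OF x] UE[OF x] E by auto
    also have "\<dots> \<le> \<delta> / 4 + (\<delta> * \<eta>) / (4 * \<eta>)"
      using st(3) N\<delta> \<eta> E by (intro add_mono divide_right_mono) (auto simp: \<eta>_def)
    also have "\<dots> < \<delta>" using \<eta> \<delta> by simp
    finally show ?thesis .
  qed
  define seg where "seg j = {real j / real N .. (real j + 1) / real N}" for j
  define V where "V f = {x \<in> H2_curves A. integral {0..1} (energy1 x) \<le> E \<and> integral {0..1} (energy2 x) \<le> E \<and>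
      (\<forall>j<N. x ` seg j \<subseteq> cinv (chart_at A (f j)) ` cball (snd (chart_at A (f j)) (f j)) (r (f j)))}" for f
  have "\<exists>Z. compactin (C1_topology A) Z \<and> V f \<subseteq> Z" for f
  proof -
    interpret itinerary A g N "\<lambda>j. chart_at A (f j)" "\<lambda>j. snd (chart_at A (f j)) (f j)" "\<lambda>j. r (f j)"
      by unfold_locales (use N r in auto)
    show ?thesis using bounded_energy_compact[of E] unfolding V_def seg_def piece_def .
  qed
  then obtain Z where Z: "\<And>f. compactin (C1_topology A) (Z f)" "\<And>f. V f \<subseteq> Z f" by metis
  \<comment> \<open>Itineraries are taken as extensional functions, of which there are finitely
    many; this is why \<open>f\<close> is restricted below.\<close>
  let ?I = "{..<N} \<rightarrow>\<^sub>E F"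
  have "finite ?I" using F(1) by (intro finite_PiE) auto
  then have "compactin (C1_topology A) (\<Union>f\<in>?I. Z f)" using Z(1) by (intro compactin_Union) auto
  moreover have "U \<subseteq> (\<Union>f\<in>?I. Z f)"
  proof
    fix x assume x: "x \<in> U"
    have "\<exists>q\<in>F. x ` seg j \<subseteq> cinv (chart_at A q) ` cball (snd (chart_at A q) q) (r q)" if j: "j < N" for j
    proof -
      let ?s = "real j / real N"
      have jN: "real j + 1 \<le> real N" using j by linarith
      have s: "?s \<in> {0..1}" using jN N by simp
      have p01: "t \<in> {0..1}" and pd: "\<bar>t - ?s\<bar> \<le> 1 / real N" if "t \<in> seg j" for t
      proof -
        have t: "?s \<le> t" "t \<le> (real j + 1) / real N" using that by (auto simp: seg_def)
        have "(real j + 1) / real N \<le> 1" using jN N by simp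
        moreover have "0 \<le> ?s" by simp
        ultimately show "t \<in> {0..1}" using t by (meson atLeastAtMost_iff order_trans)
        show "\<bar>t - ?s\<bar> \<le> 1 / real N" using t by (simp add: add_divide_distrib)
      qed
      obtain q where q: "q \<in> F" "x ?s \<in> X.mball q (\<rho> q)" using F(3) UK[OF x s] by blast
      have qc: "q \<in> component b" using q(1) F(2) KM by blast
      have "x t \<in> cinv (chart_at A q) ` cball (snd (chart_at A q) q) (r q)" if t: "t \<in> seg j" for t
      proof (rule rdist_ball_subset_coord_ball[OF r l chart_at(2) qc Uc[OF x p01[OF t]]])
        have "rdist q (x t) \<le> rdist q (x ?s) + rdist (x ?s) (x t)"
          using Uc[OF x s] Uc[OF x p01[OF t]] qc by (intro X.triangle)
        also have "\<dots> < \<rho> q + \<delta>" using q(2) short[OF x s p01[OF t] pd[OF t]] by (intro add_strict_mono) auto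
        also have "\<dots> \<le> l q * r q" using \<delta>\<rho>[OF q(1)] by (simp add: \<rho>_def)
        finally show "rdist q (x t) < l q * r q" .
      qed
      then show ?thesis using q(1) by blast
    qed
    then obtain f where f: "\<And>j. j < N \<Longrightarrow> f j \<in> F \<and> x ` seg j \<subseteq> cinv (chart_at A (f j)) ` cball (snd (chart_at A (f j)) (f j)) (r (f j))"
      by metis
    have "restrict f {..<N} \<in> ?I" using f by auto
    moreover have "x \<in> V (restrict f {..<N})" using U[OF x] UE[OF x] f by (simp add: V_def)
    ultimately show "x \<in> (\<Union>f\<in>?I. Z f)" using Z(2) by blast
  qed
  ultimately show ?thesis by blast
qed

end

theorem lemma12:
  fixes A :: "('m::t2_space, 'e::finite_dim_space) chart set"
    and g :: "('m, 'e) metric_rep"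
    and n :: nat
    and t :: "nat \<Rightarrow> real"
    and p :: "nat \<Rightarrow> 'm"
    and \<tau> :: real
  assumes "riemannian_manifold A g"
    and "riem_complete A g"
    and "n \<ge> 1"
    and "t ` {..<n} \<subseteq> {0..1}"
    and "inj_on t {..<n}"
    and "\<tau> \<noteq> 0"
  shows "weakly_proper (tension_energy A g \<tau>) (H2_curves_through A n t p) (C1_topology A)"
  unfolding weakly_proper_def
proof (intro allI impI)
  interpret riemannian A g by unfold_locales (rule assms(1))
  fix U assume U: "U \<subseteq> H2_curves_through A n t p" and bdd: "bounded (tension_energy A g \<tau> ` U)"
  obtain C where C: "\<And>x. x \<in> U \<Longrightarrow> \<bar>tension_energy A g \<tau> x\<bar> \<le> C"
    using bdd unfolding bounded_iff by auto
  \<comment> \<open>Here \<open>n \<ge> 1\<close> enters: a single prescribed point common to all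
    curves anchors them.\<close>
  have "0 \<in> {..<n}" using assms(3) by simp
  then have "t 0 \<in> {0..1}" using assms(4) by blast
  moreover have "x \<in> H2_curves A \<and> x (t 0) = p 0 \<and> tension_energy A g \<tau> x \<le> C" if "x \<in> U" for x
    using U that C[OF that] assms(3) by (auto simp: H2_curves_through_def)
  ultimately obtain Z where Z: "compactin (C1_topology A) Z" "U \<subseteq> Z"
    using bounded_tension_energy_compact[OF assms(2,6), of "t 0" U "p 0" C] by blast
  have "C1_topology A closure_of U \<subseteq> Z"
    using closure_of_minimal[OF Z(2)] compactin_imp_closedin[OF Hausdorff_C1_topology Z(1)] by blast
  then show "compactin (C1_topology A) (C1_topology A closure_of U)"
    using closed_compactin[OF Z(1)] closedin_closure_of by blast
qed

end
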